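(* Fix an integer base $b\ge 2$. Let $f$ be a non-negative additive function that is almost constant on primes. If $0<y\le 1/2$, then $\theta_{f,y}$ is normal in base $b$. If $y>1/2$ and $f$ is also weakly additive, then $\theta_{f,y}$ is not normal in base $b$.
   Context: A real-valued function $f$ on the positive integers is additive if $f(mn)=f(m)+f(n)$ for all relatively prime $m,n$. Throughout, $p$ denotes primes. A fixed integer base $b\ge 2$ is used throughout. Almost constant on primes: a non-negative additive function $f$ is almost constant on primes if there exist $c>0$ and $0<\delta<1/2$ such that for all small (i.e. all sufficiently small) $\epsilon>0$, $$\exp\left(\sum_{p\le x}\frac{B_\epsilon(x,p)}{p^{1-\delta}}\right)=o(\log x),\qquad x\to\infty,$$ where $B_\epsilon(x,p)=\min\left\{2,\ \dfrac{1}{(\log\log x)^{\epsilon/4}}|f(p)-c|\right\}$. Weakly additive: a non-negative additive function $f$ is weakly additive if for all small (i.e. all sufficiently small) $\epsilon>0$, $$\prod_{p\le x}\left(1-\sum_{p^k\le x,\ k\ge 2}\frac{C_\epsilon(x,p,k)}{p^k}\right)=1+o(1),\qquad x\to\infty,$$ where $C_\epsilon(x,p,k)=\min\left\{2,\ \dfrac{1}{(\log\log x)^{1+\epsilon/4}}|f(p^k)-f(p^{k-1})-f(p)|\right\}$. Normality: a real number $z$ with fractional part $\{z\}=0.z_1z_2z_3\dots$ written in base $b$ is normal (in base $b$) if for every $k\ge 1$ and every string $a_1a_2\dots a_k$ of $k$ base $b$ digits, $$\lim_{x\to\infty}\frac{\#\{1\le n\le x-k : z_{n-1+i}=a_i,\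 1\le i\le k\}}{x}=b^{-k}.$$ Truncation: for real $z\ge 0$ and a positive integer $m$, $T_b(z,m)$ is the string of the last $m$ base $b$ digits of $\lfloor z\rfloor$, padded with zeros at the head if $\lfloor z\rfloor$ has fewer than $m$ digits, so that the string has length exactly $m$ (e.g. $T_{10}(151,2)=(51)$, $T_{10}(1,2)=(01)$, $T_{10}(0.5,2)=(00)$). For $y>0$ let $K_y(x)=\left\lceil y\,\dfrac{\log\log\log x}{\log b}\right\rceil$ if $x>e^e$, and $K_y(x)=1$ otherwise. For a non-negative additive function $f$ let $f_y(n)=T_b(f(n),K_y(n))$, a string of $K_y(n)$ digits, and let $$\theta_{f,y}=0.(f_y(1))(f_y(2))(f_y(3))(f_y(4))\dots$$ be the real number whose base $b$ expansion after the point is the concatenation of the digit strings $f_y(1),f_y(2),f_y(3),\dots$ in order. *)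

theory Defs
  imports
    Complex_Main
    "HOL-Library.Landau_Symbols"
    "HOL-Computational_Algebra.Primes"
begin

text \<open>
  Functions on the positive integers are represented by functions on \<^typ>\<open>nat\<close>; the value at
  \<open>0\<close> is never used.
\<close>

definition additive_fun :: "(nat \<Rightarrow> real) \<Rightarrow> bool" where
  "additive_fun f \<longleftrightarrow> (\<forall>m>0. \<forall>n>0. coprime m n \<longrightarrow> f (m * n) = f m + f n)"

definition nonneg_fun :: "(nat \<Rightarrow> real) \<Rightarrow> bool" where
  "nonneg_fun f \<longleftrightarrow> (\<forall>n>0. 0 \<le> f n)"

definition B_eps :: "(nat \<Rightarrow> real) \<Rightarrow> real \<Rightarrow> real \<Rightarrow> real \<Rightarrow> nat \<Rightarrow> real" where
  "B_eps f c \<epsilon> x p = min 2 (1 / (ln (ln x)) powr (\<epsilon> / 4) * \<bar>f p - c\<bar>)"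

definition almost_constant_on_primes :: "(nat \<Rightarrow> real) \<Rightarrow> bool" where
  "almost_constant_on_primes f \<longleftrightarrow>
    (\<exists>c \<delta>. 0 < c \<and> 0 < \<delta> \<and> \<delta> < 1/2 \<and>
      (\<exists>\<epsilon>\<^sub>0>0. \<forall>\<epsilon>. 0 < \<epsilon> \<and> \<epsilon> < \<epsilon>\<^sub>0 \<longrightarrow>
        (\<lambda>x::real. exp (\<Sum>p | prime p \<and> real p \<le> x. B_eps f c \<epsilon> x p / real p powr (1 - \<delta>)))
          \<in> o[at_top](\<lambda>x. ln x)))"

definition C_eps :: "(nat \<Rightarrow> real) \<Rightarrow> real \<Rightarrow> real \<Rightarrow> nat \<Rightarrow> nat \<Rightarrow> real" where
  "C_eps f \<epsilon> x p k =
    min 2 (1 / (ln (ln x)) powr (1 + \<epsilon> / 4) * \<bar>f (p ^ k) - f (p ^ (k - 1)) - f p\<bar>)"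

definition weakly_additive :: "(nat \<Rightarrow> real) \<Rightarrow> bool" where
  "weakly_additive f \<longleftrightarrow>
    (\<exists>\<epsilon>\<^sub>0>0. \<forall>\<epsilon>. 0 < \<epsilon> \<and> \<epsilon> < \<epsilon>\<^sub>0 \<longrightarrow>
      ((\<lambda>x::real. \<Prod>p | prime p \<and> real p \<le> x.
          1 - (\<Sum>k | 2 \<le> k \<and> real (p ^ k) \<le> x. C_eps f \<epsilon> x p k / real p ^ k)) \<longlongrightarrow> 1) at_top)"

text \<open>
  The \<open>n\<close>-th digit (\<open>n \<ge> 1\<close>) after the point of the fractional part of \<open>z\<close> in base \<open>b\<close>. A number
  with two expansions gets the terminating one; such a number is not normal with either.
\<close>

definition digit :: "nat \<Rightarrow> real \<Rightarrow> nat \<Rightarrow> nat" where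
  "digit b z n = nat \<lfloor>real b ^ n * frac z\<rfloor> mod b"

text \<open>
  A string \<open>a\<^sub>1 \<dots> a\<^sub>k\<close> is a list, indexed from \<open>0\<close>, hence the \<open>a ! (i - 1)\<close>.
\<close>

definition normal_in_base :: "nat \<Rightarrow> real \<Rightarrow> bool" where
  "normal_in_base b z \<longleftrightarrow>
    (\<forall>k\<ge>1. \<forall>a. length a = k \<and> set a \<subseteq> {..<b} \<longrightarrow>
      ((\<lambda>x::real. real (card {n::nat. 1 \<le> n \<and> real n \<le> x - real k \<and>
            (\<forall>i\<in>{1..k}. digit b z (n - 1 + i) = a ! (i - 1))}) / x)
        \<longlongrightarrow> 1 / real b ^ k) at_top)"

text \<open>Most significant digit first.\<close>

definition T_base :: "nat \<Rightarrow> real \<Rightarrow> nat \<Rightarrow> nat list" where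
  "T_base b z m = map (\<lambda>j. nat \<lfloor>z\<rfloor> div b ^ j mod b) (rev [0..<m])"

definition K_len :: "nat \<Rightarrow> real \<Rightarrow> real \<Rightarrow> nat" where
  "K_len b y x =
    (if x > exp (exp 1) then nat \<lceil>y * (ln (ln (ln x)) / ln (real b))\<rceil> else 1)"

definition trunc_string :: "nat \<Rightarrow> (nat \<Rightarrow> real) \<Rightarrow> real \<Rightarrow> nat \<Rightarrow> nat list" where
  "trunc_string b f y n = T_base b (f n) (K_len b y (real n))"

text \<open>
  The \<open>n\<close>-th digit (\<open>n \<ge> 1\<close>) of the infinite concatenation of the strings of \<open>1, 2, 3, \<dots>\<close>. For
  \<open>b \<ge> 2\<close> and \<open>y > 0\<close> all strings are nonempty, so the first \<open>n\<close> of them already contain at least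
  \<open>n\<close> digits, and longer concatenations give the same digit: see \<open>theta_digit_eq\<close> below.
\<close>

definition theta_digit :: "nat \<Rightarrow> (nat \<Rightarrow> real) \<Rightarrow> real \<Rightarrow> nat \<Rightarrow> nat" where
  "theta_digit b f y n = concat (map (trunc_string b f y) [1..<n + 1]) ! (n - 1)"

definition theta :: "nat \<Rightarrow> (nat \<Rightarrow> real) \<Rightarrow> real \<Rightarrow> real" where
  "theta b f y = (\<Sum>n. real (theta_digit b f y (Suc n)) / real b ^ Suc n)"

lemma length_T_base [simp]: "length (T_base b z m) = m"
  by (simp add: T_base_def)

lemma K_len_pos:
  assumes "b \<ge> 2" "y > 0"
  shows   "K_len b y x > 0"
proof (cases "x > exp (exp 1)")
  case True
  have "ln x > exp 1"
    using True by (smt (verit) exp_gt_zero ln_exp ln_less_cancel_iff)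
  hence "ln (ln x) > 1"
    by (smt (verit) exp_gt_zero ln_exp ln_less_cancel_iff)
  hence "y * (ln (ln (ln x)) / ln (real b)) > 0"
    using assms by simp
  thus ?thesis
    using True by (simp add: K_len_def)
qed (simp add: K_len_def)

lemma length_concat_trunc_string:
  assumes "b \<ge> 2" "y > 0"
  shows   "n \<le> length (concat (map (trunc_string b f y) [1..<n + 1]))"
proof (induction n)
  case (Suc n)
  thus ?case
    using K_len_pos[OF assms, of "real (Suc n)"] by (simp add: trunc_string_def)
qed simp

lemma theta_digit_eq:
  assumes "b \<ge> 2" "y > 0" "1 \<le> n" "n \<le> N"
  shows   "theta_digit b f y n = concat (map (trunc_string b f y) [1..<N + 1]) ! (n - 1)"
proof -
  have "[1..<N + 1] = [1..<n + 1] @ [n + 1..<N + 1]"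
    using upt_add_eq_append[of 1 "n + 1" "N - n"] assms by simp
  moreover have "n - 1 < length (concat (map (trunc_string b f y) [1..<n + 1]))"
    using length_concat_trunc_string[OF assms(1,2), of n f] assms(3) by linarith
  ultimately show ?thesis
    unfolding theta_digit_def by (simp add: nth_append del: upt_Suc)
qed

end

(*
  Write l = ln (ln N).  The hypothesis forces the sum of min 1 |f p - c| / p over the primes to
  converge, so outside a set of small density f n differs from c * omega(n) by a bounded amount.
  Discarding the primes above N^(1 / (4 l)) changes omega(n) by O(ln l) on average, and for the
  remaining primes the characteristic function of omega at a frequency t is computed by truncating
  the binomial expansion of (1 + (exp (i t) - 1))^omega after about l terms.  It tends to 0 as soon as
  t^2 l tends to infinity.  Hence f n is equidistributed modulo every M between l^e and l^(1/2 - e),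
  and the digits of f n at positions between e log_b l and (1/2 - e) log_b l are equidistributed.
  For y <= 1/2 these are almost all of the digits that are kept.

  If y > 1/2, then a positive proportion of the kept digits lies above position (1/2) log_b l.  By
  Turan's inequality f n is within O(sqrt l) of its mean for most n.  Choosing N such that the mean
  lies slightly above a power of b makes almost all of these upper digits zero, so zeros are too
  frequent along a sequence of initial segments.
*)

theory Submission
  imports
    Defs
    "HOL-Analysis.Analysis"
    "HOL-Real_Asymp.Real_Asymp"
    "HOL-Computational_Algebra.Squarefree"
begin

section \<open>Sums over primes\<close>

text \<open>No limit law for \<open>f\<close> enters. Equidistribution modulo \<open>M\<close>
  involves only boundedly many multiples of the frequency 1 / M, and the two bounds on
  \<open>M\<close> serve different ends. \<open>M\<close> below l^(1/2 - e) makes the main term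
  decay. \<open>M\<close> above l^e keeps the frequency small: the truncated expansion then
  converges within l terms, and neither the O(ln l) lost with the large primes nor the bounded
  distance of f from a multiple of omega moves the phase. Crude constants in sums over primes
  suffice, since only the order of t^2 l matters. Two dependences shape the statements. The modulus
  varies with N and with the digit position, so exponential sums are bounded for all
  \<open>M\<close> in the window at once, and Weyl's criterion is stated for finite families with
  thresholds independent of the family. The blocks differ in length, but a triple logarithm is
  almost constant on [sqrt N, N], so every n up to N may be given the length belonging to N. The
  real number has the digits of the concatenation only if these do not end in a tail of b - 1; in
  both halves a count of zeros excludes this.\<close>

lemma prod_primes_dvd:
  fixes n :: nat
  assumes "finite S" "\<And>p. p \<in> S \<Longrightarrow> prime p" "\<And>p. p \<in> S \<Longrightarrow> p dvd n"
  shows "\<Prod>S dvd n"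
  using assms
proof (induction S rule: finite_induct)
  case (insert p S)
  have "coprime p (\<Prod>S)"
    by (rule prod_coprime_right) (use insert in \<open>auto intro!: primes_coprime\<close>)
  with insert show ?case by (auto intro: divides_mult)
qed auto

lemma prod_primes_dvd_iff:
  fixes n :: nat
  assumes "finite S" "\<And>p. p \<in> S \<Longrightarrow> prime p"
  shows "\<Prod>S dvd n \<longleftrightarrow> (\<forall>p\<in>S. p dvd n)"
  using prod_primes_dvd[OF assms] assms(1) by (meson dvd_prod_eqI dvd_trans)

lemma card_multiples:
  fixes d :: nat
  assumes "d > 0"
  shows "card {n\<in>{1..N}. d dvd n} = N div d"
proof -
  have "{n\<in>{1..N}. d dvd n} = (\<lambda>k. d * k) ` {1..N div d}"
  proof (intro equalityI subsetI)
    fix n assume n: "n \<in> {n\<in>{1..N}. d dvd n}"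
    then obtain k where k: "n = d * k" by blast
    have "k \<le> N div d" using n k assms by (simp add: less_eq_div_iff_mult_less_eq mult.commute)
    moreover have "k \<ge> 1" using n k by (cases k) auto
    ultimately show "n \<in> (\<lambda>k. d * k) ` {1..N div d}" using k by auto
  next
    fix n assume "n \<in> (\<lambda>k. d * k) ` {1..N div d}"
    then obtain k where k0: "n = d * k" "k \<in> {1..N div d}" by (rule imageE)
    hence k: "n = d * k" "1 \<le> k" "k \<le> N div d" by simp_all
    then have "d * k \<le> N" using assms by (simp add: less_eq_div_iff_mult_less_eq mult.commute)
    with k assms show "n \<in> {n\<in>{1..N}. d dvd n}" by (cases k) auto
  qed
  moreover have "inj_on (\<lambda>k. d * k) {1..N div d}" using assms by (auto simp: inj_on_def)
  ultimately show ?thesis by (simp add: card_image)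
qed

lemma card_multiples_le:
  assumes "d > 0"
  shows "real (card {n\<in>{1..N}. d dvd n}) \<le> real N / real d"
  using card_multiples[OF assms, of N] using of_nat_div_le_of_nat[of N d, where 'a = real] by simp

lemma card_multiples_ge:
  assumes "d > 0"
  shows "real (card {n\<in>{1..N}. d dvd n}) \<ge> real N / real d - 1"
proof -
  have "real N / real d < real (N div d) + 1"
  proof -
    have "N < d * (N div d + 1)" using assms
      by (metis add.commute dividend_less_times_div mult.commute mult_Suc_right plus_1_eq_Suc)
    hence "real N < real d * (real (N div d) + 1)" 
      by (metis of_nat_1 of_nat_add of_nat_less_iff of_nat_mult)
    thus ?thesis using assms by (simp add: field_simps)
  qed
  thus ?thesis using card_multiples[OF assms, of N] by simp
qed

text \<open>Chebyshev's argument: a prime in (n, 2n] divides (2n)! but not n!, hence divides the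
  central binomial coefficient, which is at most 4^n.\<close>

lemma prod_primes_dyadic:
  fixes n :: nat
  shows "(\<Prod>p | prime p \<and> n < p \<and> p \<le> 2 * n. p) \<le> 4 ^ n"
proof -
  let ?S = "{p. prime p \<and> n < p \<and> p \<le> 2 * n}"
  have fin: "finite ?S" by (rule finite_subset[of _ "{..2*n}"]) auto
  have "\<Prod>?S dvd (2 * n choose n)"
  proof (rule prod_primes_dvd[OF fin])
    fix p assume p: "p \<in> ?S"
    have "fact (2*n) = fact n * fact n * (2 * n choose n)"
      using binomial_fact_lemma[of n "2*n"] by (simp add: mult.assoc)
    moreover have "p dvd (fact (2*n) :: nat)" using p by (auto simp: prime_dvd_fact_iff)
    moreover have "\<not> p dvd (fact n :: nat)" using p by (auto simp: prime_dvd_fact_iff)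
    ultimately show "p dvd (2 * n choose n)" using p
      by (metis mem_Collect_eq prime_dvd_mult_iff)
  qed auto
  moreover have "(2 * n choose n) > 0" by simp
  ultimately have "\<Prod>?S \<le> (2 * n choose n)" by (meson dvd_imp_le)
  also have "\<dots> \<le> 2 ^ (2 * n)" by (rule binomial_le_pow2)
  finally show ?thesis by (simp add: power_mult)
qed

text \<open>All primes in the block exceed 2^i, so their product bounds their number by 2 * 2^i / i,
  and each reciprocal is at most 2^(-i).\<close>

lemma sum_primes_dyadic:
  assumes "i \<ge> 1"
  shows "(\<Sum>p | prime p \<and> 2 ^ i < p \<and> p \<le> (2::nat) ^ Suc i. 1 / real p) \<le> 2 / real i"
proof -
  let ?n = "(2::nat) ^ i"
  let ?S = "{p. prime p \<and> ?n < p \<and> p \<le> 2 * ?n}"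
  have fin: "finite ?S" by (rule finite_subset[of _ "{..2*?n}"]) auto
  have "?n ^ card ?S = (\<Prod>p\<in>?S. ?n)" by simp
  also have "\<dots> \<le> \<Prod>?S" by (rule prod_mono) auto
  also have "\<dots> \<le> 4 ^ ?n" by (rule prod_primes_dyadic)
  also have "(4::nat) ^ ?n = 2 ^ (2 * ?n)" by (simp add: power_mult)
  finally have "i * card ?S \<le> 2 * ?n"
    by (simp add: power_mult [symmetric] del: power_Suc)
  hence "real (i * card ?S) \<le> real (2 * ?n)"
    by (rule of_nat_mono)
  hence c: "real i * real (card ?S) \<le> 2 * real ?n"
    by (simp only: of_nat_mult of_nat_numeral)
  have "(\<Sum>p\<in>?S. 1 / real p) \<le> (\<Sum>p\<in>?S. 1 / real ?n)"
    by (intro sum_mono) (auto intro!: divide_left_mono)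
  also have "\<dots> = real (card ?S) / real ?n" by simp
  also have "\<dots> \<le> 2 / real i" using c assms by (simp add: field_simps)
  finally show ?thesis by simp
qed

lemma sum_UN_le:
  fixes g :: "'a \<Rightarrow> real"
  assumes "finite I" "\<And>i. i \<in> I \<Longrightarrow> finite (D i)" "\<And>x. 0 \<le> g x"
  shows "sum g (\<Union>i\<in>I. D i) \<le> (\<Sum>i\<in>I. sum g (D i))"
  using assms(1,2)
proof (induction I rule: finite_induct)
  case (insert i I)
  have "sum g (D i \<union> (\<Union>i\<in>I. D i)) \<le> sum g (D i) + sum g (\<Union>i\<in>I. D i)"
    using insert assms(3) by (subst sum_Un) (auto intro!: sum_nonneg)
  with insert show ?case by auto
qed simp

lemma harm_diff_le:
  fixes a b :: nat
  assumes "1 \<le> a" "a \<le> b"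
  shows "(\<Sum>i=a..b. 1 / real i) \<le> 1 / real a + ln (real b / real a)"
  using assms(2)
proof (induction b rule: dec_induct)
  case base thus ?case using assms by simp
next
  case (step n)
  have n: "n \<ge> 1" using step assms by simp
  have "1 / real (Suc n) \<le> ln (real (Suc n) / real n)"
  proof -
    have "ln (real n / real (Suc n)) \<le> real n / real (Suc n) - 1"
      using n by (intro ln_le_minus_one) auto
    also have "\<dots> = - 1 / real (Suc n)" by (simp add: field_simps)
    finally show ?thesis using n by (simp add: ln_div)
  qed
  moreover have "ln (real (Suc n) / real a) = ln (real (Suc n) / real n) + ln (real n / real a)"
    using n assms by (simp add: ln_div)
  ultimately show ?case using step by simp
qed

text \<open>Summing the dyadic bounds 2 / i for i between log_2 x and log_2 y gives a difference of
  double logarithms. The factor 2 lost against Mertens' theorem is harmless: the bound serves only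
  to show that the discarded primes contribute O(ln (ll N)) and all primes O(ll N).\<close>

lemma sum_primes_between:
  fixes x y :: real
  assumes "2 \<le> x" "x \<le> y"
  shows "(\<Sum>p | prime p \<and> x < real p \<and> real p \<le> y. 1 / real p) \<le> 4 + 2 * ln (ln y / ln x)"
proof -
  define a where "a = nat \<lfloor>log 2 x\<rfloor>"
  define b where "b = nat \<lfloor>log 2 y\<rfloor>"
  have lx: "log 2 x \<ge> 1" using assms by simp
  have ly: "log 2 y \<ge> log 2 x" using assms by simp
  have a: "real a \<le> log 2 x" "log 2 x < real a + 1" "a \<ge> 1"
    unfolding a_def using lx by (auto simp: le_nat_floor)
  have b: "real b \<le> log 2 y" "log 2 y < real b + 1" "b \<ge> a"
    unfolding a_def b_def using lx ly by (auto intro!: nat_mono floor_mono)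
  have ax: "2 ^ a \<le> x" using a(1) assms by (simp add: le_log_iff powr_realpow)
  have yb: "y < 2 ^ Suc b" 
    using b(2) assms less_log_iff[of 2 y "real (Suc b)"]  by (simp add: log_less_iff powr_add powr_realpow)
  let ?D = "\<lambda>i. {p. prime p \<and> 2 ^ i < p \<and> p \<le> (2::nat) ^ Suc i}"
  have finD: "finite (?D i)" for i by (rule finite_subset[of _ "{..2^Suc i}"]) auto
  have sub: "{p. prime p \<and> x < real p \<and> real p \<le> y} \<subseteq> (\<Union>i\<in>{a..b}. ?D i)"
  proof
    fix p assume "p \<in> {p. prime p \<and> x < real p \<and> real p \<le> y}"
    hence p: "prime p" "x < real p" "real p \<le> y" by auto
    have "2 ^ a < real p" using ax p by linarith
    hence pa: "2 ^ a < p" by (metis of_nat_less_numeral_power_cancel_iff numeral_power_less_of_nat_cancel_iff)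
    have "real p < 2 ^ Suc b" using yb p by linarith
    hence pb: "p < 2 ^ Suc b" by (metis of_nat_less_numeral_power_cancel_iff)
    \<comment> \<open>The dyadic block of \<open>p\<close>. Minimality gives 2^i < p only for i > a;
      at i = a this comes from 2^a \<le> x < p.\<close>
    define i where "i = (LEAST i. p \<le> 2 ^ Suc i)"
    have i1: "p \<le> 2 ^ Suc i" unfolding i_def by (rule LeastI[of _ b]) (use pb in auto)
    have i2: "i \<le> b" unfolding i_def by (rule Least_le) (use pb in auto)
    have i3: "a \<le> i"
    proof (rule ccontr)
      assume "\<not> a \<le> i"
      hence "(2::nat) ^ Suc i \<le> 2 ^ a" by (intro power_increasing) auto
      with i1 pa show False by linarith
    qed
    have i4: "2 ^ i < p"
    proof (cases "i = a")
      case False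
      then obtain j where j: "i = Suc j" using i3 a(3) by (cases i) auto
      have "\<not> p \<le> 2 ^ Suc j" using not_less_Least[of j "\<lambda>i. p \<le> 2 ^ Suc i"] j i_def by simp
      thus ?thesis using j by simp
    qed (use pa in simp)
    show "p \<in> (\<Union>i\<in>{a..b}. ?D i)" using i1 i2 i3 i4 p by auto
  qed
  have "(\<Sum>p | prime p \<and> x < real p \<and> real p \<le> y. 1 / real p) \<le> (\<Sum>p\<in>(\<Union>i\<in>{a..b}. ?D i). 1 / real p)"
    by (rule sum_mono2) (use sub finD in auto)
  also have "\<dots> \<le> (\<Sum>i=a..b. \<Sum>p\<in>?D i. 1 / real p)"
    by (rule sum_UN_le) (use finD in auto)
  also have "\<dots> \<le> (\<Sum>i=a..b. 2 / real i)"
    by (intro sum_mono sum_primes_dyadic) (use a in auto)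
  also have "\<dots> = 2 * (\<Sum>i=a..b. 1 / real i)" by (simp add: sum_distrib_left)
  also have "\<dots> \<le> 2 * (1 / real a + ln (real b / real a))"
    using harm_diff_le[OF a(3) b(3)] by simp
  also have "1 / real a \<le> 1" using a by simp
  also have "ln (real b / real a) \<le> ln (2 * (ln y / ln x))"
  proof -
    \<comment> \<open>Since 1 \<le> a and log_2 x < a + 1, also a \<ge> log_2 x / 2. The resulting
      ln 2 and the term 1 / a are each rounded up to 1, and the doubling turns them into the
      4.\<close>
    have "real b / real a \<le> log 2 y / (log 2 x / 2)"
      by (intro frac_le) (use a b lx in linarith)+
    also have "\<dots> = 2 * (ln y / ln x)" by (simp add: log_def)
    finally have le: "real b / real a \<le> 2 * (ln y / ln x)" .
    have "0 < real b / real a" using a b by simp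
    with le show ?thesis by (metis ln_mono)
  qed
  also have "ln (2 * (ln y / ln x)) = ln 2 + ln (ln y / ln x)"
    using assms by (subst ln_mult) auto
  also have "ln 2 \<le> (1::real)" using ln_2_less_1 by simp
  finally show ?thesis by simp
qed

text \<open>The variable \<open>u\<close> marks the number of chosen elements. Every passage between
  sums over sets of primes and Euler-type products goes through this identity, with \<open>u\<close>
  equal to 1, to a non-negative weight, or to \<open>cis t - 1\<close>.\<close>

lemma sum_Pow_power:
  fixes u :: "'a::comm_semiring_1"
  assumes "finite P"
  shows "(\<Sum>S\<in>Pow P. u ^ card S * (\<Prod>p\<in>S. g p)) = (\<Prod>p\<in>P. 1 + u * g p)"
proof -
  have "(\<Prod>p\<in>P. u * g p + 1) = (\<Sum>S\<in>Pow P. (\<Prod>p\<in>S. u * g p) * (\<Prod>p\<in>P-S. 1))"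
    by (rule prod_add[OF assms])
  also have "\<dots> = (\<Sum>S\<in>Pow P. u ^ card S * (\<Prod>p\<in>S. g p))"
    by (simp add: prod.distrib)
  finally show ?thesis by (simp add: add.commute)
qed

section \<open>A lower bound for the sum of the reciprocals of the primes\<close>

lemma sum_inverse_squares_le: "(\<Sum>t=1..N. 1 / real t ^ 2) \<le> 2"
proof -
  have "(\<Sum>t=1..N. 1 / real t ^ 2) \<le> 2 - 1 / real N" if "N \<ge> 1"
    using that
  proof (induction N rule: nat_induct_at_least)
    case (Suc n)
    have "1 / real (Suc n) ^ 2 \<le> 1 / (real n * real (Suc n))"
      using Suc by (intro divide_left_mono) (auto simp: power2_eq_square)
    also have "\<dots> = 1 / real n - 1 / real (Suc n)"
      using Suc by (simp add: field_simps)
    finally show ?case using Suc by simp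
  qed simp
  thus ?thesis by (cases "N \<ge> 1") (auto intro: order_trans)
qed

lemma squarefree_prod_prime_factors:
  fixes s :: nat
  assumes "squarefree s"
  shows "\<Prod>(prime_factors s) = s"
proof -
  have s: "s \<noteq> 0" using assms by (metis not_squarefree_0)
  have "s = (\<Prod>p\<in>prime_factors s. p ^ multiplicity p s)"
    using s by (simp add: prod_prime_factors)
  also have "\<dots> = (\<Prod>p\<in>prime_factors s. p)"
  proof (rule prod.cong)
    fix p assume "p \<in> prime_factors s"
    hence "multiplicity p s = 1" using assms s
      using squarefree_factorial_semiring''[of s] prime_factors_multiplicity[of s]
      by (auto simp: le_less s)
    thus "p ^ multiplicity p s = p" by simp
  qed simp
  finally show ?thesis by simp
qed

text \<open>Each n \<le> N is a squarefree number times a square, so the harmonic sum up to N is at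
  most the product of 1 + 1/p over p \<le> N times the sum of 1 / t^2. The latter is at most 2, and
  1 + v \<le> exp v handles the product.\<close>

lemma ln_le_exp_sum_primes:
  assumes "N \<ge> 1"
  shows "ln (real N) \<le> 2 * exp (\<Sum>p | prime p \<and> p \<le> N. 1 / real p)"
proof -
  let ?P = "{p. prime p \<and> p \<le> N}"
  let ?h = "\<lambda>n::nat. (prime_factors (squarefree_part n), square_part n)"
  \<comment> \<open>The idle factor \<open>1 ^ card S\<close> gives the summand the shape of
    \<open>sum_Pow_power\<close> with u = 1.\<close>
  let ?g = "\<lambda>(S, t). (1 ^ card S * (\<Prod>p\<in>S. 1 / real p)) * (1 / real t ^ 2)"
  have fin: "finite ?P" by simp
  have gh: "1 / real n = ?g (?h n)" for n :: nat
  proof -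
    have "real (squarefree_part n * square_part n ^ 2) = real (squarefree_part n) * real (square_part n) ^ 2"
      by (simp only: of_nat_mult of_nat_power)
    hence "real n = real (squarefree_part n) * real (square_part n) ^ 2"
      by (simp only: squarefree_decompose[of n, symmetric])
    moreover have "real (squarefree_part n) = (\<Prod>p\<in>prime_factors (squarefree_part n). real p)"
      by (simp only: of_nat_prod[symmetric] squarefree_prod_prime_factors[OF squarefree_squarefree_part])
    ultimately have "real n = (\<Prod>p\<in>prime_factors (squarefree_part n). real p) * real (square_part n) ^ 2" by (simp only:)
    thus ?thesis by (simp add: prod_dividef)
  qed
  have inj: "inj_on ?h {1..N}"
  proof (rule inj_onI)
    fix m n assume h: "?h m = ?h n"
    have "squarefree_part m = \<Prod>(prime_factors (squarefree_part m))"
      by (rule squarefree_prod_prime_factors[OF squarefree_squarefree_part, symmetric])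
    also have "\<dots> = \<Prod>(prime_factors (squarefree_part n))" using h by (simp only: prod.inject)
    also have "\<dots> = squarefree_part n"
      by (rule squarefree_prod_prime_factors[OF squarefree_squarefree_part])
    finally have 1: "squarefree_part m = squarefree_part n" .
    have 2: "square_part m = square_part n" using h by (simp only: prod.inject)
    from 1 2 have "squarefree_part m * square_part m ^ 2 = squarefree_part n * square_part n ^ 2" by simp
    thus "m = n" by (simp only: squarefree_decompose[symmetric])
  qed
  have sub: "?h ` {1..N} \<subseteq> Pow ?P \<times> {1..N}"
  proof (intro image_subsetI)
    fix n assume n: "n \<in> {1..N}"
    have d: "n = squarefree_part n * square_part n ^ 2" by (rule squarefree_decompose)
    have "p \<le> N" if "p \<in> prime_factors (squarefree_part n)" for p
    proof -
      have "p dvd n" using that by (subst d) (auto simp: in_prime_factors_iff)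
      thus ?thesis using n by (auto dest!: dvd_imp_le)
    qed
    moreover have "square_part n \<le> N"
    proof -
      have "square_part n dvd n" by (subst (2) d) (simp add: power2_eq_square)
      thus ?thesis using n by (auto dest!: dvd_imp_le)
    qed
    moreover have "square_part n \<ge> 1"
    proof -
      have "square_part n \<noteq> 0" using n by (subst square_part_0_iff) auto
      thus ?thesis by linarith
    qed
    ultimately show "?h n \<in> Pow ?P \<times> {1..N}" by auto
  qed
  have "ln (real N) \<le> ln (real N + 1)" using assms by simp
  also have "\<dots> \<le> harm N" by (rule ln_le_harm)
  also have "harm N = (\<Sum>n=1..N. 1 / real n)" by (simp add: harm_def inverse_eq_divide)
  also have "\<dots> = (\<Sum>n=1..N. ?g (?h n))" by (rule sum.cong[OF refl gh])
  also have "\<dots> = sum ?g (?h ` {1..N})" by (simp only: sum.reindex[OF inj] o_def)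
  also have "\<dots> \<le> sum ?g (Pow ?P \<times> {1..N})"
    by (rule sum_mono2) (use sub fin in \<open>auto intro!: divide_nonneg_nonneg prod_nonneg\<close>)
  also have "\<dots> = (\<Sum>S\<in>Pow ?P. 1 ^ card S * (\<Prod>p\<in>S. 1 / real p)) * (\<Sum>t=1..N. 1 / real t ^ 2)"
    unfolding sum_product sum.cartesian_product by (rule sum.cong) auto
  also have "\<dots> = (\<Prod>p\<in>?P. 1 + 1 * (1 / real p)) * (\<Sum>t=1..N. 1 / real t ^ 2)"
    by (subst sum_Pow_power[OF fin]) simp
  also have "\<dots> \<le> exp (\<Sum>p\<in>?P. 1 / real p) * 2"
  proof (rule mult_mono)
    have "(\<Prod>p\<in>?P. 1 + 1 * (1 / real p)) \<le> (\<Prod>p\<in>?P. exp (1 / real p))"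
      by (intro prod_mono) auto
    thus "(\<Prod>p\<in>?P. 1 + 1 * (1 / real p)) \<le> exp (\<Sum>p\<in>?P. 1 / real p)"
      by (simp add: exp_sum)
  qed (use sum_inverse_squares_le in \<open>auto intro!: sum_nonneg\<close>)
  finally show ?thesis by simp
qed

section \<open>Exponential moments of the number of prime divisors from a finite set\<close>

definition om :: "nat set \<Rightarrow> nat \<Rightarrow> nat" where
  "om P n = card {p\<in>P. p dvd n}"

text \<open>A set of primes consists of divisors of n exactly if its product divides n. The binomial
  expansion thus becomes a combination of divisibility indicators, whose sums over n are counts of
  multiples.\<close>

lemma power_om_eq:
  fixes u :: "'a::comm_semiring_1"
  assumes "finite P" "\<And>p. p \<in> P \<Longrightarrow> prime p"
  shows "(1 + u) ^ om P n = (\<Sum>S\<in>Pow P. if \<Prod>S dvd n then u ^ card S else 0)"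
proof -
  let ?T = "{p\<in>P. p dvd n}"
  have "(1 + u) ^ om P n = (\<Prod>p\<in>?T. 1 + u * 1)" by (simp add: om_def)
  also have "\<dots> = (\<Sum>S\<in>Pow ?T. u ^ card S)"
    using assms(1) by (subst sum_Pow_power[symmetric]) auto
  also have "Pow ?T = {S\<in>Pow P. \<Prod>S dvd n}"
  proof -
    have "S \<subseteq> ?T \<longleftrightarrow> S \<subseteq> P \<and> \<Prod>S dvd n" for S
    proof (cases "S \<subseteq> P")
      case True
      then have "\<Prod>S dvd n \<longleftrightarrow> (\<forall>p\<in>S. p dvd n)"
        using assms by (intro prod_primes_dvd_iff) (auto dest: finite_subset)
      thus ?thesis using True by auto
    qed auto
    thus ?thesis by auto
  qed
  also have "(\<Sum>S\<in>{S\<in>Pow P. \<Prod>S dvd n}. u ^ card S) = (\<Sum>S\<in>Pow P. if \<Prod>S dvd n then u ^ card S else 0)"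
    using assms(1) by (intro sum.inter_filter) auto
  finally show ?thesis .
qed

lemma prod_primes_pos:
  assumes "S \<subseteq> P" "\<And>p. p \<in> P \<Longrightarrow> prime (p::nat)"
  shows "\<Prod>S > 0"
  using assms by (intro prod_pos) (auto simp: prime_gt_0_nat)

text \<open>For v \<ge> 0 all terms are non-negative, so each count of multiples can be replaced by
  N / d with no error term and no restriction on the size of \<open>P\<close>. The bound serves as
  majorant for the truncation error.\<close>

lemma sum_power_om_le:
  fixes v :: real
  assumes "finite P" "\<And>p. p \<in> P \<Longrightarrow> prime p" "v \<ge> 0"
  shows "(\<Sum>n=1..N. (1 + v) ^ om P n) \<le> real N * exp (v * (\<Sum>p\<in>P. 1 / real p))"
proof -
  have "(\<Sum>n=1..N. (1 + v) ^ om P n) = (\<Sum>n=1..N. \<Sum>S\<in>Pow P. if \<Prod>S dvd n then v ^ card S else 0)"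
    by (simp add: power_om_eq[OF assms(1,2)])
  also have "\<dots> = (\<Sum>S\<in>Pow P. \<Sum>n=1..N. if \<Prod>S dvd n then v ^ card S else 0)"
    by (rule sum.swap)
  also have "\<dots> = (\<Sum>S\<in>Pow P. v ^ card S * real (card {n\<in>{1..N}. \<Prod>S dvd n}))"
    by (intro sum.cong refl, subst sum.inter_filter[symmetric]) (auto simp: mult.commute)
  also have "\<dots> \<le> (\<Sum>S\<in>Pow P. v ^ card S * (real N / real (\<Prod>S)))"
    using prod_primes_pos[OF _ assms(2)] assms(3)
    by (intro sum_mono mult_left_mono card_multiples_le) auto
  also have "\<dots> = real N * (\<Sum>S\<in>Pow P. v ^ card S * (\<Prod>p\<in>S. 1 / real p))"
    by (simp add: sum_distrib_left prod_dividef mult_ac of_nat_prod)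
  also have "\<dots> = real N * (\<Prod>p\<in>P. 1 + v * (1 / real p))"
    by (subst sum_Pow_power[OF assms(1)]) simp
  also have "(\<Prod>p\<in>P. 1 + v * (1 / real p)) \<le> (\<Prod>p\<in>P. exp (v * (1 / real p)))"
    using assms by (intro prod_mono) auto
  also have "\<dots> = exp (v * (\<Sum>p\<in>P. 1 / real p))"
    using assms(1) by (simp add: exp_sum sum_distrib_left)
  finally show ?thesis by (simp add: mult_left_mono)
qed

text \<open>By Pascal's rule the remainder R(m) satisfies R(m + 1) = (1 + u) R(m) + (m choose r)
  u^(r + 1). As |1 + u| \<le> 1, earlier errors are not amplified, and the first omitted term bounds
  the whole remainder.\<close>

lemma binomial_remainder:
  fixes u :: complex
  assumes "norm (1 + u) \<le> 1"
  shows "norm ((1 + u) ^ m - (\<Sum>i\<le>r. of_nat (m choose i) * u ^ i)) \<le> real (m choose Suc r) * norm u ^ Suc r"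
proof (induction m)
  case 0
  have "(\<Sum>i\<le>r. of_nat (0 choose i) * u ^ i) = (\<Sum>i\<le>r. if i = 0 then 1 else 0)"
    by (intro sum.cong) auto
  thus ?case by simp
next
  case (Suc m)
  let ?s = "\<lambda>m. (\<Sum>i\<le>r. of_nat (m choose i) * u ^ i)"
  have "?s (Suc m) = (1 + u) * ?s m - of_nat (m choose r) * u ^ Suc r"
  proof (induction r)
    case (Suc r)
    have "(of_nat (Suc m choose Suc r) :: complex) = of_nat (m choose r) + of_nat (m choose Suc r)"
      by simp
    thus ?case using Suc by (simp add: ring_distribs del: binomial_Suc_Suc)
  qed simp
  hence "(1 + u) ^ Suc m - ?s (Suc m) = (1 + u) * ((1 + u) ^ m - ?s m) + of_nat (m choose r) * u ^ Suc r"
    by (simp only: power_Suc right_diff_distrib) simp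
  hence "norm ((1 + u) ^ Suc m - ?s (Suc m)) \<le> norm (1 + u) * norm ((1 + u) ^ m - ?s m) + real (m choose r) * norm u ^ Suc r"
    by (metis (no_types, lifting) norm_mult norm_of_nat norm_power norm_triangle_ineq)
  also have "\<dots> \<le> 1 * (real (m choose Suc r) * norm u ^ Suc r) + real (m choose r) * norm u ^ Suc r"
    using Suc assms by (intro add_right_mono mult_mono) auto
  also have "\<dots> = real (Suc m choose Suc r) * norm u ^ Suc r"
    by (simp only: binomial_Suc_Suc of_nat_add ring_distribs mult_1 add.commute)
  finally show ?case .
qed

text \<open>The truncated form of \<open>power_om_eq\<close>: cutting the expansion at degree r
  leaves only the sets with at most r primes, few enough to afford an error of 1 for each.\<close>

lemma sum_binomial_om:
  fixes u :: "'a::comm_semiring_1"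
  assumes "finite P" "\<And>p. p \<in> P \<Longrightarrow> prime p"
  shows "(\<Sum>i\<le>r. of_nat (om P n choose i) * u ^ i) =
         (\<Sum>S | S \<subseteq> P \<and> card S \<le> r. if \<Prod>S dvd n then u ^ card S else 0)"
proof -
  let ?T = "{p\<in>P. p dvd n}"
  have finT: "finite ?T" using assms by auto
  define F where "F = {S. S \<subseteq> ?T \<and> card S \<le> r}"
  have finF: "finite F" unfolding F_def using finT by auto
  have iff: "S \<subseteq> ?T \<longleftrightarrow> S \<subseteq> P \<and> \<Prod>S dvd n" for S
  proof (cases "S \<subseteq> P")
    case True
    then have "\<Prod>S dvd n \<longleftrightarrow> (\<forall>p\<in>S. p dvd n)"
      using assms by (intro prod_primes_dvd_iff) (auto dest: finite_subset)
    thus ?thesis using True by auto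
  qed auto
  have F: "{S\<in>{S. S \<subseteq> P \<and> card S \<le> r}. \<Prod>S dvd n} = F"
    unfolding F_def using iff by blast
  have "(\<Sum>S | S \<subseteq> P \<and> card S \<le> r. if \<Prod>S dvd n then u ^ card S else 0) = (\<Sum>S\<in>F. u ^ card S)"
    using assms(1) by (subst F[symmetric], intro sum.inter_filter[symmetric]) auto
  also have "\<dots> = (\<Sum>i\<in>{..r}. \<Sum>S\<in>{S\<in>F. card S = i}. u ^ card S)"
    by (rule sum.group[symmetric]) (use finF in \<open>auto simp: F_def\<close>)
  also have "\<dots> = (\<Sum>i\<le>r. of_nat (om P n choose i) * u ^ i)"
  proof (rule sum.cong)
    fix i assume i: "i \<in> {..r}"
    have 1: "{S\<in>F. card S = i} = {S. S \<subseteq> ?T \<and> card S = i}" using i by (auto simp: F_def)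
    have 2: "card {S. S \<subseteq> ?T \<and> card S = i} = (om P n choose i)"
      unfolding om_def by (rule n_subsets[OF finT])
    have "(\<Sum>S\<in>{S\<in>F. card S = i}. u ^ card S) = (\<Sum>S\<in>{S\<in>F. card S = i}. u ^ i)"
      by (rule sum.cong) auto
    thus "(\<Sum>S\<in>{S\<in>F. card S = i}. u ^ card S) = of_nat (om P n choose i) * u ^ i"
      using 1 2 by simp
  qed simp
  finally show ?thesis by (rule sym)
qed

section \<open>The number of prime factors from a set of primes\<close>

lemma power_binomial_mono: "(real p + 1) ^ r \<ge> (\<Sum>i\<le>r. real (p choose i))"
proof -
  have "real (p choose i) \<le> real (r choose i) * real p ^ i" if "i \<le> r" for i
  proof -
    have "(p choose i) \<le> p ^ i" by (cases "i \<le> p") (auto intro: binomial_le_pow simp: binomial_eq_0)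
    also have "\<dots> \<le> (r choose i) * p ^ i"
      using that by (simp add: Suc_le_eq)
    finally show ?thesis by (simp only: of_nat_mult [symmetric] of_nat_power [symmetric] of_nat_le_iff)
  qed
  hence "(\<Sum>i\<le>r. real (p choose i)) \<le> (\<Sum>i\<le>r. real (r choose i) * real p ^ i)"
    by (intro sum_mono) auto
  also have "\<dots> = (real p + 1) ^ r" by (simp add: binomial_ring)
  finally show ?thesis .
qed

lemma card_small_subsets:
  assumes "finite P"
  shows "real (card {S. S \<subseteq> P \<and> card S \<le> r}) \<le> (real (card P) + 1) ^ r"
proof -
  have "{S. S \<subseteq> P \<and> card S \<le> r} = (\<Union>i\<in>{..r}. {S. S \<subseteq> P \<and> card S = i})" by auto
  hence "card {S. S \<subseteq> P \<and> card S \<le> r} \<le> (\<Sum>i\<in>{..r}. card {S. S \<subseteq> P \<and> card S = i})"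
    by (simp add: card_UN_le)
  also have "\<dots> = (\<Sum>i\<le>r. card P choose i)"
    by (intro sum.cong refl n_subsets assms)
  finally have "real (card {S. S \<subseteq> P \<and> card S \<le> r}) \<le> (\<Sum>i\<le>r. real (card P choose i))"
    by (simp only: of_nat_sum [symmetric] of_nat_le_iff)
  also have "\<dots> \<le> (real (card P) + 1) ^ r" by (rule power_binomial_mono)
  finally show ?thesis .
qed

text \<open>Three comparisons: cut the expansion at degree r; replace the count of multiples of each
  product by its density times N, at a cost of at most 1 per set because |u| \<le> 1; restore the
  omitted sets, which turns the sum into a product. The first and third errors are controlled by
  Rankin's trick, which pays exp(-(r + 1)) and replaces |u| by e |u|.\<close>

lemma sum_power_om_approx:
  fixes u :: complex
  assumes P: "finite P" "\<And>p. p \<in> P \<Longrightarrow> prime p"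
    and u: "norm (1 + u) \<le> 1" "norm u \<le> 1"
  shows "norm ((\<Sum>n=1..N. (1 + u) ^ om P n) - of_nat N * (\<Prod>p\<in>P. 1 + u * (1 / of_nat p)))
     \<le> 2 * real N * exp (3 * norm u * (\<Sum>p\<in>P. 1 / real p) - real (Suc r)) + (real (card P) + 1) ^ r"
proof -
  define L where "L = (\<Sum>p\<in>P. 1 / real p)"
  define F where "F = {S. S \<subseteq> P \<and> card S \<le> r}"
  define c where "c = (\<lambda>S. card {n\<in>{1..N}. \<Prod>S dvd n})"
  have finF: "finite F" unfolding F_def using P by auto
  have FP: "F \<subseteq> Pow P" by (auto simp: F_def)
  have L: "L \<ge> 0" unfolding L_def by (intro sum_nonneg) auto
  \<comment> \<open>Rankin's trick is applied with ratio e; rounding e up produces the 3 in the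
    statement.\<close>
  have e3: "exp 1 \<le> (3::real)" by (rule exp_le)
  let ?B = "real N * exp (3 * norm u * L - real (Suc r))"
  have expL: "exp ((exp 1 * norm u) * L) * exp (- real (Suc r)) \<le> exp (3 * norm u * L - real (Suc r))"
  proof -
    have "(exp 1 * norm u) * L \<le> 3 * norm u * L"
      by (intro mult_right_mono e3 L norm_ge_zero)
    thus ?thesis by (simp add: exp_add [symmetric])
  qed
  have eSuc: "exp (- real (Suc r)) * exp 1 ^ Suc r = 1"
    by (simp add: exp_of_nat_mult [symmetric] exp_add [symmetric] del: power_Suc of_nat_Suc)
  \<comment> \<open>The first omitted term, with |u| scaled to e |u|, is a single term of the
    expansion of (1 + e |u|)^m and hence below the full power, whose sum over n is already
    bounded.\<close>
  have rem: "norm ((1 + u) ^ om P n - (\<Sum>i\<le>r. of_nat (om P n choose i) * u ^ i))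
       \<le> exp (- real (Suc r)) * (1 + exp 1 * norm u) ^ om P n" for n
  proof -
    let ?m = "om P n"
    have "norm ((1 + u) ^ ?m - (\<Sum>i\<le>r. of_nat (?m choose i) * u ^ i)) \<le> real (?m choose Suc r) * norm u ^ Suc r"
      by (rule binomial_remainder[OF u(1)])
    also have "\<dots> = exp (- real (Suc r)) * (real (?m choose Suc r) * (exp 1 * norm u) ^ Suc r)"
      using eSuc by (simp only: power_mult_distrib mult_ac) (simp only: mult.assoc[symmetric] mult_1)
    also have "real (?m choose Suc r) * (exp 1 * norm u) ^ Suc r \<le> (1 + exp 1 * norm u) ^ ?m"
    proof (cases "Suc r \<le> ?m")
      case True
      have "(exp 1 * norm u + 1) ^ ?m = (\<Sum>k\<le>?m. real (?m choose k) * (exp 1 * norm u) ^ k)"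
        by (simp add: binomial_ring)
      moreover have "real (?m choose Suc r) * (exp 1 * norm u) ^ Suc r \<le> (\<Sum>k\<le>?m. real (?m choose k) * (exp 1 * norm u) ^ k)"
        by (rule member_le_sum) (use True in auto)
      ultimately show ?thesis by (simp only: add.commute)
    qed (simp add: binomial_eq_0)
    finally show ?thesis by simp
  qed
  have A: "norm ((\<Sum>n=1..N. (1 + u) ^ om P n) - (\<Sum>n=1..N. \<Sum>i\<le>r. of_nat (om P n choose i) * u ^ i)) \<le> ?B"
  proof -
    have "norm ((\<Sum>n=1..N. (1 + u) ^ om P n) - (\<Sum>n=1..N. \<Sum>i\<le>r. of_nat (om P n choose i) * u ^ i))
        \<le> (\<Sum>n=1..N. exp (- real (Suc r)) * (1 + exp 1 * norm u) ^ om P n)"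
      by (simp only: sum_subtractf [symmetric]) (rule sum_norm_le, rule rem)
    also have "\<dots> = exp (- real (Suc r)) * (\<Sum>n=1..N. (1 + exp 1 * norm u) ^ om P n)"
      by (simp add: sum_distrib_left)
    also have "\<dots> \<le> exp (- real (Suc r)) * (real N * exp ((exp 1 * norm u) * L))"
      unfolding L_def by (intro mult_left_mono sum_power_om_le P) auto
    also have "\<dots> = real N * (exp ((exp 1 * norm u) * L) * exp (- real (Suc r)))" by (simp only: mult_ac)
    also have "\<dots> \<le> ?B" by (intro mult_left_mono expL) auto
    finally show ?thesis .
  qed
  have S: "(\<Sum>n=1..N. \<Sum>i\<le>r. of_nat (om P n choose i) * u ^ i) = (\<Sum>S\<in>F. u ^ card S * of_nat (c S))"
  proof -
    have "(\<Sum>n=1..N. \<Sum>i\<le>r. of_nat (om P n choose i) * u ^ i) = (\<Sum>n=1..N. \<Sum>S\<in>F. if \<Prod>S dvd n then u ^ card S else 0)"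
      unfolding F_def by (intro sum.cong refl sum_binomial_om P)
    also have "\<dots> = (\<Sum>S\<in>F. \<Sum>n=1..N. if \<Prod>S dvd n then u ^ card S else 0)"
      by (rule sum.swap)
    also have "\<dots> = (\<Sum>S\<in>F. u ^ card S * of_nat (c S))"
      unfolding c_def
      by (intro sum.cong refl, subst sum.inter_filter[symmetric]) (auto simp: mult.commute)
    finally show ?thesis .
  qed
  have B: "norm ((\<Sum>S\<in>F. u ^ card S * of_nat (c S)) - (\<Sum>S\<in>F. u ^ card S * (of_nat N / of_nat (\<Prod>S))))
      \<le> (real (card P) + 1) ^ r"
  proof -
    have "norm ((\<Sum>S\<in>F. u ^ card S * of_nat (c S)) - (\<Sum>S\<in>F. u ^ card S * (of_nat N / of_nat (\<Prod>S)))) \<le> (\<Sum>S\<in>F. 1)"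
      unfolding sum_subtractf [symmetric]
    proof (rule sum_norm_le)
      fix S assume "S \<in> F"
      hence pos: "\<Prod>S > 0" using FP prod_primes_pos[OF _ P(2)] by auto
      have "(of_nat (c S) - of_nat N / of_nat (\<Prod>S) :: complex) = of_real (real (c S) - real N / real (\<Prod>S))" by simp
      hence "norm (of_nat (c S) - of_nat N / of_nat (\<Prod>S) :: complex) = \<bar>real (c S) - real N / real (\<Prod>S)\<bar>"
        by (simp only: norm_of_real)
      also have "\<dots> \<le> 1"
        using card_multiples_le[OF pos, of N] card_multiples_ge[OF pos, of N] unfolding c_def by linarith
      finally have 1: "norm (of_nat (c S) - of_nat N / of_nat (\<Prod>S) :: complex) \<le> 1" .
      have "norm (u ^ card S * of_nat (c S) - u ^ card S * (of_nat N / of_nat (\<Prod>S)))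
         = norm u ^ card S * norm (of_nat (c S) - of_nat N / of_nat (\<Prod>S) :: complex)"
        by (simp only: right_diff_distrib [symmetric] norm_mult norm_power)
      also have "\<dots> \<le> 1 * 1"
        using u(2) 1 by (intro mult_mono power_le_one) auto
      finally show "norm (u ^ card S * of_nat (c S) - u ^ card S * (of_nat N / of_nat (\<Prod>S))) \<le> 1" by simp
    qed
    also have "\<dots> \<le> (real (card P) + 1) ^ r" using card_small_subsets[OF P(1), of r] by (simp add: F_def)
    finally show ?thesis .
  qed
  have prodinv: "1 / of_nat (\<Prod>S) = (\<Prod>p\<in>S. 1 / of_nat p :: 'x::real_field)" for S
    by (simp add: prod_dividef)
  have C: "norm ((\<Sum>S\<in>F. u ^ card S * (of_nat N / of_nat (\<Prod>S))) - of_nat N * (\<Prod>p\<in>P. 1 + u * (1 / of_nat p))) \<le> ?B"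
  proof -
    have e1: "(\<Sum>S\<in>F. u ^ card S * (of_nat N / of_nat (\<Prod>S))) = of_nat N * (\<Sum>S\<in>F. u ^ card S * (\<Prod>p\<in>S. 1 / of_nat p))"
      by (simp only: prodinv [symmetric] sum_distrib_left) (simp add: mult_ac)
    have e2: "(\<Prod>p\<in>P. 1 + u * (1 / of_nat p)) = (\<Sum>S\<in>Pow P. u ^ card S * (\<Prod>p\<in>S. 1 / of_nat p))"
      by (rule sum_Pow_power[OF P(1), symmetric])
    have e3: "\<dots> - (\<Sum>S\<in>F. u ^ card S * (\<Prod>p\<in>S. 1 / of_nat p)) = (\<Sum>S\<in>Pow P - F. u ^ card S * (\<Prod>p\<in>S. 1 / of_nat p))"
      using P(1) FP by (subst sum_diff) auto
    have "norm ((\<Sum>S\<in>F. u ^ card S * (of_nat N / of_nat (\<Prod>S))) - of_nat N * (\<Prod>p\<in>P. 1 + u * (1 / of_nat p)))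
       = real N * norm (\<Sum>S\<in>Pow P - F. u ^ card S * (\<Prod>p\<in>S. 1 / of_nat p))"
      unfolding e1 e2 right_diff_distrib[symmetric] norm_mult e3[symmetric]
      by (simp add: norm_minus_commute)
    also have "norm (\<Sum>S\<in>Pow P - F. u ^ card S * (\<Prod>p\<in>S. 1 / of_nat p)) \<le>
       (\<Sum>S\<in>Pow P - F. exp (- real (Suc r)) * ((exp 1 * norm u) ^ card S * (\<Prod>p\<in>S. 1 / real p)))"
    proof (rule sum_norm_le)
      fix S assume S: "S \<in> Pow P - F"
      hence card: "Suc r \<le> card S" by (auto simp: F_def)
      have nn: "0 \<le> norm u ^ card S * (\<Prod>p\<in>S. 1 / real p)"
        by (intro mult_nonneg_nonneg prod_nonneg) auto
      have "norm (u ^ card S * (\<Prod>p\<in>S. 1 / of_nat p)) = 1 * (norm u ^ card S * (\<Prod>p\<in>S. 1 / real p))"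
        by (simp add: norm_mult norm_power prod_norm[symmetric] norm_divide)
      also have "\<dots> \<le> (exp (- real (Suc r)) * exp 1 ^ card S) * (norm u ^ card S * (\<Prod>p\<in>S. 1 / real p))"
      proof (rule mult_right_mono[OF _ nn])
        have "1 = exp (- real (Suc r)) * exp 1 ^ Suc r" using eSuc by simp
        also have "\<dots> \<le> exp (- real (Suc r)) * exp 1 ^ card S"
          using card by (intro mult_left_mono power_increasing) auto
        finally show "1 \<le> exp (- real (Suc r)) * exp 1 ^ card S" .
      qed
      finally show "norm (u ^ card S * (\<Prod>p\<in>S. 1 / of_nat p)) \<le>
        exp (- real (Suc r)) * ((exp 1 * norm u) ^ card S * (\<Prod>p\<in>S. 1 / real p))"
        by (simp only: power_mult_distrib mult.assoc)
    qed
    also have "\<dots> \<le> (\<Sum>S\<in>Pow P. exp (- real (Suc r)) * ((exp 1 * norm u) ^ card S * (\<Prod>p\<in>S. 1 / real p)))"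
      by (rule sum_mono2) (use P in \<open>auto intro!: mult_nonneg_nonneg prod_nonneg\<close>)
    also have "\<dots> = exp (- real (Suc r)) * (\<Prod>p\<in>P. 1 + exp 1 * norm u * (1 / real p))"
      by (simp only: sum_distrib_left [symmetric] sum_Pow_power[OF P(1)])
    also have "(\<Prod>p\<in>P. 1 + exp 1 * norm u * (1 / real p)) \<le> (\<Prod>p\<in>P. exp (exp 1 * norm u * (1 / real p)))"
      by (intro prod_mono conjI add_nonneg_nonneg exp_ge_add_one_self) auto
    also have "\<dots> = exp ((exp 1 * norm u) * L)"
      using P(1) unfolding L_def by (simp only: exp_sum sum_distrib_left)
    finally have "norm ((\<Sum>S\<in>F. u ^ card S * (of_nat N / of_nat (\<Prod>S))) - of_nat N * (\<Prod>p\<in>P. 1 + u * (1 / of_nat p)))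
       \<le> real N * (exp (- real (Suc r)) * exp ((exp 1 * norm u) * L))"
      by (simp add: mult_left_mono)
    also have "\<dots> \<le> ?B"
      using expL by (intro mult_left_mono) (simp_all add: mult.commute)
    finally show ?thesis .
  qed
  have tri: "norm (x - w) \<le> e1 + e2 + e3" 
    if "norm (x - y) \<le> e1" "norm (y - z) \<le> e2" "norm (z - w) \<le> e3" for x y z w :: complex and e1 e2 e3
  proof -
    have "norm ((x - y) + (y - z) + (z - w)) \<le> e1 + e2 + e3"
      using that by (meson add_mono norm_triangle_le order_trans)
    thus ?thesis by simp
  qed
  from tri[OF A[unfolded S] B C] show ?thesis unfolding L_def by simp
qed

text \<open>The left side is the characteristic function at t of a Bernoulli variable with mean q =
  1/p. Its squared norm is 1 - 2 (1 - cos t) q (1 - q), and p \<ge> 2 gives 1 - q \<ge> 1/2.\<close>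

lemma norm_one_plus_cis_le:
  fixes t :: real
  assumes "p \<ge> 2"
  shows "norm (1 + (cis t - 1) * (1 / of_nat p)) \<le> exp (- (1 - cos t) / 2 * (1 / real p))"
proof -
  define q where "q = 1 / real p"
  have q: "0 \<le> q" "q \<le> 1/2" using assms by (auto simp: field_simps q_def)
  have c: "cos t \<le> 1" by simp
  have eq: "1 + (cis t - 1) * (1 / of_nat p) = Complex (1 + (cos t - 1) * q) (sin t * q)"
    by (simp add: complex_eq_iff Re_divide_of_nat Im_divide_of_nat q_def)
  have "norm (1 + (cis t - 1) * (1 / of_nat p)) ^ 2 = (1 + (cos t - 1) * q)^2 + (sin t * q)^2"
    unfolding eq by (simp add: cmod_power2)
  also have "(1 + (x - 1) * q)^2 + (y * q)^2 = 1 - 2 * (1 - x) * q + q^2 * ((x - 1)^2 + y^2)" for x y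
    by (simp add: power2_eq_square algebra_simps)
  also have "(cos t - 1)^2 + (sin t)^2 = 2 * (1 - cos t)"
    using sin_cos_squared_add[of t] by (simp add: power2_eq_square algebra_simps)
  also have "1 - 2 * (1 - cos t) * q + q^2 * (2 * (1 - cos t)) = 1 - 2 * ((1 - cos t) * q) * (1 - q)"
    by (simp add: power2_eq_square algebra_simps)
  also have "\<dots> \<le> 1 - 2 * ((1 - cos t) * q) * (1 / 2)"
    using q c by (intro diff_left_mono mult_left_mono mult_nonneg_nonneg) auto
  also have "\<dots> \<le> exp (- ((1 - cos t) * q))" using exp_ge_add_one_self[of "- ((1 - cos t) * q)"] by simp
  also have "\<dots> = exp (- (1 - cos t) / 2 * q) ^ 2"
    by (simp add: exp_double [symmetric] algebra_simps)
  finally show ?thesis unfolding q_def by (rule power2_le_imp_le) simp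
qed

lemma one_minus_cos_ge:
  assumes "\<bar>t\<bar> \<le> (1::real)"
  shows "1 - cos t \<ge> t ^ 2 / 4"
proof -
  obtain s where "cos t = (\<Sum>m<4. cos_coeff m * t ^ m) + (cos (s + 1/2 * real 4 * pi) / fact 4) * t ^ 4"
    using Maclaurin_cos_expansion[of t 4] by blast
  hence eq: "cos t = 1 - t^2 / 2 + cos (s + 2 * pi) / 24 * t^4"
    by (simp add: lessThan_nat_numeral lessThan_Suc cos_coeff_def fact_numeral)
  have "cos (s + 2 * pi) / 24 * t^4 \<le> 1 / 24 * t ^ 4"
    by (intro mult_right_mono divide_right_mono) auto
  moreover have "t ^ 4 \<le> t ^ 2"
  proof -
    have "\<bar>t\<bar> ^ 4 \<le> \<bar>t\<bar> ^ 2" using assms by (intro power_decreasing) auto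
    thus ?thesis by simp
  qed
  moreover have "t ^ 2 \<ge> 0" by simp
  ultimately show ?thesis using eq by linarith
qed

lemma norm_cis_minus_one_le: "norm (cis t - 1) \<le> \<bar>t\<bar>"
proof -
  have "norm (cis t - 1) ^ 2 = (cos t - 1) ^ 2 + (sin t) ^ 2" by (simp add: cmod_power2)
  also have "\<dots> = 2 * (1 - cos t)"
    using sin_cos_squared_add[of t] by (simp add: power2_eq_square algebra_simps)
  also have "\<dots> = 4 * sin (t / 2) ^ 2"
    using cos_double_sin[of "t/2"] by simp
  also have "\<dots> = 4 * \<bar>sin (t / 2)\<bar> ^ 2" by simp
  also have "\<dots> \<le> 4 * \<bar>t / 2\<bar> ^ 2"
    by (intro mult_left_mono power_mono abs_sin_x_le_abs_x) auto
  also have "\<dots> = \<bar>t\<bar> ^ 2" by (simp add: power2_eq_square)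
  finally show ?thesis by (rule power2_le_imp_le) simp
qed

text \<open>With u = cis t - 1 the power (1 + u)^m is cis (t m), and the product in the main term is
  the characteristic function of a sum of independent Bernoulli variables. The 1/8 is the 1/2 of
  \<open>norm_one_plus_cis_le\<close> times the 1/4 of \<open>one_minus_cos_ge\<close>.\<close>

lemma char_bound:
  assumes P: "finite P" "\<And>p. p \<in> P \<Longrightarrow> prime p" and t: "\<bar>t\<bar> \<le> 1"
  defines "L \<equiv> (\<Sum>p\<in>P. 1 / real p)"
  shows "norm (\<Sum>n=1..N. cis (t * real (om P n))) \<le>
     real N * exp (- (t ^ 2) / 8 * L) + 2 * real N * exp (3 * \<bar>t\<bar> * L - real (Suc r)) + (real (card P) + 1) ^ r"
proof -
  define u where "u = cis t - 1"
  have L: "L \<ge> 0" unfolding L_def by (intro sum_nonneg) auto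
  have nu: "norm u \<le> \<bar>t\<bar>" unfolding u_def by (rule norm_cis_minus_one_le)
  have "norm (1 + u) \<le> 1" by (simp add: u_def)
  note ap = sum_power_om_approx[OF P this order_trans[OF nu t], of N r, folded L_def]
  have "norm (\<Prod>p\<in>P. 1 + u * (1 / of_nat p)) = (\<Prod>p\<in>P. norm (1 + u * (1 / of_nat p)))"
    by (simp only: prod_norm)
  also have "\<dots> \<le> (\<Prod>p\<in>P. exp (- (1 - cos t) / 2 * (1 / real p)))"
    unfolding u_def using P(2) by (intro prod_mono conjI norm_ge_zero norm_one_plus_cis_le) (auto dest: prime_ge_2_nat)
  also have "\<dots> = exp (- (1 - cos t) / 2 * L)"
    unfolding L_def using P(1) by (simp only: exp_sum sum_distrib_left)
  also have "\<dots> \<le> exp (- (t ^ 2) / 8 * L)"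
  proof -
    have "- (1 - cos t) / 2 \<le> - (t ^ 2) / 8" using one_minus_cos_ge[OF t] by simp
    from mult_right_mono[OF this L] show ?thesis by simp
  qed
  finally have pr: "norm (\<Prod>p\<in>P. 1 + u * (1 / of_nat p)) \<le> exp (- (t ^ 2) / 8 * L)" .
  have cis: "cis (t * real (om P n)) = (1 + u) ^ om P n" for n
    using Complex.DeMoivre[of t "om P n"] by (simp add: u_def mult.commute[of t])
  let ?S = "\<Sum>n=1..N. (1 + u) ^ om P n" and ?M = "of_nat N * (\<Prod>p\<in>P. 1 + u * (1 / of_nat p))"
  have "norm ?S \<le> norm ?M + norm (?S - ?M)" by (metis norm_triangle_sub add.commute)
  also have "norm ?M \<le> real N * exp (- (t ^ 2) / 8 * L)"
    using pr by (simp only: norm_mult norm_of_nat) (intro mult_left_mono, auto)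
  also have "norm (?S - ?M) \<le> 2 * real N * exp (3 * norm u * L - real (Suc r)) + (real (card P) + 1) ^ r"
    by (rule ap)
  also have "2 * real N * exp (3 * norm u * L - real (Suc r)) \<le> 2 * real N * exp (3 * \<bar>t\<bar> * L - real (Suc r))"
    using nu L by (intro mult_left_mono) (auto intro: mult_right_mono)
  finally show ?thesis by (simp only: cis add.assoc)
qed

section \<open>Additive functions\<close>

lemma additive_fun_1:
  assumes "additive_fun f" shows "f 1 = 0"
proof -
  have "f (1 * 1) = f 1 + f 1" using assms unfolding additive_fun_def by (metis coprime_1_left zero_less_one)
  thus ?thesis by simp
qed

lemma additive_fun_prod:
  assumes f: "additive_fun f" and S: "finite S" "\<And>p. p \<in> S \<Longrightarrow> prime p"
  shows "f (\<Prod>p\<in>S. p ^ e p) = (\<Sum>p\<in>S. f (p ^ e p))"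
  using S
proof (induction S rule: finite_induct)
  case empty thus ?case using additive_fun_1[OF f] by simp
next
  case (insert p S)
  have "coprime (p ^ e p) (\<Prod>q\<in>S. q ^ e q)"
  proof (rule prod_coprime_right)
    fix q assume "q \<in> S"
    hence "coprime p q" using insert by (intro primes_coprime) auto
    thus "coprime (p ^ e p) (q ^ e q)" by simp
  qed
  moreover have "p ^ e p > 0" using insert by (simp add: prime_gt_0_nat)
  moreover have "(\<Prod>q\<in>S. q ^ e q) > 0" using insert by (intro prod_pos) (simp add: prime_gt_0_nat)
  ultimately have "f (p ^ e p * (\<Prod>q\<in>S. q ^ e q)) = f (p ^ e p) + f (\<Prod>q\<in>S. q ^ e q)"
    using f unfolding additive_fun_def by blast
  with insert show ?case by simp
qed

lemma additive_fun_eq_sum: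
  assumes "additive_fun f" "n > 0"
  shows "f n = (\<Sum>p\<in>prime_factors n. f (p ^ multiplicity p n))"
proof -
  have n: "(\<Prod>p\<in>prime_factors n. p ^ multiplicity p n) = n"
    using assms by (simp add: prod_prime_factors)
  have "f (\<Prod>p\<in>prime_factors n. p ^ multiplicity p n) = (\<Sum>p\<in>prime_factors n. f (p ^ multiplicity p n))"
    by (rule additive_fun_prod[OF assms(1)]) auto
  thus ?thesis by (simp only: n)
qed

text \<open>The difference has the value f p - c at a prime p, so closeness of \<open>f\<close> to a
  constant on primes becomes smallness on primes of an additive function.\<close>

lemma additive_fun_diff_om:
  assumes "additive_fun f"
  shows "additive_fun (\<lambda>n. f n - c * real (card (prime_factors n)))"
proof -
  have om: "card (prime_factors (m * n)) = card (prime_factors m) + card (prime_factors n)"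
    if "m > 0" "n > 0" "coprime m n" for m n :: nat
  proof -
    have "prime_factors m \<inter> prime_factors n = {}"
    proof (rule ccontr)
      assume "\<not> ?thesis"
      then obtain p where p: "prime p" "p dvd m" "p dvd n" by (auto simp: in_prime_factors_iff)
      from coprime_common_divisor[OF that(3) p(2,3)] p(1) show False by simp
    qed
    moreover have "prime_factors (m * n) = prime_factors m \<union> prime_factors n"
      using that by (simp add: prime_factorization_mult)
    ultimately show ?thesis by (simp add: card_Un_disjoint)
  qed
  show ?thesis unfolding additive_fun_def
  proof (intro allI impI)
    fix m n :: nat assume mn: "0 < m" "0 < n" "coprime m n"
    have "f (m * n) = f m + f n" using assms mn unfolding additive_fun_def by blast
    thus "f (m * n) - c * real (card (prime_factors (m * n))) =
          f m - c * real (card (prime_factors m)) + (f n - c * real (card (prime_factors n)))"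
      by (simp only: om[OF mn] of_nat_add ring_distribs)
  qed
qed

lemma card_multiples_Union:
  assumes "finite I" "\<And>i. i \<in> I \<Longrightarrow> d i > 0"
  shows "real (card {n\<in>{1..N}. \<exists>i\<in>I. d i dvd n}) \<le> real N * (\<Sum>i\<in>I. 1 / real (d i))"
proof -
  have "{n\<in>{1..N}. \<exists>i\<in>I. d i dvd n} = (\<Union>i\<in>I. {n\<in>{1..N}. d i dvd n})" by auto
  hence "card {n\<in>{1..N}. \<exists>i\<in>I. d i dvd n} \<le> (\<Sum>i\<in>I. card {n\<in>{1..N}. d i dvd n})"
    using card_UN_le[OF assms(1)] by simp
  hence "real (card {n\<in>{1..N}. \<exists>i\<in>I. d i dvd n}) \<le> (\<Sum>i\<in>I. real (card {n\<in>{1..N}. d i dvd n}))"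
    by (simp only: of_nat_sum [symmetric] of_nat_le_iff)
  also have "\<dots> \<le> (\<Sum>i\<in>I. real N / real (d i))"
    by (intro sum_mono card_multiples_le assms)
  finally show ?thesis by (simp add: sum_distrib_left)
qed

text \<open>The predicate \<open>R\<close> selects the primes above a threshold. In both
  applications the mean value is then fed into Markov's inequality.\<close>

lemma sum_prime_factors_le:
  assumes "\<And>p. a p \<ge> (0::real)"
  shows "(\<Sum>n=1..N. \<Sum>p | prime p \<and> p dvd n \<and> R p. a p) \<le> real N * (\<Sum>p | prime p \<and> p \<le> N \<and> R p. a p / real p)"
proof -
  let ?P = "{p. prime p \<and> p \<le> N \<and> R p}"
  have fin: "finite ?P" by simp
  have "(\<Sum>n=1..N. \<Sum>p | prime p \<and> p dvd n \<and> R p. a p) = (\<Sum>n=1..N. \<Sum>p\<in>?P. if p dvd n then a p else 0)"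
  proof (rule sum.cong)
    fix n assume n: "n \<in> {1..N}"
    have "p \<le> N" if "p dvd n" for p using dvd_imp_le[OF that] n by auto
    hence eq: "{p. prime p \<and> p dvd n \<and> R p} = {p\<in>?P. p dvd n}" by auto
    show "(\<Sum>p | prime p \<and> p dvd n \<and> R p. a p) = (\<Sum>p\<in>?P. if p dvd n then a p else 0)"
      unfolding eq by (rule sum.inter_filter[OF fin])
  qed simp
  also have "\<dots> = (\<Sum>p\<in>?P. \<Sum>n=1..N. if p dvd n then a p else 0)" by (rule sum.swap)
  also have "\<dots> = (\<Sum>p\<in>?P. a p * real (card {n\<in>{1..N}. p dvd n}))"
    by (intro sum.cong refl, subst sum.inter_filter[symmetric]) (auto simp: mult.commute)
  also have "\<dots> \<le> (\<Sum>p\<in>?P. a p * (real N / real p))"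
    by (intro sum_mono mult_left_mono card_multiples_le) (use assms in \<open>auto simp: prime_gt_0_nat\<close>)
  finally show ?thesis by (simp add: sum_distrib_left mult_ac)
qed

lemma markov_card:
  fixes h :: "nat \<Rightarrow> real"
  assumes "finite A" "\<And>n. n \<in> A \<Longrightarrow> h n \<ge> 0" "(\<Sum>n\<in>A. h n) \<le> s" "t > 0"
  shows "real (card {n\<in>A. h n \<ge> t}) \<le> s / t"
proof -
  have "t * real (card {n\<in>A. h n \<ge> t}) = (\<Sum>n\<in>{n\<in>A. h n \<ge> t}. t)" by simp
  also have "\<dots> \<le> (\<Sum>n\<in>{n\<in>A. h n \<ge> t}. h n)" by (rule sum_mono) auto
  also have "\<dots> \<le> (\<Sum>n\<in>A. h n)" by (rule sum_mono2) (use assms in auto)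
  finally show ?thesis using assms by (simp add: field_simps)
qed

lemma sum_inverse_squares_tail:
  assumes "Y \<ge> 1"
  shows "(\<Sum>d=Suc Y..N. 1 / real d ^ 2) \<le> 1 / real Y"
proof -
  have "(\<Sum>d=Suc Y..N. 1 / real d ^ 2) \<le> 1 / real Y - 1 / real N" if "N \<ge> Y"
    using that
  proof (induction N rule: dec_induct)
    case (step n)
    have n: "n \<ge> 1" using step assms by simp
    have "1 / real (Suc n) ^ 2 \<le> 1 / (real n * real (Suc n))"
      using n by (intro divide_left_mono) (auto simp: power2_eq_square)
    also have "\<dots> = 1 / real n - 1 / real (Suc n)"
      using n by (simp add: field_simps)
    finally show ?case using step by simp
  qed simp
  moreover have "1 / real Y - 1 / real N \<le> 1 / real Y" by simp
  ultimately show ?thesis by (cases "N \<ge> Y") (linarith, simp)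
qed

text \<open>
  Outside a set of small density only finitely many prime powers contribute more than \<open>1\<close> in total.
\<close>

lemma additive_tight:
  fixes g :: "nat \<Rightarrow> real"
  assumes g: "additive_fun g"
    and sm: "summable (\<lambda>p. if prime p then min 1 \<bar>g p\<bar> / real p else 0)"
    and \<eta>: "\<eta> > 0"
  shows "\<exists>C. \<forall>N. real (card {n\<in>{1..N}. \<bar>g n\<bar> > C}) \<le> \<eta> * real N"
proof -
  define a where "a = (\<lambda>p. min 1 \<bar>g p\<bar>)"
  let ?s = "\<lambda>p. if prime p then a p / real p else 0"
  have a: "0 \<le> a p" "a p \<le> 1" for p by (auto simp: a_def)
  have sm': "summable ?s" using sm unfolding a_def .
  obtain Y0 where Y0: "\<And>n. n \<ge> Y0 \<Longrightarrow> norm (\<Sum>p. ?s (p + n)) < \<eta> / 4"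
    using suminf_exist_split[OF _ sm', of "\<eta> / 4"] \<eta> by auto
  obtain Y1 :: nat where Y1: "4 / \<eta> < real Y1" using reals_Archimedean2 by blast
  define Y where "Y = max Y0 (max Y1 1)"
  have Y: "norm (\<Sum>p. ?s (p + Y)) < \<eta> / 4" "1 / real Y < \<eta> / 4" "Y \<ge> 1"
  proof -
    show "norm (\<Sum>p. ?s (p + Y)) < \<eta> / 4" by (rule Y0) (simp add: Y_def)
    show Y1': "Y \<ge> 1" by (simp add: Y_def)
    have "4 / \<eta> < real Y" using Y1 by (simp add: Y_def)
    thus "1 / real Y < \<eta> / 4" using \<eta> Y1' by (simp add: field_simps)
  qed
  \<comment> \<open>At most \<open>Y\<close> primes are \<le> Y, and the multiples of each p^A have
    density at most 2^(-A). So an A-th power of a small prime rarely divides n.\<close>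
  obtain A where "real Y * 4 / \<eta> < 2 ^ A" using real_arch_pow[of 2 "real Y * 4 / \<eta>"] by auto
  hence A: "real Y / 2 ^ A < \<eta> / 4" using \<eta> by (simp add: field_simps)
  \<comment> \<open>The double sum covers every contribution of a prime p \<le> Y with exponent at
    most A; the added 1 covers all larger primes together.\<close>
  define C where "C = (\<Sum>p\<le>Y. \<Sum>k\<le>A. \<bar>g (p ^ k)\<bar>) + 1"
  show ?thesis
  proof (intro exI allI)
    fix N
    \<comment> \<open>The exceptional n: those divisible by a high power of a small prime, those
      divisible by the square of a number above \<open>Y\<close>, and those whose primes above
      \<open>Y\<close> have total weight at least 1. Each set takes a quarter of the allowed
      density.\<close>
    let ?B1 = "{n\<in>{1..N}. \<exists>p\<in>{p. prime p \<and> p \<le> Y}. p ^ A dvd n}"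
    let ?B2 = "{n\<in>{1..N}. \<exists>d\<in>{Suc Y..N}. d ^ 2 dvd n}"
    let ?h = "\<lambda>n. \<Sum>p | prime p \<and> p dvd n \<and> Y < p. a p"
    let ?B3 = "{n\<in>{1..N}. ?h n \<ge> 1}"
    have tailfin: "(\<Sum>p | prime p \<and> p \<le> N \<and> Y < p. a p / real p) \<le> \<eta> / 4"
    proof -
      have "(\<Sum>p | prime p \<and> p \<le> N \<and> Y < p. a p / real p) = (\<Sum>p\<in>{p. prime p \<and> p \<le> N \<and> Y < p}. ?s p)"
        by (intro sum.cong) auto
      also have "\<dots> \<le> (\<Sum>p\<in>{Y..<N+1+Y}. ?s p)"
        by (rule sum_mono2) (use a in auto)
      also have "\<dots> = (\<Sum>p<N+1. ?s (p + Y))"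
        by (simp only: sum.shift_bounds_nat_ivl[of ?s 0 Y "N+1", simplified add_0] lessThan_atLeast0)
      also have "\<dots> \<le> (\<Sum>p. ?s (p + Y))"
        by (rule sum_le_suminf) (use summable_ignore_initial_segment[OF sm', of Y] a in auto)
      finally show ?thesis using Y(1) by simp
    qed
    have B1: "real (card ?B1) \<le> real N * (\<eta> / 4)"
    proof -
      have "real (card ?B1) \<le> real N * (\<Sum>p | prime p \<and> p \<le> Y. 1 / real (p ^ A))"
        by (rule card_multiples_Union) (auto simp: prime_gt_0_nat)
      also have "(\<Sum>p | prime p \<and> p \<le> Y. 1 / real (p ^ A)) \<le> (\<Sum>p | prime p \<and> p \<le> Y. 1 / 2 ^ A)"
        by (intro sum_mono divide_left_mono) (auto simp: prime_gt_0_nat intro!: power_mono dest: prime_ge_2_nat)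
      also have "\<dots> \<le> (\<Sum>p\<in>{1..Y}. 1 / 2 ^ A)"
        by (rule sum_mono2) (auto simp: prime_gt_0_nat Suc_le_eq)
      also have "\<dots> = real Y / 2 ^ A" by simp
      also have "\<dots> \<le> \<eta> / 4" using A by simp
      finally show ?thesis by (simp add: mult_left_mono)
    qed
    have B2: "real (card ?B2) \<le> real N * (\<eta> / 4)"
    proof -
      have "real (card ?B2) \<le> real N * (\<Sum>d=Suc Y..N. 1 / real (d ^ 2))"
        by (rule card_multiples_Union) auto
      also have "(\<Sum>d=Suc Y..N. 1 / real (d ^ 2)) \<le> 1 / real Y"
        using sum_inverse_squares_tail[OF Y(3), of N] by simp
      also have "\<dots> \<le> \<eta> / 4" using Y(2) by simp
      finally show ?thesis by (simp add: mult_left_mono)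
    qed
    have B3: "real (card ?B3) \<le> real N * (\<eta> / 4)"
    proof -
      have "(\<Sum>n=1..N. ?h n) \<le> real N * (\<Sum>p | prime p \<and> p \<le> N \<and> Y < p. a p / real p)"
        by (rule sum_prime_factors_le) (use a in auto)
      also have "\<dots> \<le> real N * (\<eta> / 4)" by (rule mult_left_mono[OF tailfin]) simp
      finally have "real (card ?B3) \<le> real N * (\<eta> / 4) / 1"
        by (intro markov_card) (use a in \<open>auto intro!: sum_nonneg\<close>)
      thus ?thesis by simp
    qed
    have sub: "{n\<in>{1..N}. \<bar>g n\<bar> > C} \<subseteq> ?B1 \<union> ?B2 \<union> ?B3"
    proof (rule subsetI, rule ccontr)
      fix n assume n: "n \<in> {n\<in>{1..N}. \<bar>g n\<bar> > C}" and nb: "n \<notin> ?B1 \<union> ?B2 \<union> ?B3"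
      let ?F = "prime_factors n"
      let ?k = "\<lambda>p. multiplicity p n"
      have n0: "n > 0" "n \<le> N" using n by auto
      have b1: "\<not> p ^ A dvd n" if "prime p" "p \<le> Y" for p using nb n that by auto
      have b2: "\<not> d ^ 2 dvd n" if "Y < d" for d
      proof
        assume d: "d ^ 2 dvd n"
        hence "d ^ 2 \<le> N" using n0 by (auto dest: dvd_imp_le)
        moreover have "d \<le> d ^ 2" by (simp add: power2_eq_square)
        ultimately have "d \<in> {Suc Y..N}" using that by auto
        thus False using d nb n by auto
      qed
      have b3: "?h n < 1" using nb n by auto
      have fin: "finite {p. prime p \<and> p dvd n \<and> Y < p}"
        by (rule finite_subset[of _ "{..n}"]) (use n0 in \<open>auto dest: dvd_imp_le\<close>)
      \<comment> \<open>Outside the second exceptional set such a prime divides n only once. Outside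
        the third its weight is below 1, so the minimum in \<open>a p\<close> is |g p|
        itself.\<close>
      have large: "g (p ^ ?k p) = g p \<and> \<bar>g p\<bar> = a p" if p: "p \<in> ?F" "Y < p" for p
      proof
        have pp: "prime p" "p dvd n" using p by auto
        have "\<not> 2 \<le> ?k p" using b2[OF p(2)] multiplicity_dvd'[of 2 p n] by auto
        moreover have "?k p \<noteq> 0" using p by (auto simp: prime_factors_multiplicity)
        ultimately have "?k p = 1" by simp
        thus "g (p ^ ?k p) = g p" by simp
        have "a p \<le> ?h n" by (rule member_le_sum) (use pp p a fin in auto)
        hence "a p < 1" using b3 by simp
        thus "\<bar>g p\<bar> = a p" by (auto simp: a_def min_def split: if_splits)
      qed
      have small: "?k p \<le> A" if p: "p \<in> ?F" "p \<le> Y" for p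
      proof (rule ccontr)
        assume "\<not> ?k p \<le> A"
        hence "p ^ A dvd n" using multiplicity_dvd'[of A p n] by simp
        thus False using b1 p by auto
      qed
      have "\<bar>g n\<bar> \<le> (\<Sum>p\<in>?F. \<bar>g (p ^ ?k p)\<bar>)"
        by (subst additive_fun_eq_sum[OF g n0(1)]) (rule sum_abs)
      also have "\<dots> = (\<Sum>p\<in>{p\<in>?F. p \<le> Y}. \<bar>g (p ^ ?k p)\<bar>) + (\<Sum>p\<in>{p\<in>?F. Y < p}. \<bar>g (p ^ ?k p)\<bar>)"
      proof -
        have "?F = {p\<in>?F. p \<le> Y} \<union> {p\<in>?F. Y < p}" by auto
        moreover have "{p\<in>?F. p \<le> Y} \<inter> {p\<in>?F. Y < p} = {}" by auto
        ultimately show ?thesis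
          using sum.union_disjoint[of "{p\<in>?F. p \<le> Y}" "{p\<in>?F. Y < p}" "\<lambda>p. \<bar>g (p ^ ?k p)\<bar>"] by simp
      qed
      also have "(\<Sum>p\<in>{p\<in>?F. Y < p}. \<bar>g (p ^ ?k p)\<bar>) = (\<Sum>p\<in>{p\<in>?F. Y < p}. a p)"
        using large by (intro sum.cong) auto
      also have "{p\<in>?F. Y < p} = {p. prime p \<and> p dvd n \<and> Y < p}" using n0 by (auto simp: in_prime_factors_iff)
      also have "?h n < 1" by (rule b3)
      also have "(\<Sum>p\<in>{p\<in>?F. p \<le> Y}. \<bar>g (p ^ ?k p)\<bar>) \<le> (\<Sum>p\<in>{p\<in>?F. p \<le> Y}. \<Sum>k\<le>A. \<bar>g (p ^ k)\<bar>)"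
      proof (rule sum_mono)
        fix p assume p: "p \<in> {p\<in>?F. p \<le> Y}"
        hence "?k p \<in> {..A}" using small[of p] by auto
        from member_le_sum[OF this, of "\<lambda>k. \<bar>g (p ^ k)\<bar>"]
        show "\<bar>g (p ^ ?k p)\<bar> \<le> (\<Sum>k\<le>A. \<bar>g (p ^ k)\<bar>)" by simp
      qed
      also have "\<dots> \<le> (\<Sum>p\<le>Y. \<Sum>k\<le>A. \<bar>g (p ^ k)\<bar>)"
        by (rule sum_mono2) (auto intro!: sum_nonneg)
      finally show False using n by (simp add: C_def)
    qed
    have "card {n\<in>{1..N}. \<bar>g n\<bar> > C} \<le> card (?B1 \<union> ?B2 \<union> ?B3)"
      by (rule card_mono[OF _ sub]) auto
    also have "\<dots> \<le> card ?B1 + card ?B2 + card ?B3"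
      using card_Un_le[of "?B1 \<union> ?B2" ?B3] card_Un_le[of ?B1 ?B2] by linarith
    finally have "real (card {n\<in>{1..N}. \<bar>g n\<bar> > C}) \<le> real (card ?B1) + real (card ?B2) + real (card ?B3)"
      by linarith
    also have "\<dots> \<le> 3 / 4 * (real N * \<eta>)" using B1 B2 B3 by simp
    also have "\<dots> \<le> \<eta> * real N" using \<eta> by simp
    finally show "real (card {n\<in>{1..N}. \<bar>g n\<bar> > C}) \<le> \<eta> * real N" .
  qed
qed

lemma additive_near_prime_count:
  fixes f :: "nat \<Rightarrow> real"
  assumes f: "additive_fun f"
    and sm: "summable (\<lambda>p. if prime p then min 1 \<bar>f p - c\<bar> / real p else 0)"
    and \<eta>: "\<eta> > 0"
  shows "\<exists>C. \<forall>N. real (card {n\<in>{1..N}. \<bar>f n - c * real (card (prime_factors n))\<bar> > C}) \<le> \<eta> * real N"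
proof (rule additive_tight[OF additive_fun_diff_om[OF f] _ \<eta>])
  have "(\<lambda>p. if prime p then min 1 \<bar>f p - c * real (card (prime_factors p))\<bar> / real p else 0) =
      (\<lambda>p. if prime p then min 1 \<bar>f p - c\<bar> / real p else 0)"
    by (auto simp: prime_prime_factors)
  thus "summable (\<lambda>p. if prime p then min 1 \<bar>f p - c * real (card (prime_factors p))\<bar> / real p else 0)"
    using sm by simp
qed

section \<open>From the hypothesis on primes to a convergent series\<close>

lemma summable_of_dyadic_bound:
  fixes a :: "nat \<Rightarrow> real" and \<delta> :: real
  assumes a: "\<And>p. a p \<ge> 0" and \<delta>: "\<delta> > 0"
    and S: "\<And>x::nat. x \<ge> X \<Longrightarrow> (\<Sum>p | prime p \<and> p \<le> x. a p / real p powr (1 - \<delta>)) \<le> real x powr (\<delta> / 2)"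
  shows "summable (\<lambda>p. if prime p then a p / real p else 0)"
proof -
  define t where "t = (\<lambda>p::nat. if prime p then a p / real p else 0)"
  \<comment> \<open>On the block (2^i, 2^(i+1)] the passage from p^(1 - \<delta>) to p gains 2^(-i
    \<delta>), while the assumed bound grows only like 2^(i \<delta> / 2). The blocks therefore
    decay geometrically with ratio 2^(-\<delta> / 2).\<close>
  define \<rho> where "\<rho> = (2::real) powr (- (\<delta> / 2))"
  have t: "t p \<ge> 0" for p using a by (simp add: t_def)
  have \<rho>: "0 < \<rho>" "\<rho> < 1" using \<delta> by (auto simp: \<rho>_def powr_less_one)
  obtain i0 :: nat where i0: "X \<le> 2 ^ i0"
    by (meson less_exp less_imp_le)
  have step: "(\<Sum>p\<in>{2^i<..2^Suc i}. t p) \<le> 2 powr (\<delta> / 2) * \<rho> ^ i" if i: "i \<ge> i0" for i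
  proof -
    let ?D = "{p. prime p \<and> p \<in> {2^i<..(2::nat)^Suc i}}"
    have finD: "finite ?D" by (rule finite_subset[of _ "{2^i<..2^Suc i}"]) auto
    have "(\<Sum>p\<in>{2^i<..2^Suc i}. t p) = (\<Sum>p\<in>?D. a p / real p)"
      unfolding t_def by (subst sum.inter_filter[symmetric]) (auto intro!: sum.cong)
    also have "\<dots> \<le> (\<Sum>p\<in>?D. (2 ^ i) powr (- \<delta>) * (a p / real p powr (1 - \<delta>)))"
    proof (rule sum_mono)
      fix p assume p: "p \<in> ?D"
      hence "2 ^ i < p" by auto
      hence pi: "(2::real) ^ i \<le> real p" by (metis less_imp_le of_nat_le_iff of_nat_numeral of_nat_power)
      have pp: "real p > 0" using p by auto
      have "a p / real p = real p powr (- \<delta>) * (a p / real p powr (1 - \<delta>))"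
        using pp by (simp add: powr_diff powr_minus field_simps)
      also have "\<dots> \<le> (2 ^ i) powr (- \<delta>) * (a p / real p powr (1 - \<delta>))"
        using pi \<delta> a[of p] by (intro mult_right_mono powr_mono2') auto
      finally show "a p / real p \<le> (2 ^ i) powr (- \<delta>) * (a p / real p powr (1 - \<delta>))" .
    qed
    also have "\<dots> = (2 ^ i) powr (- \<delta>) * (\<Sum>p\<in>?D. a p / real p powr (1 - \<delta>))"
      by (simp only: sum_distrib_left)
    also have "(\<Sum>p\<in>?D. a p / real p powr (1 - \<delta>)) \<le> (\<Sum>p | prime p \<and> p \<le> 2 ^ Suc i. a p / real p powr (1 - \<delta>))"
      by (rule sum_mono2) (use a in auto)
    also have "\<dots> \<le> real (2 ^ Suc i) powr (\<delta> / 2)"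
      by (rule S) (use i i0 in \<open>metis le_SucI order_trans power_increasing one_le_numeral\<close>)
    also have "(2 ^ i) powr (- \<delta>) * real (2 ^ Suc i) powr (\<delta> / 2) = 2 powr (\<delta> / 2) * \<rho> ^ i"
    proof -
      have "(2 ^ i) powr (- \<delta>) * real (2 ^ Suc i) powr (\<delta> / 2) = (2 powr real i) powr (- \<delta>) * (2 powr real (Suc i)) powr (\<delta> / 2)"
        by (simp only: powr_realpow zero_less_numeral of_nat_power of_nat_numeral)
      also have "\<dots> = 2 powr (real i * (- \<delta>) + real (Suc i) * (\<delta> / 2))"
        by (simp only: powr_powr powr_add)
      also have "real i * (- \<delta>) + real (Suc i) * (\<delta> / 2) = \<delta> / 2 + (- (\<delta> / 2)) * real i"
        by (simp add: field_simps)
      also have "2 powr (\<delta> / 2 + (- (\<delta> / 2)) * real i) = 2 powr (\<delta> / 2) * (2 powr (- (\<delta> / 2))) powr real i"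
        by (simp only: powr_powr powr_add)
      also have "\<dots> = 2 powr (\<delta> / 2) * \<rho> ^ i"
        using \<rho> unfolding \<rho>_def by (simp only: powr_realpow)
      finally show ?thesis .
    qed
    finally show ?thesis by (simp add: mult_left_mono)
  qed
  have part: "(\<Sum>p\<le>2^(i0+m). t p) \<le> (\<Sum>p\<le>2^i0. t p) + 2 powr (\<delta> / 2) * (\<Sum>j<m. \<rho> ^ (i0 + j))" for m
  proof (induction m)
    case (Suc m)
    have "{..2^(i0 + Suc m)} = {..2^(i0+m)} \<union> {2^(i0+m)<..(2::nat)^Suc (i0+m)}" by auto
    hence "(\<Sum>p\<le>2^(i0 + Suc m). t p) = (\<Sum>p\<le>2^(i0+m). t p) + (\<Sum>p\<in>{2^(i0+m)<..2^Suc (i0+m)}. t p)"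
      by (simp only:) (subst sum.union_disjoint, auto)
    with Suc step[of "i0 + m"] show ?case by (simp add: ring_distribs)
  qed simp
  have geo: "(\<Sum>j<m. \<rho> ^ (i0 + j)) \<le> 1 / (1 - \<rho>)" for m
  proof -
    have "(\<Sum>j<m. \<rho> ^ (i0 + j)) \<le> (\<Sum>j<m. \<rho> ^ j)"
      using \<rho> by (intro sum_mono power_decreasing) auto
    also have "\<dots> \<le> (\<Sum>j. \<rho> ^ j)"
      using \<rho> by (intro sum_le_suminf summable_geometric) auto
    also have "\<dots> = 1 / (1 - \<rho>)" using \<rho> by (intro suminf_geometric) auto
    finally show ?thesis .
  qed
  have "summable t"
  proof (rule summableI_nonneg_bounded)
    fix n
    have "(\<Sum>p<n. t p) \<le> (\<Sum>p\<le>2^(i0+n). t p)"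
    proof (rule sum_mono2)
      have "n \<le> 2 ^ (i0 + n)"
        by (meson less_exp less_imp_le le_add2 order_trans power_increasing one_le_numeral)
      thus "{..<n} \<subseteq> {..2^(i0+n)}" by auto
    qed (use t in auto)
    also have "\<dots> \<le> (\<Sum>p\<le>2^i0. t p) + 2 powr (\<delta> / 2) * (1 / (1 - \<rho>))"
      using part[of n] mult_left_mono[OF geo[of n], of "2 powr (\<delta> / 2)"] by simp
    finally show "(\<Sum>p<n. t p) \<le> (\<Sum>p\<le>2^i0. t p) + 2 powr (\<delta> / 2) * (1 / (1 - \<rho>))" .
  qed (rule t)
  thus ?thesis by (simp only: t_def)
qed

text \<open>The hypothesis bounds the weighted sum by ln (ln x), and undoing the scaling inside
  \<open>B_eps\<close> costs at most another factor ln (ln x). The square of ln (ln x) is far below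
  x^(\<delta>/2), which is all that the dyadic argument needs; the extra weight p^\<delta> is what
  leaves this room.\<close>

lemma almost_constant_summable:
  assumes "almost_constant_on_primes f"
  obtains c where "c > 0" "summable (\<lambda>p. if prime p then min 1 \<bar>f p - c\<bar> / real p else 0)"
proof -
  obtain c \<delta> \<epsilon>\<^sub>0 where c: "c > 0" "0 < \<delta>" "\<delta> < 1/2" "\<epsilon>\<^sub>0 > 0" and
    H: "\<And>\<epsilon>. 0 < \<epsilon> \<and> \<epsilon> < \<epsilon>\<^sub>0 \<Longrightarrow>
        (\<lambda>x::real. exp (\<Sum>p | prime p \<and> real p \<le> x. B_eps f c \<epsilon> x p / real p powr (1 - \<delta>)))
          \<in> o[at_top](\<lambda>x. ln x)"
    using assms unfolding almost_constant_on_primes_def by blast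
  \<comment> \<open>The bound \<epsilon> \<le> 1 ensures that (ln (ln x))^(\<epsilon>/4) is at most
    ln (ln x).\<close>
  define \<epsilon> where "\<epsilon> = min (\<epsilon>\<^sub>0 / 2) 1"
  have \<epsilon>: "0 < \<epsilon>" "\<epsilon> < \<epsilon>\<^sub>0" "\<epsilon> \<le> 1" using c by (auto simp: \<epsilon>_def)
  define F where "F = (\<lambda>x::real. \<Sum>p | prime p \<and> real p \<le> x. B_eps f c \<epsilon> x p / real p powr (1 - \<delta>))"
  have "(\<lambda>x. exp (F x)) \<in> o[at_top](\<lambda>x. ln x)" unfolding F_def using H \<epsilon> by blast
  hence 1: "eventually (\<lambda>x. norm (exp (F x)) \<le> 1 * norm (ln x)) at_top"
    by (rule landau_o.smallD) simp
  have 2: "eventually (\<lambda>x::real. ln (ln x) \<ge> 1) at_top" by real_asymp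
  have 3: "eventually (\<lambda>x::real. ln (ln x) ^ 2 \<le> x powr (\<delta> / 2)) at_top" using c(2) by real_asymp
  have 4: "eventually (\<lambda>x::real. ln x > 0) at_top" by real_asymp
  have "eventually (\<lambda>x. (\<Sum>p | prime p \<and> real p \<le> x. min 1 \<bar>f p - c\<bar> / real p powr (1 - \<delta>)) \<le> x powr (\<delta> / 2)) at_top"
    using 1 2 3 4
  proof eventually_elim
    case (elim x)
    let ?l = "ln (ln x)"
    have Fx: "F x \<le> ?l"
    proof -
      have "exp (F x) \<le> ln x" using elim by simp
      hence "ln (exp (F x)) \<le> ln (ln x)" using elim by (subst ln_le_cancel_iff) auto
      thus ?thesis by simp
    qed
    have q: "?l powr (\<epsilon> / 4) \<le> ?l" "1 \<le> ?l powr (\<epsilon> / 4)"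
    proof -
      have "?l powr (\<epsilon> / 4) \<le> ?l powr 1" using elim \<epsilon> by (intro powr_mono) auto
      thus "?l powr (\<epsilon> / 4) \<le> ?l" using elim by simp
      show "1 \<le> ?l powr (\<epsilon> / 4)" using elim \<epsilon> by (intro ge_one_powr_ge_zero) auto
    qed
    \<comment> \<open>Multiplication by q = (ln (ln x))^(\<epsilon>/4) turns the minimum into min (2
      q) |f p - c|, and q \<ge> 1.\<close>
    have B: "min 1 \<bar>f p - c\<bar> \<le> ?l powr (\<epsilon> / 4) * B_eps f c \<epsilon> x p" for p
    proof -
      let ?q = "?l powr (\<epsilon> / 4)"
      have "?q * B_eps f c \<epsilon> x p = min (?q * 2) (\<bar>f p - c\<bar>)"
        using q unfolding B_eps_def by (simp add: min_mult_distrib_left)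
      thus ?thesis using q by (auto simp: min_def)
    qed
    have "(\<Sum>p | prime p \<and> real p \<le> x. min 1 \<bar>f p - c\<bar> / real p powr (1 - \<delta>)) \<le>
       (\<Sum>p | prime p \<and> real p \<le> x. ?l powr (\<epsilon> / 4) * (B_eps f c \<epsilon> x p / real p powr (1 - \<delta>)))"
    proof (rule sum_mono)
      fix p
      show "min 1 \<bar>f p - c\<bar> / real p powr (1 - \<delta>) \<le> ?l powr (\<epsilon> / 4) * (B_eps f c \<epsilon> x p / real p powr (1 - \<delta>))"
        using divide_right_mono[OF B[of p], of "real p powr (1 - \<delta>)"] by simp
    qed
    also have "\<dots> = ?l powr (\<epsilon> / 4) * F x" unfolding F_def by (simp only: sum_distrib_left)
    also have "\<dots> \<le> ?l powr (\<epsilon> / 4) * ?l" using Fx q by (intro mult_left_mono) auto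
    also have "\<dots> \<le> ?l * ?l" using q elim(2) by (intro mult_right_mono) linarith+
    also have "\<dots> \<le> x powr (\<delta> / 2)" using elim by (simp add: power2_eq_square)
    finally show ?case .
  qed
  then obtain X where X: "\<And>x. x \<ge> X \<Longrightarrow> (\<Sum>p | prime p \<and> real p \<le> x. min 1 \<bar>f p - c\<bar> / real p powr (1 - \<delta>)) \<le> x powr (\<delta> / 2)"
    by (auto simp: eventually_at_top_linorder)
  have "summable (\<lambda>p. if prime p then min 1 \<bar>f p - c\<bar> / real p else 0)"
  proof (rule summable_of_dyadic_bound[where X = "nat \<lceil>X\<rceil>" and \<delta> = \<delta>])
    fix x :: nat assume "x \<ge> nat \<lceil>X\<rceil>"
    hence "real x \<ge> X" by linarith
    from X[OF this] show "(\<Sum>p | prime p \<and> p \<le> x. min 1 \<bar>f p - c\<bar> / real p powr (1 - \<delta>)) \<le> real x powr (\<delta> / 2)"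
      by simp
  qed (use c in auto)
  with c(1) show ?thesis by (rule that)
qed

section \<open>Exponential sums at all scales below the standard deviation\<close>

definition ll :: "nat \<Rightarrow> real" where "ll N = ln (ln (real N))"

definition cutoff :: "nat \<Rightarrow> real" where "cutoff N = exp (ln (real N) / (4 * ll N))"

definition small_primes :: "nat \<Rightarrow> nat set" where
  "small_primes N = {p. prime p \<and> real p \<le> cutoff N}"

definition prime_recip_sum :: "nat \<Rightarrow> real" where
  "prime_recip_sum N = (\<Sum>p | prime p \<and> p \<le> N. 1 / real p)"

lemma finite_small_primes [simp]: "finite (small_primes N)"
proof (rule finite_subset)
  show "small_primes N \<subseteq> {..nat \<lfloor>cutoff N\<rfloor>}"
    by (auto simp: small_primes_def le_nat_floor)
qed simp

lemma card_small_primes_le: "real (card (small_primes N)) \<le> cutoff N"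
proof -
  have "small_primes N \<subseteq> {1..nat \<lfloor>cutoff N\<rfloor>}"
    by (auto simp: small_primes_def le_nat_floor Suc_le_eq prime_gt_0_nat)
  hence "card (small_primes N) \<le> nat \<lfloor>cutoff N\<rfloor>"
    using card_mono[of "{1..nat \<lfloor>cutoff N\<rfloor>}"] by simp
  moreover have "cutoff N \<ge> 0" by (simp add: cutoff_def)
  ultimately show ?thesis by linarith
qed

lemma eventually_ll_ge: "eventually (\<lambda>N. ll N \<ge> C) sequentially"
  unfolding ll_def by real_asymp

lemma filterlim_ll: "filterlim ll at_top sequentially"
  unfolding ll_def by real_asymp

lemma eventually_ll_compose:
  assumes "eventually P (at_top :: real filter)"
  shows "eventually (\<lambda>N. P (ll N)) sequentially"
  using filterlim_ll assms by (simp add: filterlim_iff)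

lemma prime_recip_sum_ge:
  assumes "N \<ge> 2"
  shows "prime_recip_sum N \<ge> ll N - 1"
proof -
  have "ln (real N) \<le> 2 * exp (prime_recip_sum N)"
    using ln_le_exp_sum_primes[of N] assms by (simp add: prime_recip_sum_def)
  hence "ll N \<le> ln (2 * exp (prime_recip_sum N))"
    unfolding ll_def using assms by (subst ln_le_cancel_iff) auto
  also have "\<dots> = ln 2 + prime_recip_sum N" by (simp add: ln_mult)
  finally show ?thesis using ln_2_less_1 by simp
qed

lemma prime_recip_sum_le:
  assumes "N \<ge> 2"
  shows "prime_recip_sum N \<le> 2 * ll N + 7"
proof -
  have "{p. prime p \<and> p \<le> N} = insert 2 {p. prime p \<and> 2 < real p \<and> real p \<le> real N}"
    using assms by (auto dest: prime_ge_2_nat)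
  hence "prime_recip_sum N = 1 / 2 + (\<Sum>p | prime p \<and> 2 < real p \<and> real p \<le> real N. 1 / real p)"
    unfolding prime_recip_sum_def by simp
  also have "\<dots> \<le> 1 / 2 + (4 + 2 * ln (ln (real N) / ln 2))"
    using sum_primes_between[of 2 "real N"] assms by simp
  also have "ln (ln (real N) / ln 2) \<le> ln (2 * ln (real N))"
  proof -
    have "1 / 2 \<le> ln (2::real)" using ln2_ge_two_thirds by simp
    hence "ln (real N) / ln 2 \<le> ln (real N) / (1 / 2)" using assms by (intro divide_left_mono) auto
    moreover have "ln (real N) / ln 2 > 0" using assms by simp
    ultimately show ?thesis by (intro ln_mono) simp_all
  qed
  also have "\<dots> = ln 2 + ll N" using assms by (simp add: ln_mult ll_def)
  also have "ln 2 \<le> (1::real)" using ln_2_less_1 by simp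
  finally show ?thesis by simp
qed

text \<open>The ratio of ln N to ln (cutoff N) is exactly 4 * ll N, so
  \<open>sum_primes_between\<close> yields a logarithm of \<open>ll N\<close>.\<close>

lemma eventually_large_primes_sum:
  "eventually (\<lambda>N. (\<Sum>p | prime p \<and> p \<le> N \<and> cutoff N < real p. 1 / real p) \<le> 4 + 2 * ln (4 * ll N)) sequentially"
proof -
  have 1: "eventually (\<lambda>N. cutoff N \<ge> 2) sequentially"
    unfolding cutoff_def ll_def by real_asymp
  have 2: "eventually (\<lambda>N. cutoff N \<le> real N) sequentially"
    unfolding cutoff_def ll_def by real_asymp
  show ?thesis using 1 2 eventually_ll_ge[of 1] eventually_ge_at_top[of 2]
  proof eventually_elim
    case (elim N)
    have lnN: "ln (real N) > 0" using elim by simp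
    have "{p. prime p \<and> p \<le> N \<and> cutoff N < real p} = {p. prime p \<and> cutoff N < real p \<and> real p \<le> real N}"
      by auto
    moreover have "ln (real N) / ln (cutoff N) = 4 * ll N"
      using elim lnN by (simp add: cutoff_def)
    ultimately show ?case using sum_primes_between[of "cutoff N" "real N"] elim by simp
  qed
qed

lemma small_primes_sum:
  "eventually (\<lambda>N. ll N / 2 \<le> (\<Sum>p\<in>small_primes N. 1 / real p) \<and>
     (\<Sum>p\<in>small_primes N. 1 / real p) \<le> 3 * ll N) sequentially"
proof -
  have 1: "eventually (\<lambda>N. ll N - 1 - (4 + 2 * ln (4 * ll N)) \<ge> ll N / 2) sequentially"
    by (rule eventually_ll_compose) real_asymp
  have 2: "eventually (\<lambda>N. cutoff N \<le> real N) sequentially"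
    unfolding cutoff_def ll_def by real_asymp
  show ?thesis using 1 2 eventually_ll_ge[of 7] eventually_ge_at_top[of 2] eventually_large_primes_sum
  proof eventually_elim
    case (elim N)
    have "{p. prime p \<and> p \<le> N} = small_primes N \<union> {p. prime p \<and> p \<le> N \<and> cutoff N < real p}"
      using elim by (auto simp: small_primes_def)
    moreover have "small_primes N \<inter> {p. prime p \<and> p \<le> N \<and> cutoff N < real p} = {}"
      by (auto simp: small_primes_def)
    ultimately have "prime_recip_sum N = (\<Sum>p\<in>small_primes N. 1 / real p) +
        (\<Sum>p | prime p \<and> p \<le> N \<and> cutoff N < real p. 1 / real p)"
      unfolding prime_recip_sum_def by (simp only:) (rule sum.union_disjoint, auto)
    moreover have "(\<Sum>p | prime p \<and> p \<le> N \<and> cutoff N < real p. 1 / real p) \<ge> 0"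
      by (intro sum_nonneg) auto
    ultimately show ?case
      using prime_recip_sum_ge[of N] prime_recip_sum_le[of N] elim by linarith
  qed
qed

text \<open>The difference is kept as a sum of ones over primes so that
  \<open>sum_prime_factors_le\<close> applies to it directly.\<close>

lemma om_split:
  assumes "n > 0"
  shows "real (card (prime_factors n)) - real (om (small_primes N) n) =
     (\<Sum>p | prime p \<and> p dvd n \<and> cutoff N < real p. 1)"
proof -
  let ?A = "{p\<in>small_primes N. p dvd n}" and ?B = "{p. prime p \<and> p dvd n \<and> cutoff N < real p}"
  have "prime_factors n = ?A \<union> ?B"
    using assms by (auto simp: small_primes_def in_prime_factors_iff)
  moreover have "?A \<inter> ?B = {}" by (auto simp: small_primes_def)
  moreover have "finite ?B" by (rule finite_subset[of _ "prime_factors n"]) (use assms in \<open>auto simp: in_prime_factors_iff\<close>)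
  ultimately have "card (prime_factors n) = card ?A + card ?B"
    by (simp add: card_Un_disjoint)
  thus ?thesis by (simp add: om_def)
qed

text \<open>The primes above the cutoff contribute only \<open>O(ln (ll N))\<close> on average.\<close>

lemma additive_approx_om:
  fixes f :: "nat \<Rightarrow> real"
  assumes f: "additive_fun f" and c: "c > 0"
    and sm: "summable (\<lambda>p. if prime p then min 1 \<bar>f p - c\<bar> / real p else 0)"
    and eps: "\<epsilon> > 0" "\<kappa> > 0" "\<eta> > 0"
  shows "eventually (\<lambda>N. real (card {n\<in>{1..N}. \<bar>f n - c * real (om (small_primes N) n)\<bar> > \<kappa> * ll N powr \<epsilon>}) \<le> \<eta> * real N) sequentially"
proof -
  define g where "g = (\<lambda>n. f n - c * real (card (prime_factors n)))"
  obtain C where C: "\<And>N. real (card {n\<in>{1..N}. \<bar>g n\<bar> > C}) \<le> \<eta> / 2 * real N"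
    using additive_near_prime_count[OF f sm, of "\<eta> / 2"] eps unfolding g_def by auto
  have 1: "eventually (\<lambda>N. C + c * (\<kappa> / (2 * c) * ll N powr \<epsilon>) \<le> \<kappa> * ll N powr \<epsilon>) sequentially"
    by (rule eventually_ll_compose) (use c eps in real_asymp)
  have 2: "eventually (\<lambda>N. (4 + 2 * ln (4 * ll N)) / (\<kappa> / (2 * c) * ll N powr \<epsilon>) \<le> \<eta> / 2) sequentially"
    by (rule eventually_ll_compose) (use c eps in real_asymp)
  show ?thesis
    using 1 2 eventually_large_primes_sum eventually_ll_ge[of 1]
  proof eventually_elim
    case (elim N)
    \<comment> \<open>Half of the tolerance goes to the primes above the cutoff, whence the division
      by 2c; the other half eventually absorbs the constant \<open>C\<close>, which does not depend
      on N.\<close>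
    define s where "s = \<kappa> / (2 * c) * ll N powr \<epsilon>"
    have s: "s > 0" unfolding s_def using elim c eps by simp
    let ?h = "\<lambda>n. (\<Sum>p | prime p \<and> p dvd n \<and> cutoff N < real p. 1::real)"
    let ?B1 = "{n\<in>{1..N}. \<bar>g n\<bar> > C}" and ?B2 = "{n\<in>{1..N}. ?h n \<ge> s}"
    have sub: "{n\<in>{1..N}. \<bar>f n - c * real (om (small_primes N) n)\<bar> > \<kappa> * ll N powr \<epsilon>} \<subseteq> ?B1 \<union> ?B2"
    proof (rule subsetI, rule ccontr)
      fix n assume n: "n \<in> {n\<in>{1..N}. \<bar>f n - c * real (om (small_primes N) n)\<bar> > \<kappa> * ll N powr \<epsilon>}"
        and nb: "n \<notin> ?B1 \<union> ?B2"
      have h: "real (card (prime_factors n)) - real (om (small_primes N) n) = ?h n"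
        using n by (intro om_split) auto
      have eq: "f n - c * real (om (small_primes N) n) = g n + c * ?h n"
        unfolding h[symmetric] g_def by (simp add: algebra_simps)
      have b: "\<bar>g n\<bar> \<le> C" "?h n < s" using n nb by auto
      have "?h n \<ge> 0" by (intro sum_nonneg) auto
      hence "\<bar>f n - c * real (om (small_primes N) n)\<bar> \<le> \<bar>g n\<bar> + c * ?h n"
        unfolding eq using c by (simp add: abs_triangle_ineq[THEN order_trans])
      also have "\<dots> \<le> C + c * s" using b c by (intro add_mono mult_left_mono) auto
      also have "\<dots> \<le> \<kappa> * ll N powr \<epsilon>" using elim(1) unfolding s_def .
      finally show False using n by simp
    qed
    have B2: "real (card ?B2) \<le> \<eta> / 2 * real N"
    proof -
      have "(\<Sum>n=1..N. ?h n) \<le> real N * (\<Sum>p | prime p \<and> p \<le> N \<and> cutoff N < real p. 1 / real p)"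
        by (rule sum_prime_factors_le) simp
      also have "\<dots> \<le> real N * (4 + 2 * ln (4 * ll N))" using elim by (intro mult_left_mono) auto
      finally have "real (card ?B2) \<le> real N * (4 + 2 * ln (4 * ll N)) / s"
        by (intro markov_card s) (auto intro!: sum_nonneg)
      also have "\<dots> = real N * ((4 + 2 * ln (4 * ll N)) / s)" by simp
      also have "\<dots> \<le> real N * (\<eta> / 2)" using elim(2) unfolding s_def by (intro mult_left_mono) auto
      finally show ?thesis by (simp only: mult.commute)
    qed
    have "card {n\<in>{1..N}. \<bar>f n - c * real (om (small_primes N) n)\<bar> > \<kappa> * ll N powr \<epsilon>} \<le> card (?B1 \<union> ?B2)"
      by (rule card_mono[OF _ sub]) auto
    also have "\<dots> \<le> card ?B1 + card ?B2" by (rule card_Un_le)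
    finally have "real (card {n\<in>{1..N}. \<bar>f n - c * real (om (small_primes N) n)\<bar> > \<kappa> * ll N powr \<epsilon>}) \<le> real (card ?B1) + real (card ?B2)"
      by linarith
    also have "\<dots> \<le> \<eta> * real N" using B2 C[of N] by simp
    finally show ?case .
  qed
qed

text \<open>The lower bound on \<open>M\<close> keeps t = K / M small enough for the truncation; the
  upper bound keeps t^2 ll(N) above K^2 ll(N)^(2 \<epsilon>). The quantifier over \<open>M\<close>
  stands inside \<open>eventually\<close> because the digit positions to be treated vary with
  N.\<close>

lemma om_exp_sum_small:
  fixes K :: real
  assumes K: "K > 0" and eps: "\<epsilon> > 0" "\<eta> > 0"
  shows "eventually (\<lambda>N. \<forall>M. ll N powr \<epsilon> \<le> M \<and> M \<le> ll N powr (1/2 - \<epsilon>) \<longrightarrow>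
     norm (\<Sum>n=1..N. cis (K / M * real (om (small_primes N) n))) \<le> \<eta> * real N) sequentially"
proof -
  have 1: "eventually (\<lambda>N. exp (- (K\<^sup>2 * ll N powr (2 * \<epsilon>) / 16)) \<le> \<eta> / 3) sequentially"
    by (rule eventually_ll_compose) (use K eps in real_asymp)
  have 2: "eventually (\<lambda>N. 2 * exp (- ll N / 2) \<le> \<eta> / 3) sequentially"
    by (rule eventually_ll_compose) (use K eps in real_asymp)
  have 3: "eventually (\<lambda>N. 2 * ln (real N) * sqrt (real N) \<le> \<eta> / 3 * real N) sequentially"
    using eps by real_asymp
  \<comment> \<open>K \<le> l^\<epsilon> gives |t| \<le> 1. With L \<le> 3 l, the bound 18 K \<le>
    l^\<epsilon> gives 3 |t| L \<le> l / 2, half of the truncation order.\<close>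
  have 4: "eventually (\<lambda>N. K + 18 * K \<le> ll N powr \<epsilon>) sequentially"
    by (rule eventually_ll_compose) (use K eps in real_asymp)
  have 5: "eventually (\<lambda>N. cutoff N \<ge> 1) sequentially"
    unfolding cutoff_def ll_def by real_asymp
  show ?thesis
    using 1 2 3 4 5 small_primes_sum eventually_ll_ge[of 1] eventually_ge_at_top[of 2]
  proof eventually_elim
    case (elim N)
    define L where "L = (\<Sum>p\<in>small_primes N. 1 / real p)"
    define l where "l = ll N"
    define r where "r = nat \<lceil>l\<rceil>"
    have l1: "l \<ge> 1" using elim by (simp add: l_def)
    have r: "l \<le> real r" "real r \<le> l + 1" using l1 unfolding r_def by linarith+
    have L: "l / 2 \<le> L" "L \<le> 3 * l" using elim by (auto simp: L_def l_def)
    have lnN: "ln (real N) > 0" using elim by simp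
    have lN: "exp l = ln (real N)" using lnN by (simp add: l_def ll_def)
    show ?case
    proof (intro allI impI)
      fix M assume M: "ll N powr \<epsilon> \<le> M \<and> M \<le> ll N powr (1/2 - \<epsilon>)"
      define t where "t = K / M"
      have le: "l powr \<epsilon> > 0" using l1 by simp
      have Mpos: "M > 0" using M le unfolding l_def by linarith
      have tpos: "t > 0" using K Mpos by (simp add: t_def)
      have t_up: "t \<le> K / l powr \<epsilon>"
        unfolding t_def using M K mult_pos_pos[OF Mpos le] by (intro divide_left_mono) (auto simp: l_def)
      have t_lo: "t \<ge> K / l powr (1/2 - \<epsilon>)"
        unfolding t_def using M K Mpos l1 by (intro divide_left_mono) (auto simp: l_def)
      have l4: "K + 18 * K \<le> l powr \<epsilon>" using elim by (simp add: l_def)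
      have t1: "\<bar>t\<bar> \<le> 1"
      proof -
        have "K / l powr \<epsilon> \<le> 1" using le l4 K by (simp add: field_simps)
        thus ?thesis using t_up tpos by simp
      qed
      have T1: "exp (- (t ^ 2) / 8 * L) \<le> \<eta> / 3"
      proof -
        have "K\<^sup>2 * l powr (2 * \<epsilon>) / 16 = (K / l powr (1/2 - \<epsilon>)) ^ 2 / 8 * (l / 2)"
        proof -
          have "(l powr (1/2 - \<epsilon>)) ^ 2 = l powr (1 - 2 * \<epsilon>)"
            using l1 by (simp add: powr_power algebra_simps)
          also have "\<dots> = l / l powr (2 * \<epsilon>)" using l1 by (simp add: powr_diff)
          finally have "(l powr (1/2 - \<epsilon>)) ^ 2 = l / l powr (2 * \<epsilon>)" .
          thus ?thesis using l1 by (simp add: power_divide)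
        qed
        also have "\<dots> \<le> t ^ 2 / 8 * L"
          using t_lo L l1 K by (intro mult_mono divide_right_mono power_mono) auto
        finally have "exp (- (t ^ 2) / 8 * L) \<le> exp (- (K\<^sup>2 * l powr (2 * \<epsilon>) / 16))" by simp
        also have "\<dots> \<le> \<eta> / 3" using elim by (simp add: l_def)
        finally show ?thesis .
      qed
      have T2: "2 * exp (3 * \<bar>t\<bar> * L - real (Suc r)) \<le> \<eta> / 3"
      proof -
        have "3 * \<bar>t\<bar> * L \<le> 3 * (K / l powr \<epsilon>) * (3 * l)"
          using t_up tpos L l1 by (intro mult_mono) auto
        also have "\<dots> = 18 * K / l powr \<epsilon> * (l / 2)" by simp
        also have "\<dots> \<le> 1 * (l / 2)"
          using l4 le l1 K by (intro mult_right_mono) (auto simp: field_simps)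
        finally have "3 * \<bar>t\<bar> * L - real (Suc r) \<le> - l / 2" using r by simp
        hence "2 * exp (3 * \<bar>t\<bar> * L - real (Suc r)) \<le> 2 * exp (- l / 2)" by simp
        also have "\<dots> \<le> \<eta> / 3" using elim by (simp add: l_def)
        finally show ?thesis .
      qed
      \<comment> \<open>The number of sets is at most (2 cutoff)^(l + 1). For l \<ge> 1 the exponent
        (l + 1) / (4 l) of N is at most 1/2, which explains the 4 in \<open>cutoff\<close>, and 2^l
        \<le> exp l = ln N. Altogether this is O(sqrt N ln N).\<close>
      have T3: "(real (card (small_primes N)) + 1) ^ r \<le> \<eta> / 3 * real N"
      proof -
        have c1: "cutoff N \<ge> 1" using elim by simp
        have "(real (card (small_primes N)) + 1) ^ r \<le> (2 * cutoff N) ^ r"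
          using card_small_primes_le[of N] c1 by (intro power_mono) auto
        also have "\<dots> = (2 * cutoff N) powr real r" using c1 by (simp add: powr_realpow)
        also have "\<dots> \<le> (2 * cutoff N) powr (l + 1)" using r c1 by (intro powr_mono) auto
        also have "\<dots> = exp ((l + 1) * (ln 2 + ln (real N) / (4 * l)))"
          using c1 by (simp add: powr_def ln_mult cutoff_def l_def)
        also have "(l + 1) * (ln 2 + ln (real N) / (4 * l)) = ln 2 + l * ln 2 + (l + 1) / (2 * l) * (ln (real N) / 2)"
          using l1 by (simp add: field_simps)
        also have "exp \<dots> \<le> exp (ln 2 + l * 1 + 1 * (ln (real N) / 2))"
          using l1 lnN ln_2_less_1 by (subst exp_le_cancel_iff, intro add_mono mult_mono order_refl) auto
        also have "\<dots> = 2 * ln (real N) * sqrt (real N)"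
          using lN lnN elim by (simp add: exp_add ln_sqrt[symmetric])
        also have "\<dots> \<le> \<eta> / 3 * real N" using elim by simp
        finally show ?thesis .
      qed
      have "norm (\<Sum>n=1..N. cis (t * real (om (small_primes N) n))) \<le>
         real N * exp (- (t ^ 2) / 8 * L) + 2 * real N * exp (3 * \<bar>t\<bar> * L - real (Suc r)) + (real (card (small_primes N)) + 1) ^ r"
        unfolding L_def by (rule char_bound[OF _ _ t1]) (simp, simp add: small_primes_def)
      also have "\<dots> \<le> real N * (\<eta> / 3) + real N * (\<eta> / 3) + \<eta> / 3 * real N"
      proof (intro add_mono T3)
        show "real N * exp (- (t ^ 2) / 8 * L) \<le> real N * (\<eta> / 3)" using T1 by (intro mult_left_mono) auto
        have "real N * (2 * exp (3 * \<bar>t\<bar> * L - real (Suc r))) \<le> real N * (\<eta> / 3)" using T2 by (intro mult_left_mono) auto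
        thus "2 * real N * exp (3 * \<bar>t\<bar> * L - real (Suc r)) \<le> real N * (\<eta> / 3)" by simp
      qed
      also have "\<dots> = \<eta> * real N" by simp
      finally show "norm (\<Sum>n=1..N. cis (K / M * real (om (small_primes N) n))) \<le> \<eta> * real N"
        by (simp only: t_def)
    qed
  qed
qed

lemma norm_cis_diff_le: "norm (cis a - cis b) \<le> \<bar>a - b\<bar>"
proof -
  have "cis a - cis b = cis b * (cis (a - b) - 1)"
    by (simp add: right_diff_distrib cis_mult)
  thus ?thesis using norm_cis_minus_one_le[of "a - b"] by (simp add: norm_mult)
qed

text \<open>Off a set of density \<eta>/6 the error of c * om is at most \<eta> / (3 K) times
  ll(N)^\<epsilon> \<le> M, so the phase moves by at most \<eta>/3. On that set the trivial bound 2
  costs another \<eta>/3, and the sum for c * om takes the last third.\<close>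

lemma additive_exp_sum_small:
  fixes f :: "nat \<Rightarrow> real"
  assumes f: "additive_fun f" and c: "c > 0"
    and sm: "summable (\<lambda>p. if prime p then min 1 \<bar>f p - c\<bar> / real p else 0)"
    and eps: "\<epsilon> > 0" "\<eta> > 0" and h: "h \<ge> (1::nat)"
  shows "eventually (\<lambda>N. \<forall>M. ll N powr \<epsilon> \<le> M \<and> M \<le> ll N powr (1/2 - \<epsilon>) \<longrightarrow>
     norm (\<Sum>n=1..N. cis (2 * pi * real h * (f n / M))) \<le> \<eta> * real N) sequentially"
proof -
  define K where "K = 2 * pi * real h"
  have K: "K > 0" using h by (simp add: K_def)
  have 1: "eventually (\<lambda>N. \<forall>M. ll N powr \<epsilon> \<le> M \<and> M \<le> ll N powr (1/2 - \<epsilon>) \<longrightarrow>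
     norm (\<Sum>n=1..N. cis (K * c / M * real (om (small_primes N) n))) \<le> \<eta> / 3 * real N) sequentially"
    by (rule om_exp_sum_small) (use K c eps in auto)
  have 2: "eventually (\<lambda>N. real (card {n\<in>{1..N}. \<bar>f n - c * real (om (small_primes N) n)\<bar> > \<eta> / (3 * K) * ll N powr \<epsilon>}) \<le> \<eta> / 6 * real N) sequentially"
    by (rule additive_approx_om[OF f c sm]) (use eps K in auto)
  show ?thesis using 1 2 eventually_ll_ge[of 1]
  proof eventually_elim
    case (elim N)
    show ?case
    proof (intro allI impI)
      fix M assume M: "ll N powr \<epsilon> \<le> M \<and> M \<le> ll N powr (1/2 - \<epsilon>)"
      have Mpos: "M > 0" using M elim by (smt (verit) powr_gt_zero)
      let ?B = "{n\<in>{1..N}. \<bar>f n - c * real (om (small_primes N) n)\<bar> > \<eta> / (3 * K) * ll N powr \<epsilon>}"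
      let ?a = "\<lambda>n. cis (2 * pi * real h * (f n / M))" and ?b = "\<lambda>n. cis (K * c / M * real (om (small_primes N) n))"
      have "norm (\<Sum>n=1..N. ?a n - ?b n) \<le> (\<Sum>n=1..N. \<eta> / 3 + (if n \<in> ?B then 2 else 0))"
      proof (rule sum_norm_le)
        fix n assume n: "n \<in> {1..N}"
        show "norm (?a n - ?b n) \<le> \<eta> / 3 + (if n \<in> ?B then 2 else 0)"
        proof (cases "n \<in> ?B")
          case True
          have "norm (?a n - ?b n) \<le> norm (?a n) + norm (?b n)" by (rule norm_triangle_ineq4)
          thus ?thesis using True eps by simp
        next
          case False
          hence le: "\<bar>f n - c * real (om (small_primes N) n)\<bar> \<le> \<eta> / (3 * K) * ll N powr \<epsilon>" using n by auto
          have "norm (?a n - ?b n) \<le> \<bar>2 * pi * real h * (f n / M) - K * c / M * real (om (small_primes N) n)\<bar>"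
            by (rule norm_cis_diff_le)
          also have "2 * pi * real h * (f n / M) - K * c / M * real (om (small_primes N) n) = K / M * (f n - c * real (om (small_primes N) n))"
            by (simp add: K_def right_diff_distrib)
          also have "\<bar>\<dots>\<bar> = K / M * \<bar>f n - c * real (om (small_primes N) n)\<bar>"
            using K Mpos by (simp add: abs_mult)
          also have "\<dots> \<le> K / M * (\<eta> / (3 * K) * M)"
          proof (rule mult_left_mono)
            have "\<eta> / (3 * K) * ll N powr \<epsilon> \<le> \<eta> / (3 * K) * M"
              using M eps K by (intro mult_left_mono) auto
            thus "\<bar>f n - c * real (om (small_primes N) n)\<bar> \<le> \<eta> / (3 * K) * M" using le by linarith
          qed (use K Mpos in auto)
          also have "\<dots> = \<eta> / 3" using K Mpos by simp
          finally show ?thesis using False by simp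
        qed
      qed
      also have "\<dots> = \<eta> / 3 * real N + 2 * real (card ?B)"
      proof -
        have "(\<Sum>n=1..N. if n \<in> ?B then 2 else 0 :: real) = (\<Sum>n\<in>{n\<in>{1..N}. n \<in> ?B}. 2)"
          by (rule sum.inter_filter[symmetric]) simp
        also have "{n\<in>{1..N}. n \<in> ?B} = ?B" by auto
        finally show ?thesis by (simp add: sum.distrib)
      qed
      also have "\<dots> \<le> 2 / 3 * (\<eta> * real N)" using elim(2) by simp
      finally have D: "norm ((\<Sum>n=1..N. ?a n) - (\<Sum>n=1..N. ?b n)) \<le> 2 / 3 * (\<eta> * real N)"
        by (simp only: sum_subtractf)
      have "norm (\<Sum>n=1..N. ?b n) \<le> \<eta> / 3 * real N" using elim(1) M by blast
      hence "norm (\<Sum>n=1..N. ?a n) \<le> \<eta> / 3 * real N + 2 / 3 * (\<eta> * real N)"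
        using D norm_triangle_sub[of "\<Sum>n=1..N. ?a n" "\<Sum>n=1..N. ?b n"] by linarith
      thus "norm (\<Sum>n=1..N. ?a n) \<le> \<eta> * real N" by simp
    qed
  qed
qed

section \<open>Weyl's criterion for finite families\<close>

text \<open>Trigonometric polynomials of period 1. Generation by binary sums lets mean values be
  proved by induction, with a single exponential as the only real case.\<close>

inductive trig :: "(real \<Rightarrow> complex) \<Rightarrow> bool" where
  trig_cis: "trig (\<lambda>s. a * cis (2 * pi * of_int h * s))"
| trig_add: "trig f \<Longrightarrow> trig g \<Longrightarrow> trig (\<lambda>s. f s + g s)"

lemma trig_const: "trig (\<lambda>s. a)"
  using trig_cis[of a 0] by simp

lemma trig_mult:
  assumes "trig f" "trig g"
  shows "trig (\<lambda>s. f s * g s)"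
  using assms(1)
proof (induction f rule: trig.induct)
  case (trig_cis a h)
  show ?case using assms(2)
  proof (induction g rule: trig.induct)
    case (trig_cis b k)
    have "(\<lambda>s. a * cis (2 * pi * of_int h * s) * (b * cis (2 * pi * of_int k * s)))
        = (\<lambda>s. (a * b) * cis (2 * pi * of_int (h + k) * s))"
    proof
      fix s
      have "cis (2 * pi * of_int (h + k) * s) = cis (2 * pi * of_int h * s) * cis (2 * pi * of_int k * s)"
        by (simp add: cis_mult algebra_simps)
      thus "a * cis (2 * pi * of_int h * s) * (b * cis (2 * pi * of_int k * s))
        = (a * b) * cis (2 * pi * of_int (h + k) * s)" by simp
    qed
    thus ?case using trig.trig_cis[of "a * b" "h + k"] by simp
  next
    case (trig_add f g)
    thus ?case using trig.trig_add by (simp add: ring_distribs)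
  qed
next
  case (trig_add f g')
  thus ?case using trig.trig_add by (simp add: ring_distribs)
qed

text \<open>This links the polynomials of the Stone-Weierstrass theorem, built from linear
  functionals on the plane, to exponentials: on the unit circle such a functional is h 1 * cos + h
  \<i> * sin.\<close>

lemma trig_real_polynomial:
  fixes p :: "complex \<Rightarrow> real"
  assumes "real_polynomial_function p"
  shows "trig (\<lambda>s. of_real (p (cis (2 * pi * s))))"
  using assms
proof (induction p rule: real_polynomial_function.induct)
  case (linear h)
  interpret h: bounded_linear h by fact
  have "of_real (h (cis (2 * pi * s))) =
        (of_real (h 1) / 2 + of_real (h \<i>) / (2 * \<i>)) * cis (2 * pi * of_int 1 * s) +
        (of_real (h 1) / 2 - of_real (h \<i>) / (2 * \<i>)) * cis (2 * pi * of_int (-1) * s)" for s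
  proof -
    let ?t = "2 * pi * s"
    have "cis ?t = cos ?t *\<^sub>R 1 + sin ?t *\<^sub>R \<i>" by (simp add: complex_eq_iff)
    hence "h (cis ?t) = cos ?t * h 1 + sin ?t * h \<i>" by (simp only: h.add h.scaleR) simp
    thus ?thesis by (simp add: complex_eq_iff Re_divide Im_divide power2_eq_square)
  qed
  thus ?case
    using trig_add[OF trig_cis[of "of_real (h 1) / 2 + of_real (h \<i>) / (2 * \<i>)" 1]
       trig_cis[of "of_real (h 1) / 2 - of_real (h \<i>) / (2 * \<i>)" "-1"]] by simp
next
  case (const c)
  show ?case by (rule trig_const)
next
  case (add f g)
  thus ?case using trig_add by simp
next
  case (mult f g)
  thus ?case using trig_mult by simp
qed

text \<open>A quantitative Weyl criterion without a limit: \<open>H\<close> and \<delta> depend on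
  the test function and \<eta> alone, not on the family. This is needed because the points f n / M
  change completely with N and with the modulus.\<close>

definition weyl_avg :: "(real \<Rightarrow> complex) \<Rightarrow> complex \<Rightarrow> bool" where
  "weyl_avg g a \<longleftrightarrow> (\<forall>\<eta>>0. \<exists>H::nat. \<exists>\<delta>>0. \<forall>(A::nat set) (u :: nat \<Rightarrow> real). finite A \<longrightarrow>
     (\<forall>h\<in>{1..H}. norm (\<Sum>n\<in>A. cis (2 * pi * real h * u n)) \<le> \<delta> * real (card A)) \<longrightarrow>
     norm ((\<Sum>n\<in>A. g (u n)) - of_nat (card A) * a) \<le> \<eta> * real (card A))"

lemma weyl_avgD:
  assumes "weyl_avg g a" "\<eta> > 0"
  obtains H \<delta> where "\<delta> > 0" "\<And>(A::nat set) u. finite A \<Longrightarrow>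
     (\<And>h. h \<in> {1..H} \<Longrightarrow> norm (\<Sum>n\<in>A. cis (2 * pi * real h * u n)) \<le> \<delta> * real (card A)) \<Longrightarrow>
     norm ((\<Sum>n\<in>A. g (u n)) - of_nat (card A) * a) \<le> \<eta> * real (card A)"
proof -
  from assms[unfolded weyl_avg_def] obtain H \<delta> where "\<delta> > 0" "\<forall>(A::nat set) (u :: nat \<Rightarrow> real). finite A \<longrightarrow>
     (\<forall>h\<in>{1..H}. norm (\<Sum>n\<in>A. cis (2 * pi * real h * u n)) \<le> \<delta> * real (card A)) \<longrightarrow>
     norm ((\<Sum>n\<in>A. g (u n)) - of_nat (card A) * a) \<le> \<eta> * real (card A)"
    by (elim allE[of _ \<eta>] impE exE conjE) auto
  thus ?thesis by (intro that[of \<delta> H]) auto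
qed

lemma weyl_avgI:
  assumes "\<And>\<eta>. \<eta> > 0 \<Longrightarrow> \<exists>H::nat. \<exists>\<delta>>0. \<forall>(A::nat set) (u :: nat \<Rightarrow> real). finite A \<longrightarrow>
     (\<forall>h\<in>{1..H}. norm (\<Sum>n\<in>A. cis (2 * pi * real h * u n)) \<le> \<delta> * real (card A)) \<longrightarrow>
     norm ((\<Sum>n\<in>A. g (u n)) - of_nat (card A) * a) \<le> \<eta> * real (card A)"
  shows "weyl_avg g a"
  using assms unfolding weyl_avg_def by simp

lemma trig_average:
  assumes "trig g"
  shows "\<exists>a. (g has_integral a) {0..1} \<and> weyl_avg g a"
  using assms
proof (induction g rule: trig.induct)
  case (trig_cis c h)
  show ?case
  proof (cases "h = 0")
    case True
    have "((\<lambda>s. c) has_integral c) {0..1::real}"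
      using has_integral_const_real[of c 0 1] by simp
    moreover have "weyl_avg (\<lambda>s. c) c"
      by (intro weyl_avgI exI[of _ 0] exI[of _ "1::real"]) simp
    ultimately show ?thesis using True by (intro exI[of _ c]) simp
  next
    case False
    let ?w = "2 * pi * of_int h :: real"
    have w: "?w \<noteq> 0" using False by simp
    have int: "((\<lambda>s. c * cis (?w * s)) has_integral 0) {0..1}"
    proof -
      let ?F = "\<lambda>s. c / (\<i> * of_real ?w) * cis (?w * s)"
      have "((\<lambda>s. c * cis (?w * s)) has_integral (?F 1 - ?F 0)) {0..1}"
      proof (rule fundamental_theorem_of_calculus)
        fix x :: real
        let ?G = "\<lambda>z. c / (\<i> * of_real ?w) * exp (\<i> * of_real ?w * z)"
        have "(?G has_field_derivative c * exp (\<i> * of_real ?w * of_real x)) (at (of_real x))"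
          using False by (auto intro!: derivative_eq_intros)
        from has_vector_derivative_real_field[OF this, of "{0..1}"]
        show "(?F has_vector_derivative c * cis (?w * x)) (at x within {0..1})"
          by (simp only: cis_conv_exp of_real_mult mult.assoc)
      qed simp
      moreover have "cis (?w * 1) = 1"
        by (metis cis_multiple_2pi Ints_of_int mult.right_neutral mult.assoc)
      ultimately show ?thesis by simp
    qed
    have main: "\<exists>H. \<exists>\<delta>>0. \<forall>(A::nat set) u. finite A \<longrightarrow>
       (\<forall>h\<in>{1..H}. norm (\<Sum>n\<in>A. cis (2 * pi * real h * u n)) \<le> \<delta> * real (card A)) \<longrightarrow>
       norm ((\<Sum>n\<in>A. c * cis (?w * u n)) - of_nat (card A) * 0) \<le> \<eta> * real (card A)" if \<eta>: "\<eta> > 0" for \<eta>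
    proof (intro exI[of _ "nat \<bar>h\<bar>"] exI[of _ "\<eta> / (norm c + 1)"] conjI allI impI)
      show "\<eta> / (norm c + 1) > 0" using \<eta> by (simp add: add_nonneg_pos)
      fix A :: "nat set" and u
      assume hyp: "\<forall>k\<in>{1..nat \<bar>h\<bar>}. norm (\<Sum>n\<in>A. cis (2 * pi * real k * u n)) \<le> \<eta> / (norm c + 1) * real (card A)"
      let ?k = "nat \<bar>h\<bar>"
      have k: "?k \<in> {1..nat \<bar>h\<bar>}" using False by auto
      have "norm (\<Sum>n\<in>A. cis (?w * u n)) = norm (\<Sum>n\<in>A. cis (2 * pi * real ?k * u n))"
      proof (cases "h > 0")
        case True
        thus ?thesis by simp
      next
        case False
        \<comment> \<open>The hypothesis speaks only of positive frequencies; a negative one has the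
          conjugate sum, of the same norm.\<close>
        hence "(\<Sum>n\<in>A. cis (?w * u n)) = cnj (\<Sum>n\<in>A. cis (2 * pi * real ?k * u n))"
          by (simp add: cis_cnj)
        thus ?thesis by (simp only: complex_mod_cnj)
      qed
      also have "\<dots> \<le> \<eta> / (norm c + 1) * real (card A)" using hyp k by blast
      finally have "norm c * norm (\<Sum>n\<in>A. cis (?w * u n)) \<le> norm c * (\<eta> / (norm c + 1) * real (card A))"
        by (rule mult_left_mono) simp
      also have "\<dots> = (norm c / (norm c + 1)) * (\<eta> * real (card A))" by simp
      also have "\<dots> \<le> 1 * (\<eta> * real (card A))"
        using \<eta> by (intro mult_right_mono) (auto simp: divide_le_eq_1 add_nonneg_pos)
      finally show "norm ((\<Sum>n\<in>A. c * cis (?w * u n)) - of_nat (card A) * 0) \<le> \<eta> * real (card A)"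
        by (simp add: sum_distrib_left[symmetric] norm_mult)
    qed
    show ?thesis by (intro exI[of _ 0] conjI int weyl_avgI main)
  qed
next
  case (trig_add f g)
  from trig_add.IH(1) obtain a where a: "(f has_integral a) {0..1}" "weyl_avg f a" by (elim exE conjE)
  from trig_add.IH(2) obtain b where b: "(g has_integral b) {0..1}" "weyl_avg g b" by (elim exE conjE)
  have "weyl_avg (\<lambda>s. f s + g s) (a + b)"
  proof (rule weyl_avgI)
    fix \<eta> :: real assume \<eta>: "\<eta> > 0"
    obtain H1 d1 where 1: "d1 > 0" "\<And>A u. finite (A::nat set) \<Longrightarrow> (\<And>h. h\<in>{1..H1} \<Longrightarrow> norm (\<Sum>n\<in>A. cis (2 * pi * real h * u n)) \<le> d1 * real (card A)) \<Longrightarrow>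
       norm ((\<Sum>n\<in>A. f (u n)) - of_nat (card A) * a) \<le> \<eta> / 2 * real (card A)"
      using weyl_avgD[OF a(2), of "\<eta> / 2"] \<eta> half_gt_zero by metis
    obtain H2 d2 where 2: "d2 > 0" "\<And>A u. finite (A::nat set) \<Longrightarrow> (\<And>h. h\<in>{1..H2} \<Longrightarrow> norm (\<Sum>n\<in>A. cis (2 * pi * real h * u n)) \<le> d2 * real (card A)) \<Longrightarrow>
       norm ((\<Sum>n\<in>A. g (u n)) - of_nat (card A) * b) \<le> \<eta> / 2 * real (card A)"
      using weyl_avgD[OF b(2), of "\<eta> / 2"] \<eta> half_gt_zero by metis
    show "\<exists>H::nat. \<exists>\<delta>>0. \<forall>(A::nat set) (u :: nat \<Rightarrow> real). finite A \<longrightarrow>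
     (\<forall>h\<in>{1..H}. norm (\<Sum>n\<in>A. cis (2 * pi * real h * u n)) \<le> \<delta> * real (card A)) \<longrightarrow>
     norm ((\<Sum>n\<in>A. f (u n) + g (u n)) - of_nat (card A) * (a + b)) \<le> \<eta> * real (card A)"
    proof (intro exI[of _ "max H1 H2"] exI[of _ "min d1 d2"] conjI allI impI)
      show "min d1 d2 > 0" using 1 2 by simp
      fix A :: "nat set" and u
      assume fin: "finite A" and hyp: "\<forall>h\<in>{1..max H1 H2}. norm (\<Sum>n\<in>A. cis (2 * pi * real h * u n)) \<le> min d1 d2 * real (card A)"
      have le: "min d1 d2 * real (card A) \<le> d1 * real (card A)" "min d1 d2 * real (card A) \<le> d2 * real (card A)"
        by (intro mult_right_mono; simp)+
      have A1: "norm ((\<Sum>n\<in>A. f (u n)) - of_nat (card A) * a) \<le> \<eta> / 2 * real (card A)"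
      proof (rule 1(2)[OF fin])
        fix h assume "h \<in> {1..H1}"
        hence "h \<in> {1..max H1 H2}" by auto
        with hyp have "norm (\<Sum>n\<in>A. cis (2 * pi * real h * u n)) \<le> min d1 d2 * real (card A)" by blast
        thus "norm (\<Sum>n\<in>A. cis (2 * pi * real h * u n)) \<le> d1 * real (card A)" using le by linarith
      qed
      have A2: "norm ((\<Sum>n\<in>A. g (u n)) - of_nat (card A) * b) \<le> \<eta> / 2 * real (card A)"
      proof (rule 2(2)[OF fin])
        fix h assume "h \<in> {1..H2}"
        hence "h \<in> {1..max H1 H2}" by auto
        with hyp have "norm (\<Sum>n\<in>A. cis (2 * pi * real h * u n)) \<le> min d1 d2 * real (card A)" by blast
        thus "norm (\<Sum>n\<in>A. cis (2 * pi * real h * u n)) \<le> d2 * real (card A)" using le by linarith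
      qed
      have "(\<Sum>n\<in>A. f (u n) + g (u n)) - of_nat (card A) * (a + b) =
         ((\<Sum>n\<in>A. f (u n)) - of_nat (card A) * a) + ((\<Sum>n\<in>A. g (u n)) - of_nat (card A) * b)"
        by (simp add: sum.distrib ring_distribs)
      also have "norm \<dots> \<le> \<eta> / 2 * real (card A) + \<eta> / 2 * real (card A)"
        by (rule norm_triangle_le[OF add_mono[OF A1 A2]])
      finally show "norm ((\<Sum>n\<in>A. f (u n) + g (u n)) - of_nat (card A) * (a + b)) \<le> \<eta> * real (card A)"
        by simp
    qed
  qed
  with has_integral_add[OF a(1) b(1)] show ?case by blast
qed

section \<open>Counting points in arcs of the circle\<close>

lemma cis_2pi_eqD:
  assumes "cis (2 * pi * s) = cis (2 * pi * t)" "0 < s" "s < 1" "0 \<le> t" "t \<le> 1"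
  shows "s = t"
proof -
  have "sin (2 * pi * s) = sin (2 * pi * t) \<and> cos (2 * pi * s) = cos (2 * pi * t)"
    using assms(1) by (simp add: complex_eq_iff)
  then obtain n :: int where "2 * pi * s = 2 * pi * t + 2 * pi * of_int n"
    using sin_cos_eq_iff by blast
  hence "2 * pi * s = 2 * pi * (t + of_int n)" by (simp add: ring_distribs)
  hence st: "s = t + of_int n" by simp
  have "of_int n < (1::real)" "(-1::real) < of_int n" using st assms by linarith+
  hence "n = 0" by linarith
  thus ?thesis using st by simp
qed

lemma cis_2pi_frac: "cis (2 * pi * u) = cis (2 * pi * frac u)"
proof -
  have "2 * pi * u = 2 * pi * frac u + 2 * pi * of_int \<lfloor>u\<rfloor>" by (simp add: frac_def algebra_simps)
  thus ?thesis by (simp add: cis_mult[symmetric] complex_eq_iff sin_add cos_add)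
qed

text \<open>\<open>G k\<close> decreases pointwise to the indicator of a closed arc, so its
  integrals tend to the arc length by dominated convergence. Measuring the distance in the plane
  makes the functions continuous on the circle, with no case distinction at the point 1.\<close>

lemma bump_integral:
  fixes \<alpha> \<beta> :: real
  assumes "0 \<le> \<alpha>" "\<alpha> \<le> \<beta>" "\<beta> \<le> 1"
    and carc_def: "carc = (\<lambda>s. cis (2 * pi * s)) ` {\<alpha>..\<beta>}"
    and G_def: "G = (\<lambda>(k::nat) z. max 0 (1 - real k * infdist z carc))"
  shows "(\<lambda>k. integral {0..1} (\<lambda>s. G k (cis (2 * pi * s)))) \<longlonglongrightarrow> \<beta> - \<alpha>"
    "\<And>k. (\<lambda>s. G k (cis (2 * pi * s))) integrable_on {0..1}"
    "\<And>k. continuous_on UNIV (G k)"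
proof -
  have cont: "continuous_on UNIV (G k)" for k
    unfolding G_def by (intro continuous_intros continuous_on_infdist)
  have ccis: "continuous_on {a..b} (\<lambda>s. cis (2 * pi * s))" for a b
    by (intro continuous_intros)
  have carc: "compact carc" unfolding carc_def by (rule compact_continuous_image[OF ccis]) simp
  have ne: "carc \<noteq> {}" unfolding carc_def using assms(2) by simp
  show int: "(\<lambda>s. G k (cis (2 * pi * s))) integrable_on {0..1}" for k
    by (rule integrable_continuous_real, rule continuous_on_compose2[OF cont ccis]) simp
  show "continuous_on UNIV (G k)" for k by (rule cont)
  define g where "g = (\<lambda>s. if cis (2 * pi * s) \<in> carc then 1 else (0::real))"
  have lim: "(\<lambda>k. integral {0..1} (\<lambda>s. G k (cis (2 * pi * s)))) \<longlonglongrightarrow> integral {0..1} g"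
  proof (rule dominated_convergence(2)[where h = "\<lambda>_. 1"])
    show "(\<lambda>k. G k (cis (2 * pi * s))) \<longlonglongrightarrow> g s" for s
    proof (cases "cis (2 * pi * s) \<in> carc")
      case True
      thus ?thesis by (simp add: G_def g_def)
    next
      case False
      define d where "d = infdist (cis (2 * pi * s)) carc"
      have "d \<noteq> 0" unfolding d_def using False in_closed_iff_infdist_zero[OF compact_imp_closed[OF carc] ne] by simp
      hence d: "d > 0" using infdist_nonneg[of "cis (2 * pi * s)" carc] unfolding d_def by linarith
      obtain K :: nat where K: "1 / d < real K" using reals_Archimedean2 by blast
      have "G k (cis (2 * pi * s)) = 0" if "k \<ge> K" for k
      proof -
        have "1 < real K * d" using K d by (simp add: field_simps)
        also have "\<dots> \<le> real k * d" using that d by (intro mult_right_mono) auto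
        finally show ?thesis by (simp add: G_def d_def)
      qed
      hence "eventually (\<lambda>k. G k (cis (2 * pi * s)) = g s) sequentially"
        using False by (auto simp: g_def eventually_sequentially)
      thus ?thesis by (rule tendsto_eventually)
    qed
    show "norm (G k (cis (2 * pi * s))) \<le> 1" for k s
      using infdist_nonneg[of "cis (2 * pi * s)" carc] by (auto simp: G_def)
  qed (use int in auto)
  have "((\<lambda>s. if s \<in> {\<alpha>..\<beta>} then 1 else (0::real)) has_integral (\<beta> - \<alpha>)) {0..1}"
    by (subst has_integral_restrict) (use assms has_integral_const_real[of "1::real" \<alpha> \<beta>] in auto)
  hence "(g has_integral (\<beta> - \<alpha>)) {0..1}"
  \<comment> \<open>The parameters 0 and 1 describe the same point of the circle, so membership in
    the arc and in the interval can differ there, and only there.\<close>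
  proof (rule has_integral_spike_finite[of "{0, 1}", rotated 2])
    fix x :: real assume x: "x \<in> {0..1} - {0, 1}"
    have "cis (2 * pi * x) \<in> carc \<longleftrightarrow> x \<in> {\<alpha>..\<beta>}"
    proof
      assume "cis (2 * pi * x) \<in> carc"
      then obtain t where t: "t \<in> {\<alpha>..\<beta>}" "cis (2 * pi * x) = cis (2 * pi * t)" unfolding carc_def by blast
      have "x = t" by (rule cis_2pi_eqD[OF t(2)]) (use x t assms in auto)
      thus "x \<in> {\<alpha>..\<beta>}" using t by simp
    qed (auto simp: carc_def)
    thus "g x = (if x \<in> {\<alpha>..\<beta>} then 1 else 0)" by (simp add: g_def)
  qed simp
  with lim show "(\<lambda>k. integral {0..1} (\<lambda>s. G k (cis (2 * pi * s)))) \<longlonglongrightarrow> \<beta> - \<alpha>"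
    by (simp add: integral_unique)
qed

text \<open>A closed arc and an upper bound suffice: lower bounds follow in \<open>weyl_arcs\<close>
  by counting the complement. Continuous majorants of the indicator are thus enough.\<close>

lemma arc_count_upper:
  fixes \<alpha> \<beta> \<eta> :: real
  assumes ab: "0 \<le> \<alpha>" "\<alpha> \<le> \<beta>" "\<beta> \<le> 1" and \<eta>: "\<eta> > 0"
  shows "\<exists>H::nat. \<exists>\<delta>>0. \<forall>(A::nat set) (u :: nat \<Rightarrow> real). finite A \<longrightarrow>
     (\<forall>h\<in>{1..H}. norm (\<Sum>n\<in>A. cis (2 * pi * real h * u n)) \<le> \<delta> * real (card A)) \<longrightarrow>
     real (card {n\<in>A. \<alpha> \<le> frac (u n) \<and> frac (u n) \<le> \<beta>}) \<le> (\<beta> - \<alpha> + \<eta>) * real (card A)"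
proof -
  define carc where "carc = (\<lambda>s. cis (2 * pi * s)) ` {\<alpha>..\<beta>}"
  define G where "G = (\<lambda>(k::nat) z. max 0 (1 - real k * infdist z carc))"
  note bump = bump_integral[OF ab carc_def G_def]
  have "eventually (\<lambda>k. integral {0..1} (\<lambda>s. G k (cis (2 * pi * s))) < \<beta> - \<alpha> + \<eta> / 4) sequentially"
    using order_tendstoD(2)[OF bump(1), of "\<beta> - \<alpha> + \<eta> / 4"] \<eta> by simp
  then obtain k where k: "integral {0..1} (\<lambda>s. G k (cis (2 * pi * s))) < \<beta> - \<alpha> + \<eta> / 4"
    by (auto simp: eventually_sequentially)
  \<comment> \<open>Each of four errors gets \<eta>/4: the bump against the arc, the polynomial
    against the bump in the integral, the average of the polynomial, and the bump against the
    polynomial in the sum.\<close>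
  have \<eta>4: "\<eta> / 4 > 0" using \<eta> by simp
  have Gc: "continuous_on (sphere 0 1) (G k)" by (rule continuous_on_subset[OF bump(3)]) simp
  obtain p where p: "real_polynomial_function p" "\<And>z. z \<in> sphere 0 1 \<Longrightarrow> \<bar>G k z - p z\<bar> < \<eta> / 4"
    using Stone_Weierstrass_real_polynomial_function[OF compact_sphere Gc \<eta>4] by blast
  have pG: "\<bar>G k (cis t) - p (cis t)\<bar> < \<eta> / 4" for t by (rule p(2)) simp
  let ?T = "\<lambda>s. complex_of_real (p (cis (2 * pi * s)))"
  obtain a where a: "(?T has_integral a) {0..1}" "weyl_avg ?T a"
    using trig_average[OF trig_real_polynomial[OF p(1)]] by blast
  have Rea: "((\<lambda>s. p (cis (2 * pi * s))) has_integral Re a) {0..1}"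
    using has_integral_linear[OF a(1) bounded_linear_Re] by (simp add: o_def)
  have "Re a \<le> \<beta> - \<alpha> + \<eta> / 2"
  proof -
    have i1: "((\<lambda>s. G k (cis (2 * pi * s)) + \<eta> / 4) has_integral integral {0..1} (\<lambda>s. G k (cis (2 * pi * s))) + \<eta> / 4) {0..1}"
      using has_integral_add[OF integrable_integral[OF bump(2)[of k]] has_integral_const_real[of "\<eta> / 4" 0 1]] by simp
    have "p (cis t) \<le> G k (cis t) + \<eta> / 4" for t using pG[of t] by linarith
    hence "Re a \<le> integral {0..1} (\<lambda>s. G k (cis (2 * pi * s))) + \<eta> / 4"
      by (intro has_integral_le[OF Rea i1])
    thus ?thesis using k by simp
  qed
  obtain H \<delta> where H: "\<delta> > 0" "\<And>(A::nat set) u. finite A \<Longrightarrow>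
     (\<And>h. h \<in> {1..H} \<Longrightarrow> norm (\<Sum>n\<in>A. cis (2 * pi * real h * u n)) \<le> \<delta> * real (card A)) \<Longrightarrow>
     norm ((\<Sum>n\<in>A. ?T (u n)) - of_nat (card A) * a) \<le> \<eta> / 4 * real (card A)"
    using weyl_avgD[OF a(2) \<eta>4] by metis
  show ?thesis
  proof (intro exI[of _ H] exI[of _ \<delta>] conjI allI impI H(1))
    fix A :: "nat set" and u :: "nat \<Rightarrow> real"
    assume fin: "finite A" and hyp: "\<forall>h\<in>{1..H}. norm (\<Sum>n\<in>A. cis (2 * pi * real h * u n)) \<le> \<delta> * real (card A)"
    let ?B = "{n\<in>A. \<alpha> \<le> frac (u n) \<and> frac (u n) \<le> \<beta>}"
    have "norm ((\<Sum>n\<in>A. ?T (u n)) - of_nat (card A) * a) \<le> \<eta> / 4 * real (card A)"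
      using H(2)[OF fin] hyp by blast
    hence "\<bar>Re ((\<Sum>n\<in>A. ?T (u n)) - of_nat (card A) * a)\<bar> \<le> \<eta> / 4 * real (card A)"
      using abs_Re_le_cmod order_trans by blast
    hence "Re ((\<Sum>n\<in>A. ?T (u n)) - of_nat (card A) * a) \<le> \<eta> / 4 * real (card A)"
      by (rule abs_le_D1)
    hence avg: "(\<Sum>n\<in>A. p (cis (2 * pi * u n))) \<le> real (card A) * Re a + \<eta> / 4 * real (card A)"
      by simp
    have G0: "G k z \<ge> 0" for z by (simp add: G_def)
    have "real (card ?B) = (\<Sum>n\<in>?B. 1)" by simp
    also have "\<dots> \<le> (\<Sum>n\<in>?B. G k (cis (2 * pi * u n)))"
    proof (rule sum_mono)
      fix n assume "n \<in> ?B"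
      hence "cis (2 * pi * u n) \<in> carc" unfolding carc_def by (subst cis_2pi_frac) auto
      thus "1 \<le> G k (cis (2 * pi * u n))" by (simp add: G_def)
    qed
    also have "\<dots> \<le> (\<Sum>n\<in>A. G k (cis (2 * pi * u n)))"
      by (rule sum_mono2) (use fin G0 in auto)
    also have "\<dots> \<le> (\<Sum>n\<in>A. p (cis (2 * pi * u n)) + \<eta> / 4)"
    proof (rule sum_mono)
      fix n show "G k (cis (2 * pi * u n)) \<le> p (cis (2 * pi * u n)) + \<eta> / 4"
        using pG[of "2 * pi * u n"] by linarith
    qed
    also have "\<dots> = (\<Sum>n\<in>A. p (cis (2 * pi * u n))) + \<eta> / 4 * real (card A)"
      by (simp add: sum.distrib)
    also have "\<dots> \<le> (Re a + \<eta> / 2) * real (card A)" using avg by (simp add: algebra_simps)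
    also have "\<dots> \<le> (\<beta> - \<alpha> + \<eta>) * real (card A)"
      using \<open>Re a \<le> \<beta> - \<alpha> + \<eta> / 2\<close> by (intro mult_right_mono) auto
    finally show "real (card ?B) \<le> (\<beta> - \<alpha> + \<eta>) * real (card A)" .
  qed
qed

text \<open>The q arcs partition the circle, and each count exceeds its share by at most the
  fraction \<eta> / q. The counts add up to \<open>card A\<close>, so none can fall short by more
  than the excesses of the others.\<close>

lemma weyl_arcs:
  fixes q :: nat and \<eta> :: real
  assumes q: "q \<ge> 1" and \<eta>: "\<eta> > 0"
  shows "\<exists>H::nat. \<exists>\<delta>>0. \<forall>(A::nat set) (u :: nat \<Rightarrow> real) v. finite A \<longrightarrow>
     (\<forall>h\<in>{1..H}. norm (\<Sum>n\<in>A. cis (2 * pi * real h * u n)) \<le> \<delta> * real (card A)) \<longrightarrow> v < q \<longrightarrow>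
     \<bar>real (card {n\<in>A. nat \<lfloor>real q * frac (u n)\<rfloor> = v}) - real (card A) / real q\<bar> \<le> \<eta> * real (card A)"
proof -
  have "\<forall>v\<in>{..<q}. \<exists>H::nat. \<exists>\<delta>>0. \<forall>(A::nat set) (u :: nat \<Rightarrow> real). finite A \<longrightarrow>
     (\<forall>h\<in>{1..H}. norm (\<Sum>n\<in>A. cis (2 * pi * real h * u n)) \<le> \<delta> * real (card A)) \<longrightarrow>
     real (card {n\<in>A. real v / real q \<le> frac (u n) \<and> frac (u n) \<le> real (Suc v) / real q})
       \<le> (real (Suc v) / real q - real v / real q + \<eta> / real q) * real (card A)"
    (is "\<forall>v\<in>{..<q}. ?P v")
  proof
    fix v assume "v \<in> {..<q}"
    hence v: "v < q" by simp
    show "?P v"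
      by (rule arc_count_upper) (use v \<eta> q in \<open>auto simp: divide_right_mono\<close>)
  qed
  from bchoice[OF this] obtain Hf :: "nat \<Rightarrow> nat" where "\<forall>v\<in>{..<q}. \<exists>\<delta>>0. \<forall>(A::nat set) (u :: nat \<Rightarrow> real). finite A \<longrightarrow>
     (\<forall>h\<in>{1..Hf v}. norm (\<Sum>n\<in>A. cis (2 * pi * real h * u n)) \<le> \<delta> * real (card A)) \<longrightarrow>
     real (card {n\<in>A. real v / real q \<le> frac (u n) \<and> frac (u n) \<le> real (Suc v) / real q})
       \<le> (real (Suc v) / real q - real v / real q + \<eta> / real q) * real (card A)"
    ..
  from bchoice[OF this] obtain df :: "nat \<Rightarrow> real" where F: "\<forall>v\<in>{..<q}. df v > 0 \<and> (\<forall>(A::nat set) (u :: nat \<Rightarrow> real). finite A \<longrightarrow>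
     (\<forall>h\<in>{1..Hf v}. norm (\<Sum>n\<in>A. cis (2 * pi * real h * u n)) \<le> df v * real (card A)) \<longrightarrow>
     real (card {n\<in>A. real v / real q \<le> frac (u n) \<and> frac (u n) \<le> real (Suc v) / real q})
       \<le> (real (Suc v) / real q - real v / real q + \<eta> / real q) * real (card A))"
    ..
  define H where "H = Max (Hf ` {..<q})"
  define \<delta> where "\<delta> = Min (df ` {..<q})"
  have q0: "0 \<in> {..<q}" using q by simp
  have "\<delta> > 0" unfolding \<delta>_def using F q0 by (subst Min_gr_iff) auto
  moreover have "\<bar>real (card {n\<in>A. nat \<lfloor>real q * frac (u n)\<rfloor> = v}) - real (card A) / real q\<bar> \<le> \<eta> * real (card A)"
    if fin: "finite A" and hyp: "\<And>h. h \<in> {1..H} \<Longrightarrow> norm (\<Sum>n\<in>A. cis (2 * pi * real h * u n)) \<le> \<delta> * real (card A)"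
      and v: "v < q" for A :: "nat set" and u :: "nat \<Rightarrow> real" and v
  proof -
    let ?c = "real (card A)"
    let ?S = "\<lambda>v. {n\<in>A. nat \<lfloor>real q * frac (u n)\<rfloor> = v}"
    have up: "real (card (?S w)) \<le> (1 + \<eta>) / real q * ?c" if w: "w < q" for w
    proof -
      have "Hf w \<le> H" unfolding H_def using w by (intro Max_ge) auto
      moreover have "\<delta> \<le> df w" unfolding \<delta>_def using w by (intro Min_le) auto
      hence "\<delta> * ?c \<le> df w * ?c" by (intro mult_right_mono) auto
      ultimately have "\<forall>h\<in>{1..Hf w}. norm (\<Sum>n\<in>A. cis (2 * pi * real h * u n)) \<le> df w * ?c"
        using hyp by (meson atLeastAtMost_iff order_trans)
      hence le: "real (card {n\<in>A. real w / real q \<le> frac (u n) \<and> frac (u n) \<le> real (Suc w) / real q})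
       \<le> (real (Suc w) / real q - real w / real q + \<eta> / real q) * ?c"
        using F w fin by blast
      have "?S w \<subseteq> {n\<in>A. real w / real q \<le> frac (u n) \<and> frac (u n) \<le> real (Suc w) / real q}"
      proof
        fix n assume n: "n \<in> ?S w"
        have nn: "0 \<le> real q * frac (u n)" by (simp add: frac_ge_0)
        have "real w \<le> real q * frac (u n)" "real q * frac (u n) < real w + 1"
          using n nn by auto
        thus "n \<in> {n\<in>A. real w / real q \<le> frac (u n) \<and> frac (u n) \<le> real (Suc w) / real q}"
          using n q by (auto simp: field_simps)
      qed
      hence "real (card (?S w)) \<le> real (card {n\<in>A. real w / real q \<le> frac (u n) \<and> frac (u n) \<le> real (Suc w) / real q})"
        using fin by (intro of_nat_mono card_mono) auto
      also note le
      also have "real (Suc w) / real q - real w / real q + \<eta> / real q = (1 + \<eta>) / real q"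
        using q by (simp add: field_simps)
      finally show ?thesis .
    qed
    have tot: "(\<Sum>w<q. real (card (?S w))) = ?c"
    proof -
      have "A = (\<Union>w\<in>{..<q}. ?S w)"
      proof -
        have "nat \<lfloor>real q * frac (u n)\<rfloor> < q" for n
        proof -
          have "real q * frac (u n) < real q * 1" using q frac_lt_1[of "u n"] by (intro mult_strict_left_mono) auto
          hence "\<lfloor>real q * frac (u n)\<rfloor> < int q" by (simp add: floor_less_iff)
          thus ?thesis using q by (simp add: nat_less_iff)
        qed
        thus ?thesis by auto
      qed
      hence "card A = card (\<Union>w\<in>{..<q}. ?S w)" by simp
      also have "\<dots> = (\<Sum>w<q. card (?S w))"
        using fin by (intro card_UN_disjoint) auto
      finally show ?thesis by simp
    qed
    have "(\<Sum>w<q. real (card (?S w))) = real (card (?S v)) + (\<Sum>w\<in>{..<q}-{v}. real (card (?S w)))"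
      using v by (intro sum.remove) auto
    also have "(\<Sum>w\<in>{..<q}-{v}. real (card (?S w))) \<le> (\<Sum>w\<in>{..<q}-{v}. (1 + \<eta>) / real q * ?c)"
      by (intro sum_mono up) auto
    also have "\<dots> = (real q - 1) * ((1 + \<eta>) / real q * ?c)"
      using v by (simp add: card_Diff_singleton of_nat_diff)
    also have "\<dots> = (1 + \<eta>) * ?c - (1 + \<eta>) / real q * ?c" using q by (simp add: field_simps)
    finally have "(1 + \<eta>) / real q * ?c - \<eta> * ?c \<le> real (card (?S v))"
      unfolding tot by (simp add: algebra_simps)
    moreover have "(1 + \<eta>) / real q * ?c = ?c / real q + \<eta> / real q * ?c" by (simp add: add_divide_distrib algebra_simps)
    moreover have "0 \<le> \<eta> / real q * ?c" using \<eta> by simp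
    moreover have "\<eta> / real q * ?c \<le> \<eta> * ?c" using \<eta> q by (intro mult_right_mono) (auto simp: field_simps)
    ultimately show ?thesis using up[OF v] by linarith
  qed
  ultimately show ?thesis by (intro exI[of _ H] exI[of _ \<delta>] conjI allI impI) auto
qed

section \<open>Digits\<close>

lemma sum_digits_geometric:
  fixes b :: nat
  assumes "b \<ge> 2"
  shows "(\<lambda>i. real (b - 1) / real b ^ Suc i) sums 1"
proof -
  have "(\<lambda>i. (real b - 1) / real b * (1 / real b) ^ i) sums ((real b - 1) / real b * (1 / (1 - 1 / real b)))"
    by (intro sums_mult geometric_sums) (use assms in auto)
  also have "(real b - 1) / real b * (1 / (1 - 1 / real b)) = 1"
    using assms by (simp add: field_simps)
  also have "(\<lambda>i. (real b - 1) / real b * (1 / real b) ^ i) = (\<lambda>i. real (b - 1) / real b ^ Suc i)"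
    using assms by (auto simp: fun_eq_iff power_divide of_nat_diff)
  finally show ?thesis .
qed

text \<open>The tails \<open>r m\<close> satisfy b * r m = d m + r (m + 1). They stay strictly below
  1 because some later digit differs from b - 1; a tail equal to 1 would carry into the digit before
  it.\<close>

lemma digit_of_expansion:
  fixes d :: "nat \<Rightarrow> nat"
  assumes b: "b \<ge> 2" and d: "\<And>i. d i < b" and inf: "\<And>n. \<exists>i\<ge>n. d i \<noteq> b - 1"
  shows "digit b (\<Sum>i. real (d i) / real b ^ Suc i) (Suc n) = d n"
proof -
  let ?t = "\<lambda>m i. real (d (m + i)) / real b ^ Suc i"
  have le: "?t m i \<le> real (b - 1) / real b ^ Suc i" for m i
    using d[of "m + i"] by (intro divide_right_mono) auto
  have geo: "summable (\<lambda>i. real (b - 1) / real b ^ Suc i)" "(\<Sum>i. real (b - 1) / real b ^ Suc i) = 1"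
    using sum_digits_geometric[OF b] by (auto simp: sums_iff)
  have sm: "summable (?t m)" for m
    by (rule summable_comparison_test'[OF geo(1), of 0]) (use le in auto)
  define r where "r = (\<lambda>m. \<Sum>i. ?t m i)"
  have r0: "r m \<ge> 0" for m unfolding r_def by (intro suminf_nonneg sm) auto
  have r1: "r m < 1" for m
  proof -
    obtain i where i: "i \<ge> m" "d i \<noteq> b - 1" using inf by blast
    define e where "e = i - m"
    have e: "d (m + e) \<noteq> b - 1" using i by (simp add: e_def)
    hence "d (m + e) < b - 1" using d[of "m + e"] by linarith
    hence "0 < real (b - 1) / real b ^ Suc e - ?t m e"
      using b by (simp add: divide_strict_right_mono)
    hence "0 < (\<Sum>i. real (b - 1) / real b ^ Suc i - ?t m i)"
      using le by (intro suminf_pos2[where i = e] summable_diff geo sm) auto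
    also have "\<dots> = 1 - r m" unfolding r_def using suminf_diff[OF geo(1) sm[of m]] geo(2) by simp
    finally show ?thesis by simp
  qed
  have step: "real b * r m = real (d m) + r (Suc m)" for m
  proof -
    have "r m = ?t m 0 + (\<Sum>i. ?t m (Suc i))" unfolding r_def using suminf_split_head[OF sm[of m]] by linarith
    also have "(\<Sum>i. ?t m (Suc i)) = (\<Sum>i. ?t (Suc m) i / real b)"
      by (simp add: mult.commute)
    also have "\<dots> = r (Suc m) / real b" unfolding r_def by (rule suminf_divide[OF sm])
    finally show ?thesis using b by (simp add: field_simps)
  qed
  \<comment> \<open>Modulo b only the last digit and the tail survive; \<open>A\<close> collects the
    earlier digits. For m = 0 there is no last digit yet.\<close>
  have "\<exists>A::nat. real b ^ m * r 0 = real b * real A + (if m = 0 then 0 else real (d (m - 1))) + r m" for m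
  proof (induction m)
    case 0 show ?case by (rule exI[of _ 0]) simp
  next
    case (Suc m)
    then obtain A :: nat where A: "real b ^ m * r 0 = real b * real A + (if m = 0 then 0 else real (d (m - 1))) + r m" by blast
    have "real b ^ Suc m * r 0 = real b * (real b ^ m * r 0)" by simp
    also have "\<dots> = real b * real (b * A + (if m = 0 then 0 else d (m - 1))) + real b * r m"
      unfolding A by (auto simp: algebra_simps)
    also have "real b * r m = real (d m) + r (Suc m)" by (rule step)
    finally show ?case by (intro exI[of _ "b * A + (if m = 0 then 0 else d (m - 1))"]) simp
  qed
  from this[of "Suc n"] obtain A :: nat where A: "real b ^ Suc n * r 0 = real (b * A + d n) + r (Suc n)" by auto
  have fr: "frac (r 0) = r 0" using r0[of 0] r1[of 0] by (simp add: frac_eq)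
  have "\<lfloor>real b ^ Suc n * frac (r 0)\<rfloor> = int (b * A + d n)"
    unfolding fr A using r0[of "Suc n"] r1[of "Suc n"] by linarith
  hence "digit b (r 0) (Suc n) = d n"
    using d[of n] by (simp only: digit_def nat_int) simp
  thus ?thesis by (simp add: r_def)
qed

lemma digit_sum_less:
  fixes b :: nat
  assumes "\<And>i. i < k \<Longrightarrow> d i < b"
  shows "(\<Sum>i<k. d i * b ^ i) < b ^ k"
  using assms
proof (induction k)
  case (Suc k)
  have "(\<Sum>i<Suc k. d i * b ^ i) < b ^ k + d k * b ^ k" using Suc by simp
  also have "\<dots> = (d k + 1) * b ^ k" by simp
  also have "\<dots> \<le> b * b ^ k" using Suc.prems[of k] by (intro mult_right_mono) auto
  finally show ?case by simp
qed simp

lemma mod_power_eq_sum_iff: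
  fixes m b :: nat
  assumes "\<And>i. i < k \<Longrightarrow> d i < b"
  shows "m mod b ^ k = (\<Sum>i<k. d i * b ^ i) \<longleftrightarrow> (\<forall>i<k. m div b ^ i mod b = d i)"
  using assms
proof (induction k)
  case (Suc k)
  let ?S = "\<Sum>i<k. d i * b ^ i"
  have b: "b > 0" using Suc.prems[of k] by simp
  have S: "?S < b ^ k" by (rule digit_sum_less) (use Suc.prems in simp)
  have "m mod b ^ Suc k = (m div b ^ k mod b) * b ^ k + m mod b ^ k"
    using mod_mult2_eq[of m "b ^ k" b] by (simp add: mult.commute)
  also have "\<dots> = (\<Sum>i<Suc k. d i * b ^ i) \<longleftrightarrow> m div b ^ k mod b = d k \<and> m mod b ^ k = ?S"
  proof
    assume eq: "(m div b ^ k mod b) * b ^ k + m mod b ^ k = (\<Sum>i<Suc k. d i * b ^ i)"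
    have lt: "m mod b ^ k < b ^ k" using b by simp
    have "((m div b ^ k mod b) * b ^ k + m mod b ^ k) div b ^ k = (d k * b ^ k + ?S) div b ^ k"
      using eq by (simp add: add.commute)
    hence "m div b ^ k mod b = d k" using lt S b by simp
    thus "m div b ^ k mod b = d k \<and> m mod b ^ k = ?S" using eq by simp
  qed simp
  finally show ?case using Suc by (auto simp: less_Suc_eq)
qed simp

text \<open>The k digits above the lowest j depend only on the position of z modulo b^(j + k). This
  power is the modulus \<open>M\<close> for which equidistribution is required.\<close>

lemma digits_eq_frac:
  fixes z :: real and b :: nat
  assumes "z \<ge> 0" "b \<ge> 1"
  shows "nat \<lfloor>real (b ^ k) * frac (z / real b ^ (j + k))\<rfloor> = nat \<lfloor>z\<rfloor> div b ^ j mod b ^ k"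
proof -
  define x where "x = z / real b ^ j"
  define q where "q = b ^ k"
  have q: "q > 0" using assms by (simp add: q_def)
  have fx: "\<lfloor>x\<rfloor> = \<lfloor>z\<rfloor> div int (b ^ j)"
    unfolding x_def using floor_divide_real_eq_div[of "int (b ^ j)" z] by simp
  have fq: "\<lfloor>x / real q\<rfloor> = \<lfloor>x\<rfloor> div int q"
    using floor_divide_real_eq_div[of "int q" x] by simp
  have "z / real b ^ (j + k) = x / real q" by (simp add: x_def q_def power_add)
  hence "real (b ^ k) * frac (z / real b ^ (j + k)) = real q * (x / real q - of_int (\<lfloor>x\<rfloor> div int q))"
    by (simp only: frac_def fq q_def[symmetric])
  also have "\<dots> = x - of_int (int q * (\<lfloor>x\<rfloor> div int q))" using q by (simp add: right_diff_distrib)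
  finally have "\<lfloor>real (b ^ k) * frac (z / real b ^ (j + k))\<rfloor> = \<lfloor>x - of_int (int q * (\<lfloor>x\<rfloor> div int q))\<rfloor>"
    by (simp only:)
  also have "\<dots> = \<lfloor>x\<rfloor> - int q * (\<lfloor>x\<rfloor> div int q)" by (simp only: floor_diff_of_int)
  also have "\<dots> = \<lfloor>x\<rfloor> mod int q" by (simp add: minus_mult_div_eq_mod)
  also have "\<lfloor>z\<rfloor> = int (nat \<lfloor>z\<rfloor>)" using assms by simp
  hence "\<lfloor>x\<rfloor> mod int q = int (nat \<lfloor>z\<rfloor> div b ^ j mod q)"
    unfolding fx by (metis zdiv_int zmod_int)
  finally show ?thesis by (simp add: q_def)
qed

section \<open>Positions of a string in the concatenation\<close>

definition tot_len :: "nat \<Rightarrow> real \<Rightarrow> nat \<Rightarrow> nat" where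
  "tot_len b y N = (\<Sum>n=1..N. K_len b y (real n))"

definition int_part :: "(nat \<Rightarrow> real) \<Rightarrow> nat \<Rightarrow> nat" where
  "int_part f n = nat \<lfloor>f n\<rfloor>"

definition string_value :: "nat \<Rightarrow> nat list \<Rightarrow> nat" where
  "string_value b a = (\<Sum>i<length a. a ! (length a - 1 - i) * b ^ i)"

text \<open>Stated for \<open>theta_digit\<close>, since the digits of the real number are known to
  agree with these only after a tail of b - 1 has been excluded.\<close>

definition occurs_at :: "nat \<Rightarrow> (nat \<Rightarrow> real) \<Rightarrow> real \<Rightarrow> nat list \<Rightarrow> nat \<Rightarrow> bool" where
  "occurs_at b f y a i \<longleftrightarrow> (\<forall>s\<in>{1..length a}. theta_digit b f y (i - 1 + s) = a ! (s - 1))"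

definition occ_count :: "nat \<Rightarrow> (nat \<Rightarrow> real) \<Rightarrow> real \<Rightarrow> nat list \<Rightarrow> nat \<Rightarrow> nat" where
  "occ_count b f y a X = card {i\<in>{1..X}. occurs_at b f y a i}"

text \<open>Here \<open>j\<close> is the number of digits to the right of the string inside f n.
  Nothing restricts the string to the digits that are kept.\<close>

definition hit :: "nat \<Rightarrow> (nat \<Rightarrow> real) \<Rightarrow> nat list \<Rightarrow> nat \<Rightarrow> nat \<Rightarrow> bool" where
  "hit b f a n j \<longleftrightarrow> int_part f n div b ^ j mod b ^ length a = string_value b a"

text \<open>An idealised count: every n \<le> N is treated as if its block had the length belonging
  to N, and strings reaching beyond the block are included.\<close>

definition hit_count :: "nat \<Rightarrow> (nat \<Rightarrow> real) \<Rightarrow> real \<Rightarrow> nat list \<Rightarrow> nat \<Rightarrow> nat" where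
  "hit_count b f y a N = (\<Sum>j<K_len b y (real N). card {n\<in>{1..N}. hit b f a n j})"

lemma tot_len_Suc: "tot_len b y (Suc N) = tot_len b y N + K_len b y (real (Suc N))"
  by (simp add: tot_len_def)

lemma length_concat_blocks:
  "length (concat (map (trunc_string b f y) [1..<Suc N])) = tot_len b y N"
proof (induction N)
  case (Suc N)
  have "[1..<Suc (Suc N)] = [1..<Suc N] @ [Suc N]" by simp
  hence "length (concat (map (trunc_string b f y) [1..<Suc (Suc N)])) =
     length (concat (map (trunc_string b f y) [1..<Suc N])) + length (trunc_string b f y (Suc N))"
    by (simp only: map_append concat_append length_append) simp
  also have "\<dots> = tot_len b y N + K_len b y (real (Suc N))"
    unfolding Suc.IH by (simp add: trunc_string_def)
  finally show ?case by (simp only: tot_len_Suc)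
qed (simp add: tot_len_def)

lemma theta_digit_in_block:
  assumes b: "b \<ge> 2" "y > 0" and t: "t < K_len b y (real (Suc n))"
  shows "theta_digit b f y (Suc (tot_len b y n + t)) =
     int_part f (Suc n) div b ^ (K_len b y (real (Suc n)) - 1 - t) mod b"
proof -
  let ?s = "trunc_string b f y" and ?K = "K_len b y (real (Suc n))"
  define i where "i = Suc (tot_len b y n + t)"
  \<comment> \<open>Large enough both for \<open>theta_digit_eq\<close> at position \<open>i\<close>
    and for the block of \<open>Suc n\<close> to be present.\<close>
  define M where "M = max i (Suc n)"
  have "theta_digit b f y i = concat (map ?s [1..<M + 1]) ! (i - 1)"
    by (rule theta_digit_eq[OF b]) (auto simp: i_def M_def)
  also have "[1..<M + 1] = [1..<Suc n] @ Suc n # [Suc (Suc n)..<M + 1]"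
  proof -
    have "[1..<M + 1] = [1..<Suc n] @ [Suc n..<M + 1]"
      using upt_add_eq_append[of 1 "Suc n" "M - n"] by (simp add: M_def)
    also have "[Suc n..<M + 1] = Suc n # [Suc (Suc n)..<M + 1]"
      by (rule upt_conv_Cons) (simp add: M_def)
    finally show ?thesis .
  qed
  also have "concat (map ?s ([1..<Suc n] @ Suc n # [Suc (Suc n)..<M + 1])) ! (i - 1) = ?s (Suc n) ! t"
    using t length_concat_blocks[of b f y n]
    by (simp add: i_def nth_append trunc_string_def del: upt_Suc)
  also have "\<dots> = int_part f (Suc n) div b ^ (?K - 1 - t) mod b"
    using t by (simp add: trunc_string_def T_base_def rev_nth int_part_def)
  finally show ?thesis by (simp only: i_def)
qed

lemma occurs_at_in_block:
  assumes b: "b \<ge> 2" "y > 0" and a: "set a \<subseteq> {..<b}" and t: "t + length a \<le> K_len b y (real (Suc n))"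
  shows "occurs_at b f y a (Suc (tot_len b y n + t)) \<longleftrightarrow> hit b f a (Suc n) (K_len b y (real (Suc n)) - length a - t)"
proof -
  let ?K = "K_len b y (real (Suc n))" and ?k = "length a" and ?F = "int_part f (Suc n)"
  define j where "j = ?K - ?k - t"
  have lt: "a ! (?k - 1 - i) < b" if "i < ?k" for i
  proof -
    have "a ! (?k - 1 - i) \<in> set a" using that by (intro nth_mem) auto
    thus ?thesis using a by auto
  qed
  have "hit b f a (Suc n) j \<longleftrightarrow> (\<forall>i<?k. ?F div b ^ j div b ^ i mod b = a ! (?k - 1 - i))"
    unfolding hit_def string_value_def by (rule mod_power_eq_sum_iff) (rule lt)
  also have "\<dots> \<longleftrightarrow> (\<forall>i<?k. ?F div b ^ (j + i) mod b = a ! (?k - 1 - i))"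
    by (simp add: div_mult2_eq power_add)
  also have "\<dots> \<longleftrightarrow> (\<forall>s\<in>{1..?k}. ?F div b ^ (?K - t - s) mod b = a ! (s - 1))"
  proof
    assume H: "\<forall>i<?k. ?F div b ^ (j + i) mod b = a ! (?k - 1 - i)"
    show "\<forall>s\<in>{1..?k}. ?F div b ^ (?K - t - s) mod b = a ! (s - 1)"
    proof
      fix s assume s: "s \<in> {1..?k}"
      have "j + (?k - s) = ?K - t - s" "?k - 1 - (?k - s) = s - 1" using s t by (auto simp: j_def)
      with H[rule_format, of "?k - s"] s show "?F div b ^ (?K - t - s) mod b = a ! (s - 1)" by auto
    qed
  next
    assume H: "\<forall>s\<in>{1..?k}. ?F div b ^ (?K - t - s) mod b = a ! (s - 1)"
    show "\<forall>i<?k. ?F div b ^ (j + i) mod b = a ! (?k - 1 - i)"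
    proof (intro allI impI)
      fix i assume i: "i < ?k"
      have "?K - t - (?k - i) = j + i" "(?k - i) - 1 = ?k - 1 - i" "?k - i \<in> {1..?k}" using i t by (auto simp: j_def)
      with H show "?F div b ^ (j + i) mod b = a ! (?k - 1 - i)" by metis
    qed
  qed
  also have "\<dots> \<longleftrightarrow> occurs_at b f y a (Suc (tot_len b y n + t))"
    unfolding occurs_at_def
  proof (rule ball_cong)
    fix s assume s: "s \<in> {1..?k}"
    have e: "Suc (tot_len b y n + t) - 1 + s = Suc (tot_len b y n + (t + s - 1))" using s by auto
    have "t + s - 1 < ?K" "?K - 1 - (t + s - 1) = ?K - t - s" using s t by auto
    with theta_digit_in_block[OF b, of "t + s - 1" n f]
    show "(?F div b ^ (?K - t - s) mod b = a ! (s - 1)) =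
      (theta_digit b f y (Suc (tot_len b y n + t) - 1 + s) = a ! (s - 1))" unfolding e by simp
  qed simp
  finally show ?thesis by (simp add: j_def)
qed

text \<open>Starting positions t are counted from the left of the block and \<open>hit\<close>
  positions from the right, hence the reflection t to K - length a - t. Occurrences that run into
  the next block start among the last \<open>length a\<close> positions.\<close>

lemma card_block_occurrences:
  fixes f :: "nat \<Rightarrow> real" and n :: nat
  assumes b: "b \<ge> 2" "y > 0" and a: "set a \<subseteq> {..<b}" "a \<noteq> []"
  defines "K \<equiv> K_len b y (real (Suc n))"
  defines "w \<equiv> card {j. j + length a \<le> K \<and> hit b f a (Suc n) j}"
  shows "w \<le> card {t. t < K \<and> occurs_at b f y a (Suc (tot_len b y n + t))}"
    and "card {t. t < K \<and> occurs_at b f y a (Suc (tot_len b y n + t))} \<le> w + length a"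
proof -
  let ?k = "length a"
  let ?A = "{t. t + ?k \<le> K \<and> occurs_at b f y a (Suc (tot_len b y n + t))}"
  let ?B = "{t. t < K \<and> occurs_at b f y a (Suc (tot_len b y n + t))}"
  let ?W = "{j. j + ?k \<le> K \<and> hit b f a (Suc n) j}"
  have finB: "finite ?B" by simp
  have "bij_betw (\<lambda>t. K - ?k - t) ?A ?W"
  proof (rule bij_betwI[where g = "\<lambda>t. K - ?k - t"])
    show "(\<lambda>t. K - ?k - t) \<in> ?A \<rightarrow> ?W"
      using occurs_at_in_block[OF b a(1), of _ n f] by (auto simp: K_def)
    show "(\<lambda>t. K - ?k - t) \<in> ?W \<rightarrow> ?A"
    proof
      fix j assume j: "j \<in> ?W"
      have "K - ?k - (K - ?k - j) = j" "K - ?k - j + ?k \<le> K" using j by auto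
      with occurs_at_in_block[OF b a(1), of "K - ?k - j" n f] j show "K - ?k - j \<in> ?A" by (simp add: K_def)
    qed
  qed auto
  hence w: "w = card ?A" unfolding w_def by (rule bij_betw_same_card[symmetric])
  show "card ?B \<le> w + ?k"
  proof -
    have "?B \<subseteq> ?A \<union> {t. K - ?k \<le> t \<and> t < K}" by auto
    hence "card ?B \<le> card (?A \<union> {t. K - ?k \<le> t \<and> t < K})"
      by (intro card_mono) (auto intro: finite_subset[of _ "{..K}"])
    also have "\<dots> \<le> card ?A + card {t. K - ?k \<le> t \<and> t < K}" by (rule card_Un_le)
    also have "{t. K - ?k \<le> t \<and> t < K} = {K - ?k..<K}" by auto
    finally show ?thesis using w by simp
  qed
  have "?k \<ge> 1" using a(2) by (cases a) auto
  hence "?A \<subseteq> ?B" by auto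
  thus "w \<le> card ?B" unfolding w by (intro card_mono finB)
qed

lemma K_len_mono:
  assumes "b \<ge> 2" "y > 0" "x \<le> x'"
  shows "K_len b y x \<le> K_len b y x'"
proof (cases "x > exp (exp 1)")
  case True
  have 1: "exp 1 < ln x" using True by (metis exp_gt_zero ln_exp ln_less_cancel_iff order_less_trans)
  have 2: "1 < ln (ln x)" using 1 by (metis exp_gt_zero ln_exp ln_less_cancel_iff order_less_trans)
  have x: "0 < x" using True exp_gt_zero[of "exp 1 :: real"] by linarith
  have l1: "ln x \<le> ln x'" using x assms(3) by (intro ln_mono) auto
  have l2: "ln (ln x) \<le> ln (ln x')" by (rule ln_mono) (use 1 l1 exp_gt_zero[of "1::real"] in linarith)+
  have l3: "ln (ln (ln x)) \<le> ln (ln (ln x'))" by (rule ln_mono) (use 2 l2 in linarith)+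
  have "y * (ln (ln (ln x)) / ln (real b)) \<le> y * (ln (ln (ln x')) / ln (real b))"
    using assms l3 by (intro mult_left_mono divide_right_mono) auto
  hence "nat \<lceil>y * (ln (ln (ln x)) / ln (real b))\<rceil> \<le> nat \<lceil>y * (ln (ln (ln x')) / ln (real b))\<rceil>"
    by (intro nat_mono ceiling_mono)
  moreover have "x' > exp (exp 1)" using True assms(3) by linarith
  ultimately show ?thesis using True by (simp only: K_len_def if_True)
next
  case False
  hence "K_len b y x = 1" by (simp add: K_len_def)
  thus ?thesis using K_len_pos[OF assms(1,2), of x'] by simp
qed

lemma occ_count_tot_len:
  fixes f :: "nat \<Rightarrow> real"
  assumes b: "b \<ge> 2" "y > 0" and a: "set a \<subseteq> {..<b}" "a \<noteq> []"
  defines "K \<equiv> \<lambda>n. K_len b y (real n)"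
  defines "W \<equiv> \<lambda>N. \<Sum>n=1..N. card {j. j + length a \<le> K n \<and> hit b f a n j}"
  shows "W N \<le> occ_count b f y a (tot_len b y N)"
    and "occ_count b f y a (tot_len b y N) \<le> W N + length a * N"
proof -
  have step: "occ_count b f y a (tot_len b y (Suc N)) = occ_count b f y a (tot_len b y N) +
      card {t. t < K (Suc N) \<and> occurs_at b f y a (Suc (tot_len b y N + t))}" for N
  proof -
    let ?T = "tot_len b y N" and ?Q = "\<lambda>i. occurs_at b f y a i"
    have "{i\<in>{1..?T + K (Suc N)}. ?Q i} = {i\<in>{1..?T}. ?Q i} \<union> (\<lambda>t. Suc (?T + t)) ` {t. t < K (Suc N) \<and> ?Q (Suc (?T + t))}"
    proof (intro equalityI subsetI)
      fix i assume i: "i \<in> {i\<in>{1..?T + K (Suc N)}. ?Q i}"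
      show "i \<in> {i\<in>{1..?T}. ?Q i} \<union> (\<lambda>t. Suc (?T + t)) ` {t. t < K (Suc N) \<and> ?Q (Suc (?T + t))}"
      proof (cases "i \<le> ?T")
        case False
        hence "i = Suc (?T + (i - 1 - ?T))" "i - 1 - ?T < K (Suc N)" using i by auto
        thus ?thesis using i by (intro UnI2 image_eqI[of _ _ "i - 1 - ?T"]) auto
      qed (use i in auto)
    qed auto
    moreover have "{i\<in>{1..?T}. ?Q i} \<inter> (\<lambda>t. Suc (?T + t)) ` {t. t < K (Suc N) \<and> ?Q (Suc (?T + t))} = {}" by auto
    ultimately have "card {i\<in>{1..?T + K (Suc N)}. ?Q i} = card {i\<in>{1..?T}. ?Q i} +
        card ((\<lambda>t. Suc (?T + t)) ` {t. t < K (Suc N) \<and> ?Q (Suc (?T + t))})"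
      by (simp add: card_Un_disjoint)
    also have "card ((\<lambda>t. Suc (?T + t)) ` {t. t < K (Suc N) \<and> ?Q (Suc (?T + t))}) = card {t. t < K (Suc N) \<and> ?Q (Suc (?T + t))}"
      by (intro card_image) (auto simp: inj_on_def)
    finally show ?thesis by (simp add: occ_count_def tot_len_Suc K_def)
  qed
  have W: "W (Suc N) = W N + card {j. j + length a \<le> K (Suc N) \<and> hit b f a (Suc N) j}" for N
    by (simp add: W_def)
  have 0: "occ_count b f y a (tot_len b y 0) = 0" "W 0 = 0"
    by (auto simp: occ_count_def tot_len_def W_def)
  note cb = card_block_occurrences[OF b a, where f = f]
  show "W N \<le> occ_count b f y a (tot_len b y N)"
  proof (induction N)
    case (Suc N) thus ?case unfolding W step using cb(1)[of N] by (simp add: K_def)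
  qed (simp add: 0)
  show "occ_count b f y a (tot_len b y N) \<le> W N + length a * N"
  proof (induction N)
    case (Suc N) thus ?case unfolding W step using cb(2)[of N] by (simp add: K_def)
  qed (simp add: 0)
qed

text \<open>Extending all blocks to the length belonging to N costs the sum of the differences of
  lengths, which is N K - tot_len; the ends of the blocks cost at most \<open>length a\<close>
  each.\<close>

lemma occ_count_hit_count:
  assumes b: "b \<ge> 2" "y > 0" and a: "set a \<subseteq> {..<b}" "a \<noteq> []"
  shows "\<bar>real (occ_count b f y a (tot_len b y N)) - real (hit_count b f y a N)\<bar> \<le>
     (real N * real (K_len b y (real N)) - real (tot_len b y N)) + real (length a) * real N"
proof -
  define K where "K = (\<lambda>n. K_len b y (real n))"
  define W where "W = (\<lambda>N. \<Sum>n=1..N. card {j. j + length a \<le> K n \<and> hit b f a n j})"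
  let ?k = "length a"
  have C: "W N \<le> occ_count b f y a (tot_len b y N)" "occ_count b f y a (tot_len b y N) \<le> W N + ?k * N"
    using occ_count_tot_len[OF b a, where f = f and N = N] unfolding W_def K_def by auto
  have k: "?k \<ge> 1" using a by (cases a) auto
  have V: "hit_count b f y a N = (\<Sum>n=1..N. card {j. j < K N \<and> hit b f a n j})"
  proof -
    have "hit_count b f y a N = (\<Sum>j<K N. \<Sum>n=1..N. if hit b f a n j then 1 else 0)"
      unfolding hit_count_def K_def
      by (intro sum.cong refl) (simp only: sum.inter_filter[symmetric] finite_atLeastAtMost card_eq_sum)
    also have "\<dots> = (\<Sum>n=1..N. \<Sum>j<K N. if hit b f a n j then 1 else 0)" by (rule sum.swap)
    also have "\<dots> = (\<Sum>n=1..N. card {j\<in>{..<K N}. hit b f a n j})"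
      by (intro sum.cong refl) (simp only: sum.inter_filter[symmetric] finite_lessThan card_eq_sum)
    finally show ?thesis by (simp add: lessThan_def)
  qed
  have Kle: "K n \<le> K N" if "n \<le> N" for n
    unfolding K_def using that by (intro K_len_mono b) auto
  have WV: "W N \<le> hit_count b f y a N"
    unfolding V W_def
  proof (rule sum_mono)
    fix n assume "n \<in> {1..N}"
    hence "K n \<le> K N" by (intro Kle) auto
    thus "card {j. j + ?k \<le> K n \<and> hit b f a n j} \<le> card {j. j < K N \<and> hit b f a n j}"
      using k by (intro card_mono) auto
  qed
  have VW: "hit_count b f y a N \<le> W N + (\<Sum>n=1..N. (K N - K n) + ?k)"
    unfolding V W_def sum.distrib[symmetric]
  proof (rule sum_mono)
    fix n assume n: "n \<in> {1..N}"
    \<comment> \<open>A position with j + k > K n satisfies j \<ge> K n + 1 - k, so at most k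
      positions below K n are affected.\<close>
    have "{j. j < K N \<and> hit b f a n j} \<subseteq> {j. j + ?k \<le> K n \<and> hit b f a n j} \<union> {K n + 1 - ?k..<K N}"
      by auto
    hence "card {j. j < K N \<and> hit b f a n j} \<le> card ({j. j + ?k \<le> K n \<and> hit b f a n j} \<union> {K n + 1 - ?k..<K N})"
      by (intro card_mono) (auto intro: finite_subset[of _ "{..K n}"])
    also have "\<dots> \<le> card {j. j + ?k \<le> K n \<and> hit b f a n j} + card {K n + 1 - ?k..<K N}"
      by (rule card_Un_le)
    also have "card {K n + 1 - ?k..<K N} \<le> (K N - K n) + ?k"
      using Kle[of n] n k by auto
    finally show "card {j. j < K N \<and> hit b f a n j} \<le> card {j. j + ?k \<le> K n \<and> hit b f a n j} + ((K N - K n) + ?k)"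
      by simp
  qed
  have "real (\<Sum>n=1..N. (K N - K n) + ?k) = (\<Sum>n=1..N. real (K N) - real (K n) + real ?k)"
    unfolding of_nat_sum
  proof (rule sum.cong)
    fix n assume "n \<in> {1..N}"
    hence "K n \<le> K N" by (intro Kle) auto
    thus "real (K N - K n + ?k) = real (K N) - real (K n) + real ?k" by linarith
  qed simp
  also have "\<dots> = real N * real (K N) - real (tot_len b y N) + real ?k * real N"
    by (simp add: sum.distrib sum_subtractf tot_len_def K_def)
  finally have S: "real (\<Sum>n=1..N. (K N - K n) + ?k) = real N * real (K N) - real (tot_len b y N) + real ?k * real N" .
  have T: "real (tot_len b y N) \<le> real N * real (K N)"
  proof -
    have "tot_len b y N \<le> (\<Sum>n=1..N. K N)"
      unfolding tot_len_def K_def[symmetric] using Kle by (intro sum_mono) (auto simp: K_def)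
    hence "tot_len b y N \<le> N * K N" by simp
    hence "real (tot_len b y N) \<le> real (N * K N)" by (rule of_nat_mono)
    thus ?thesis by (simp only: of_nat_mult)
  qed
  have "real (occ_count b f y a (tot_len b y N)) \<le> real (hit_count b f y a N) + real ?k * real N"
    using C(2) WV by (simp only: of_nat_mult[symmetric] of_nat_add[symmetric] of_nat_le_iff)
  moreover have "real (hit_count b f y a N) \<le> real (occ_count b f y a (tot_len b y N)) + real (\<Sum>n=1..N. (K N - K n) + ?k)"
    using C(1) VW by (simp only: of_nat_add[symmetric] of_nat_le_iff)
  ultimately show ?thesis using S T unfolding K_def by linarith
qed

section \<open>Frequencies\<close>

lemma tot_len_mono: "M \<le> N \<Longrightarrow> tot_len b y M \<le> tot_len b y N"
  unfolding tot_len_def by (rule sum_mono2) auto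

lemma tot_len_ge:
  assumes "b \<ge> 2" "y > 0"
  shows "N \<le> tot_len b y N"
proof -
  have "(\<Sum>n=1..N. 1) \<le> tot_len b y N"
    unfolding tot_len_def by (rule sum_mono) (use K_len_pos[OF assms] in \<open>simp add: Suc_le_eq\<close>)
  thus ?thesis by simp
qed

lemma tot_len_le:
  assumes "b \<ge> 2" "y > 0"
  shows "real (tot_len b y N) \<le> real N * real (K_len b y (real N))"
proof -
  have "tot_len b y N \<le> (\<Sum>n=1..N. K_len b y (real N))"
    unfolding tot_len_def by (intro sum_mono K_len_mono assms) auto
  hence "tot_len b y N \<le> N * K_len b y (real N)" by simp
  hence "real (tot_len b y N) \<le> real (N * K_len b y (real N))" by (rule of_nat_mono)
  thus ?thesis by (simp only: of_nat_mult)
qed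

lemma K_len_bounds:
  assumes "b \<ge> 2" "y > 0"
  shows "eventually (\<lambda>N. y * (ln (ll N) / ln (real b)) \<le> real (K_len b y (real N)) \<and>
     real (K_len b y (real N)) \<le> y * (ln (ll N) / ln (real b)) + 1 \<and> 0 \<le> ln (ll N) / ln (real b)) sequentially"
proof -
  have "eventually (\<lambda>N. real N > exp (exp 1)) sequentially" by real_asymp
  thus ?thesis using eventually_ll_ge[of 1]
  proof eventually_elim
    case (elim N)
    have "ln (ll N) / ln (real b) \<ge> 0" using elim assms by simp
    moreover from this have "y * (ln (ll N) / ln (real b)) \<ge> 0" using assms by (intro mult_nonneg_nonneg) auto
    moreover have "K_len b y (real N) = nat \<lceil>y * (ln (ll N) / ln (real b))\<rceil>"
      using elim by (simp add: K_len_def ll_def)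
    ultimately show ?case by linarith
  qed
qed

text \<open>The triple logarithms of N and sqrt N differ by a vanishing amount, so for n \<ge> sqrt
  N the lengths differ by at most 2: one for the logarithms and one for the ceiling. The smaller n
  are too few to matter.\<close>

lemma tot_len_asymp:
  assumes b: "b \<ge> 2" "y > 0" and \<eta>: "\<eta> > 0"
  shows "eventually (\<lambda>N. real N * real (K_len b y (real N)) - real (tot_len b y N) \<le>
     \<eta> * (real N * real (K_len b y (real N)))) sequentially"
proof -
  define c where "c = y / ln (real b)"
  have c: "c > 0" using b by (simp add: c_def)
  have 1: "eventually (\<lambda>N. c * (ln (ln (ln (real N))) - ln (ln (ln (sqrt (real N))))) \<le> 1) sequentially"
    using c by real_asymp
  have 2: "eventually (\<lambda>N. real N > exp (exp 1)) sequentially" by real_asymp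
  have 3: "eventually (\<lambda>N. sqrt (real N) > exp (exp 1)) sequentially" by real_asymp
  have 4: "eventually (\<lambda>N. sqrt (real N) \<le> \<eta> / 2 * real N) sequentially" using \<eta> by real_asymp
  have 5: "eventually (\<lambda>N. 2 \<le> \<eta> / 2 * (c * ln (ln (ln (real N))))) sequentially" using c \<eta> by real_asymp
  show ?thesis using 1 2 3 4 5
  proof eventually_elim
    case (elim N)
    let ?K = "\<lambda>n. K_len b y (real n)"
    have KN: "real (?K N) \<le> c * ln (ln (ln (real N))) + 1" "c * ln (ln (ln (real N))) \<le> real (?K N)"
    proof -
      have k: "?K N = nat \<lceil>c * ln (ln (ln (real N)))\<rceil>" using elim(2) by (simp add: K_len_def c_def)
      have "?K N > 0" by (rule K_len_pos[OF b])
      thus "real (?K N) \<le> c * ln (ln (ln (real N))) + 1" "c * ln (ln (ln (real N))) \<le> real (?K N)"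
        unfolding k by linarith+
    qed
    have Ks: "c * ln (ln (ln (sqrt (real N)))) \<le> real (K_len b y (sqrt (real N)))"
    proof -
      have "K_len b y (sqrt (real N)) = nat \<lceil>c * ln (ln (ln (sqrt (real N))))\<rceil>" using elim(3) by (simp add: K_len_def c_def)
      thus ?thesis by linarith
    qed
    have big: "real (?K N) - real (?K n) \<le> 2" if "real n \<ge> sqrt (real N)" for n
    proof -
      have "K_len b y (sqrt (real N)) \<le> ?K n" by (rule K_len_mono[OF b that])
      hence "c * ln (ln (ln (sqrt (real N)))) \<le> real (?K n)" using Ks by linarith
      thus ?thesis using elim(1) KN by (simp add: right_diff_distrib)
    qed
    let ?S = "{n\<in>{1..N}. real n < sqrt (real N)}"
    have "real N * real (?K N) - real (tot_len b y N) = (\<Sum>n=1..N. real (?K N) - real (?K n))"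
      by (simp add: sum_subtractf tot_len_def)
    also have "\<dots> \<le> (\<Sum>n=1..N. 2 + (if real n < sqrt (real N) then real (?K N) else 0))"
      using big by (intro sum_mono) (auto simp: not_less)
    also have "\<dots> = 2 * real N + real (card ?S) * real (?K N)"
      by (simp add: sum.distrib sum.inter_filter[symmetric])
    also have "real (card ?S) \<le> sqrt (real N)"
    proof -
      have "?S \<subseteq> {1..nat \<lfloor>sqrt (real N)\<rfloor>}" by (auto simp: le_nat_floor)
      hence "card ?S \<le> nat \<lfloor>sqrt (real N)\<rfloor>" using card_mono[of "{1..nat \<lfloor>sqrt (real N)\<rfloor>}" ?S] by simp
      thus ?thesis using real_sqrt_ge_zero[of "real N"] by linarith
    qed
    also have "2 * real N + sqrt (real N) * real (?K N) \<le> (\<eta> / 2 * real (?K N)) * real N + (\<eta> / 2 * real N) * real (?K N)"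
    proof (intro add_mono mult_right_mono)
      have "\<eta> / 2 * (c * ln (ln (ln (real N)))) \<le> \<eta> / 2 * real (?K N)" using KN(2) \<eta> by (intro mult_left_mono) auto
      thus "2 \<le> \<eta> / 2 * real (?K N)" using elim(5) by linarith
    qed (use elim(4) in simp_all)
    also have "\<dots> = \<eta> * (real N * real (?K N))" by (simp add: algebra_simps)
    finally show ?case by (simp add: mult_right_mono)
  qed
qed

lemma string_value_less:
  assumes "b \<ge> 1" "set a \<subseteq> {..<b}"
  shows "string_value b a < b ^ length a"
proof -
  have lt: "a ! (length a - 1 - i) < b" if "i < length a" for i
  proof -
    have "a ! (length a - 1 - i) \<in> set a" using that by (intro nth_mem) auto
    thus ?thesis using assms by auto
  qed
  thus ?thesis unfolding string_value_def by (rule digit_sum_less)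
qed

text \<open>Weyl's criterion for the points f n / b^(j + k). Neither \<open>H\<close> and \<delta>
  nor the threshold for N depends on j, so the estimate is uniform over all positions in the
  window.\<close>

lemma hit_equidistributed:
  fixes f :: "nat \<Rightarrow> real"
  assumes f: "nonneg_fun f" "additive_fun f" and c: "c > 0"
    and sm: "summable (\<lambda>p. if prime p then min 1 \<bar>f p - c\<bar> / real p else 0)"
    and eps: "\<epsilon> > 0" "\<eta> > 0" and b: "b \<ge> 2" and a: "set a \<subseteq> {..<b}"
  shows "eventually (\<lambda>N. \<forall>j. ll N powr \<epsilon> \<le> real b ^ (j + length a) \<and> real b ^ (j + length a) \<le> ll N powr (1/2 - \<epsilon>) \<longrightarrow>
     \<bar>real (card {n\<in>{1..N}. hit b f a n j}) - real N / real (b ^ length a)\<bar> \<le> \<eta> * real N) sequentially"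
proof -
  let ?q = "b ^ length a"
  have q: "?q \<ge> 1" using b by simp
  have sv: "string_value b a < ?q" by (rule string_value_less[OF _ a]) (use b in simp)
  obtain H :: nat and \<delta> :: real where H: "\<delta> > 0" "\<forall>(A::nat set) (u :: nat \<Rightarrow> real) v. finite A \<longrightarrow>
     (\<forall>h\<in>{1..H}. norm (\<Sum>n\<in>A. cis (2 * pi * real h * u n)) \<le> \<delta> * real (card A)) \<longrightarrow> v < ?q \<longrightarrow>
     \<bar>real (card {n\<in>A. nat \<lfloor>real ?q * frac (u n)\<rfloor> = v}) - real (card A) / real ?q\<bar> \<le> \<eta> * real (card A)"
    using weyl_arcs[OF q eps(2)] by (elim exE conjE) (rule that)
  have "eventually (\<lambda>N. \<forall>h\<in>{1..H}. \<forall>M. ll N powr \<epsilon> \<le> M \<and> M \<le> ll N powr (1/2 - \<epsilon>) \<longrightarrow>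
     norm (\<Sum>n=1..N. cis (2 * pi * real h * (f n / M))) \<le> \<delta> * real N) sequentially"
    by (intro eventually_ball_finite ballI additive_exp_sum_small[OF f(2) c sm eps(1) H(1)]) auto
  thus ?thesis
  proof eventually_elim
    case (elim N)
    show ?case
    proof (intro allI impI)
      fix j assume j: "ll N powr \<epsilon> \<le> real b ^ (j + length a) \<and> real b ^ (j + length a) \<le> ll N powr (1/2 - \<epsilon>)"
      let ?u = "\<lambda>n. f n / real b ^ (j + length a)"
      have eq: "{n\<in>{1..N}. hit b f a n j} = {n\<in>{1..N}. nat \<lfloor>real ?q * frac (?u n)\<rfloor> = string_value b a}"
      proof -
        have "nat \<lfloor>real ?q * frac (?u n)\<rfloor> = int_part f n div b ^ j mod ?q" if "n \<in> {1..N}" for n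
          unfolding int_part_def
          by (rule digits_eq_frac) (use that f(1) b in \<open>auto simp: nonneg_fun_def\<close>)
        thus ?thesis unfolding hit_def by auto
      qed
      have "\<bar>real (card {n\<in>{1..N}. nat \<lfloor>real ?q * frac (?u n)\<rfloor> = string_value b a}) - real (card {1..N}) / real ?q\<bar> \<le> \<eta> * real (card {1..N})"
      proof (intro H(2)[rule_format])
        fix h assume "h \<in> {1..H}"
        with elim j show "norm (\<Sum>n=1..N. cis (2 * pi * real h * ?u n)) \<le> \<delta> * real (card {1..N})"
          by simp
      qed (use sv in simp_all)
      thus "\<bar>real (card {n\<in>{1..N}. hit b f a n j}) - real N / real ?q\<bar> \<le> \<eta> * real N"
        unfolding eq by simp
    qed
  qed
qed

text \<open>In units of log_b l the admissible exponents fill the interval from \<epsilon> to 1/2 -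
  \<epsilon>. As \<open>K\<close> reaches at most 1/2, the loss is about \<epsilon> at each end,
  plus the shift k and roundings. This is where y \<le> 1/2 enters.\<close>

lemma card_bad_exponents:
  fixes l :: real
  assumes b: "b \<ge> 2" and l: "l \<ge> 1" and eps: "\<epsilon> > 0" "\<epsilon> < 1/2"
    and K: "real K \<le> ln l / ln (real b) / 2 + 1"
  shows "real (card {j\<in>{..<K}. \<not> (l powr \<epsilon> \<le> real b ^ (j + k) \<and> real b ^ (j + k) \<le> l powr (1/2 - \<epsilon>))})
     \<le> 2 * \<epsilon> * (ln l / ln (real b)) + real k + 4"
proof -
  define lam where "lam = ln l / ln (real b)"
  have lb: "ln (real b) > 0" using b by simp
  have lam: "lam \<ge> 0" unfolding lam_def using l lb by simp
  have lp: "l powr x = real b powr (x * lam)" for x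
    using b l lb by (simp add: powr_def lam_def)
  have bp: "real b ^ i = real b powr real i" for i using b by (simp add: powr_realpow)
  let ?B = "{j\<in>{..<K}. \<not> (l powr \<epsilon> \<le> real b ^ (j + k) \<and> real b ^ (j + k) \<le> l powr (1/2 - \<epsilon>))}"
  have "?B \<subseteq> {..<nat \<lceil>\<epsilon> * lam\<rceil>} \<union> {nat \<lfloor>(1/2 - \<epsilon>) * lam\<rfloor> - k..<K}"
  proof
    fix j assume j: "j \<in> ?B"
    hence "\<not> (\<epsilon> * lam \<le> real (j + k) \<and> real (j + k) \<le> (1/2 - \<epsilon>) * lam)"
      using b by (simp only: lp bp mem_Collect_eq) simp
    hence "real j < \<epsilon> * lam \<or> real (j + k) > (1/2 - \<epsilon>) * lam" by auto
    thus "j \<in> {..<nat \<lceil>\<epsilon> * lam\<rceil>} \<union> {nat \<lfloor>(1/2 - \<epsilon>) * lam\<rfloor> - k..<K}"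
    proof
      assume "real j < \<epsilon> * lam"
      hence "j < nat \<lceil>\<epsilon> * lam\<rceil>" by linarith
      thus ?thesis by simp
    next
      assume "real (j + k) > (1/2 - \<epsilon>) * lam"
      hence "nat \<lfloor>(1/2 - \<epsilon>) * lam\<rfloor> \<le> j + k" by linarith
      thus ?thesis using j by auto
    qed
  qed
  hence "card ?B \<le> card ({..<nat \<lceil>\<epsilon> * lam\<rceil>} \<union> {nat \<lfloor>(1/2 - \<epsilon>) * lam\<rfloor> - k..<K})"
    by (intro card_mono) auto
  also have "\<dots> \<le> card {..<nat \<lceil>\<epsilon> * lam\<rceil>} + card {nat \<lfloor>(1/2 - \<epsilon>) * lam\<rfloor> - k..<K}"
    by (rule card_Un_le)
  finally have B: "real (card ?B) \<le> real (nat \<lceil>\<epsilon> * lam\<rceil>) + real (K - (nat \<lfloor>(1/2 - \<epsilon>) * lam\<rfloor> - k))"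
    by simp
  have "real (nat \<lceil>\<epsilon> * lam\<rceil>) \<le> \<epsilon> * lam + 1"
    using eps lam mult_nonneg_nonneg[of \<epsilon> lam] by linarith
  moreover have "real (K - (nat \<lfloor>(1/2 - \<epsilon>) * lam\<rfloor> - k)) \<le> \<epsilon> * lam + real k + 2"
  proof -
    have "(1/2 - \<epsilon>) * lam = lam / 2 - \<epsilon> * lam" by (simp add: left_diff_distrib)
    moreover have "real (nat \<lfloor>(1/2 - \<epsilon>) * lam\<rfloor>) \<ge> (1/2 - \<epsilon>) * lam - 1" by linarith
    moreover have "real (K - (nat \<lfloor>(1/2 - \<epsilon>) * lam\<rfloor> - k)) \<le> max 0 (real K - real (nat \<lfloor>(1/2 - \<epsilon>) * lam\<rfloor>) + real k)"
      by linarith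
    moreover have "\<epsilon> * lam \<ge> 0" using eps lam by simp
    ultimately show ?thesis using K unfolding lam_def[symmetric] by linarith
  qed
  ultimately have "real (card ?B) \<le> 2 * (\<epsilon> * lam) + real k + 4" using B by linarith
  thus ?thesis unfolding lam_def by (simp only: mult.assoc)
qed

lemma hit_count_asymp:
  fixes f :: "nat \<Rightarrow> real"
  assumes f: "nonneg_fun f" "additive_fun f" and c: "c > 0"
    and sm: "summable (\<lambda>p. if prime p then min 1 \<bar>f p - c\<bar> / real p else 0)"
    and b: "b \<ge> 2" and y: "0 < y" "y \<le> 1/2" and a: "set a \<subseteq> {..<b}" and \<eta>: "\<eta> > 0"
  shows "eventually (\<lambda>N. \<bar>real (hit_count b f y a N) - real N * real (K_len b y (real N)) / real (b ^ length a)\<bar>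
     \<le> \<eta> * (real N * real (K_len b y (real N)))) sequentially"
proof -
  \<comment> \<open>The bad positions number about 2 \<epsilon> log_b l, at most (\<eta>/4) y log_b
    l and hence at most \<eta> K / 4. Another \<eta> K / 4 absorbs the constant length a +
    4.\<close>
  define \<epsilon> where "\<epsilon> = min (1/4) (\<eta> * y / 8)"
  have eps: "\<epsilon> > 0" "\<epsilon> < 1/2" "\<epsilon> \<le> \<eta> * y / 8" using \<eta> y by (auto simp: \<epsilon>_def)
  have lb: "ln (real b) > 0" using b by simp
  have 1: "eventually (\<lambda>N. \<forall>j. ll N powr \<epsilon> \<le> real b ^ (j + length a) \<and> real b ^ (j + length a) \<le> ll N powr (1/2 - \<epsilon>) \<longrightarrow>
     \<bar>real (card {n\<in>{1..N}. hit b f a n j}) - real N / real (b ^ length a)\<bar> \<le> \<eta> / 2 * real N) sequentially"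
    by (rule hit_equidistributed[OF f c sm eps(1) _ b a]) (use \<eta> in simp)
  have 2: "eventually (\<lambda>N. real (length a) + 4 \<le> \<eta> / 4 * (y * (ln (ll N) / ln (real b)))) sequentially"
    by (rule eventually_ll_compose) (use y \<eta> lb in real_asymp)
  show ?thesis using 1 2 K_len_bounds[OF b y(1)] eventually_ll_ge[of 1]
  proof eventually_elim
    case (elim N)
    define K where "K = K_len b y (real N)"
    define lam where "lam = ln (ll N) / ln (real b)"
    let ?q = "real (b ^ length a)"
    define G where "G = (\<lambda>j. ll N powr \<epsilon> \<le> real b ^ (j + length a) \<and> real b ^ (j + length a) \<le> ll N powr (1/2 - \<epsilon>))"
    let ?B = "{j\<in>{..<K}. \<not> G j}"
    let ?c = "\<lambda>j. card {n\<in>{1..N}. hit b f a n j}"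
    have lam: "lam \<ge> 0" "y * lam \<le> real K" "real K \<le> y * lam + 1" using elim by (auto simp: lam_def K_def)
    have "y * lam \<le> 1 / 2 * lam" using y lam by (intro mult_right_mono) auto
    hence "real K \<le> lam / 2 + 1" using lam by simp
    hence B1: "real (card ?B) \<le> 2 * \<epsilon> * lam + real (length a) + 4"
      unfolding G_def lam_def by (intro card_bad_exponents[OF b _ eps(1,2)]) (use elim(4) in auto)
    have B2: "2 * \<epsilon> * lam \<le> 2 * (\<eta> * y / 8) * lam" using eps lam by (intro mult_right_mono) auto
    have B3: "2 * (\<eta> * y / 8) * lam = \<eta> / 4 * (y * lam)" by simp
    have B4: "real (length a) + 4 \<le> \<eta> / 4 * (y * lam)" using elim(2) by (simp add: lam_def)
    have B5: "\<eta> / 4 * (y * lam) \<le> \<eta> / 4 * real K" using lam \<eta> by (intro mult_left_mono) auto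
    have B: "real (card ?B) \<le> \<eta> / 2 * real K" using B1 B2 B3 B4 B5 by linarith
    have q: "?q \<ge> 1" using b by simp
    have bad: "\<bar>real (?c j) - real N / ?q\<bar> \<le> real N" for j
    proof -
      have "card {n\<in>{1..N}. hit b f a n j} \<le> card {1..N}" by (intro card_mono) auto
      hence "real (?c j) \<le> real N" by simp
      moreover have "0 \<le> real N / ?q" by simp
      moreover have "real N / ?q \<le> real N" using q by (simp add: divide_le_eq mult_left_mono[of 1 ?q "real N", simplified])
      ultimately show ?thesis unfolding abs_le_iff by linarith
    qed
    have V: "real (hit_count b f y a N) - real N * real K / ?q = (\<Sum>j<K. real (?c j) - real N / ?q)"
      by (simp add: hit_count_def K_def sum_subtractf)
    have "\<bar>real (hit_count b f y a N) - real N * real K / ?q\<bar> \<le> (\<Sum>j<K. \<bar>real (?c j) - real N / ?q\<bar>)" unfolding V by (rule sum_abs)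
    also have "\<dots> \<le> (\<Sum>j<K. \<eta> / 2 * real N + (if \<not> G j then real N else 0))"
    proof (rule sum_mono)
      fix j
      show "\<bar>real (?c j) - real N / ?q\<bar> \<le> \<eta> / 2 * real N + (if \<not> G j then real N else 0)"
      proof (cases "G j")
        case True
        thus ?thesis using elim(1) unfolding G_def by simp
      next
        case False
        have "0 \<le> \<eta> / 2 * real N" using \<eta> by simp
        thus ?thesis using bad[of j] False by simp
      qed
    qed
    also have "\<dots> = \<eta> / 2 * real N * real K + real N * real (card ?B)"
    proof -
      have "(\<Sum>j<K. if \<not> G j then real N else 0) = (\<Sum>j\<in>?B. real N)"
        by (rule sum.inter_filter[symmetric]) simp
      thus ?thesis by (simp add: sum.distrib)
    qed
    also have "\<dots> \<le> \<eta> / 2 * real N * real K + real N * (\<eta> / 2 * real K)"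
      using B by (intro add_left_mono mult_left_mono) auto
    also have "\<dots> = \<eta> * (real N * real K)" by simp
    finally show ?case by (simp add: K_def)
  qed
qed

lemma occ_count_asymp:
  assumes b: "b \<ge> 2" and y: "0 < y" and a: "set a \<subseteq> {..<b}" "a \<noteq> []"
    and hc: "\<And>\<eta>. \<eta> > 0 \<Longrightarrow> eventually (\<lambda>N. \<bar>real (hit_count b f y a N) - real N * real (K_len b y (real N)) / real (b ^ length a)\<bar>
     \<le> \<eta> * (real N * real (K_len b y (real N)))) sequentially"
    and \<eta>: "\<eta> > 0"
  shows "eventually (\<lambda>N. \<bar>real (occ_count b f y a (tot_len b y N)) - real (tot_len b y N) / real (b ^ length a)\<bar>
     \<le> \<eta> * real (tot_len b y N)) sequentially"
proof -
  \<comment> \<open>Four errors of size \<delta> N K arise below, and \<delta> \<le> 1/2 gives N K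
    \<le> 2 T, so their total is at most 8 \<delta> T.\<close>
  define \<delta> where "\<delta> = min (1/2) (\<eta> / 8)"
  have \<delta>: "\<delta> > 0" "\<delta> \<le> 1/2" "\<delta> \<le> \<eta> / 8" using \<eta> by (auto simp: \<delta>_def)
  have lb: "ln (real b) > 0" using b by simp
  have 2: "eventually (\<lambda>N. real (length a) \<le> \<delta> * (y * (ln (ll N) / ln (real b)))) sequentially"
    by (rule eventually_ll_compose) (use y \<delta>(1) lb in real_asymp)
  show ?thesis using hc[OF \<delta>(1)] tot_len_asymp[OF b y \<delta>(1)] 2 K_len_bounds[OF b y]
  proof eventually_elim
    case (elim N)
    define NK where "NK = real N * real (K_len b y (real N))"
    define T where "T = real (tot_len b y N)"
    define C where "C = real (occ_count b f y a (tot_len b y N))"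
    define V where "V = real (hit_count b f y a N)"
    define \<beta> where "\<beta> = 1 / real (b ^ length a)"
    have \<beta>: "0 \<le> \<beta>" "\<beta> \<le> 1" using b by (auto simp: \<beta>_def)
    have 1: "\<bar>C - V\<bar> \<le> (NK - T) + real (length a) * real N"
      unfolding C_def V_def NK_def T_def by (rule occ_count_hit_count[OF b y a])
    have 2: "\<bar>V - NK * \<beta>\<bar> \<le> \<delta> * NK" using elim(1) by (simp add: V_def NK_def \<beta>_def)
    have 3: "NK - T \<le> \<delta> * NK" using elim(2) by (simp add: T_def NK_def)
    have 4: "T \<le> NK" unfolding T_def NK_def by (rule tot_len_le[OF b y])
    have "real (length a) * real N \<le> (\<delta> * real (K_len b y (real N))) * real N"
    proof (rule mult_right_mono)
      have "\<delta> * (y * (ln (ll N) / ln (real b))) \<le> \<delta> * real (K_len b y (real N))"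
        using elim(4) \<delta> by (intro mult_left_mono) auto
      thus "real (length a) \<le> \<delta> * real (K_len b y (real N))" using elim(3) by linarith
    qed simp
    hence 5: "real (length a) * real N \<le> \<delta> * NK" by (simp add: NK_def mult_ac)
    have 6: "\<bar>NK * \<beta> - T * \<beta>\<bar> \<le> \<delta> * NK"
    proof -
      have "\<bar>NK * \<beta> - T * \<beta>\<bar> = (NK - T) * \<beta>" using 4 \<beta> by (simp add: left_diff_distrib[symmetric] abs_mult)
      also have "\<dots> \<le> (NK - T) * 1" using 4 \<beta> by (intro mult_left_mono) auto
      finally show ?thesis using 3 by simp
    qed
    have 7: "\<bar>C - T * \<beta>\<bar> \<le> 4 * (\<delta> * NK)" using 1 2 3 5 6 by linarith
    have "NK \<ge> 0" by (simp add: NK_def)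
    hence "\<delta> * NK \<le> 1/2 * NK" using \<delta> by (intro mult_right_mono) auto
    hence "NK \<le> 2 * T" using 3 by simp
    hence 8: "\<delta> * NK \<le> \<delta> * (2 * T)" using \<delta> by (intro mult_left_mono) auto
    have "8 * \<delta> * T \<le> \<eta> * T" using \<delta> by (intro mult_right_mono) (auto simp: T_def)
    hence "\<bar>C - T * \<beta>\<bar> \<le> \<eta> * T" using 7 8 by linarith
    thus ?case by (simp add: C_def T_def \<beta>_def)
  qed
qed

section \<open>From whole blocks to arbitrary prefixes\<close>

lemma occ_count_mono: "X \<le> Y \<Longrightarrow> occ_count b f y a X \<le> occ_count b f y a Y"
  unfolding occ_count_def by (rule card_mono) auto

lemma occ_count_diff:
  assumes "X \<le> Y"
  shows "occ_count b f y a Y \<le> occ_count b f y a X + (Y - X)"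
proof -
  have "{i\<in>{1..Y}. occurs_at b f y a i} \<subseteq> {i\<in>{1..X}. occurs_at b f y a i} \<union> {X<..Y}" by auto
  hence "card {i\<in>{1..Y}. occurs_at b f y a i} \<le> card ({i\<in>{1..X}. occurs_at b f y a i} \<union> {X<..Y})"
    by (intro card_mono) auto
  also have "\<dots> \<le> card {i\<in>{1..X}. occurs_at b f y a i} + card {X<..Y}" by (rule card_Un_le)
  finally show ?thesis by (simp add: occ_count_def)
qed

text \<open>An arbitrary prefix exceeds one made of whole blocks by at most one block length, which
  is o(N), while N blocks contain at least N digits.\<close>

lemma occ_count_limit:
  fixes \<beta> :: real
  assumes b: "b \<ge> 2" and y: "0 < y" and \<beta>: "0 \<le> \<beta>" "\<beta> \<le> 1"
    and A: "\<And>\<eta>. \<eta> > 0 \<Longrightarrow> eventually (\<lambda>N. \<bar>real (occ_count b f y a (tot_len b y N)) - real (tot_len b y N) * \<beta>\<bar>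
     \<le> \<eta> * real (tot_len b y N)) sequentially"
  shows "(\<lambda>X. real (occ_count b f y a X) / real X) \<longlonglongrightarrow> \<beta>"
proof (rule LIMSEQ_I)
  fix \<eta> :: real assume \<eta>: "0 < \<eta>"
  have lb: "ln (real b) > 0" using b by simp
  have "eventually (\<lambda>N. y * (ln (ll N) / ln (real b)) + 1 \<le> \<eta> / 5 * (real N - 1)) sequentially"
    unfolding ll_def using y \<eta> lb by real_asymp
  hence "eventually (\<lambda>N. real (K_len b y (real N)) \<le> \<eta> / 5 * (real N - 1)) sequentially"
    using K_len_bounds[OF b y] by eventually_elim linarith
  hence K: "eventually (\<lambda>N. real (K_len b y (real (Suc N))) \<le> \<eta> / 5 * real N) sequentially"
    by (subst (asm) eventually_sequentially_Suc[symmetric]) simp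
  have "eventually (\<lambda>N. \<bar>real (occ_count b f y a (tot_len b y N)) - real (tot_len b y N) * \<beta>\<bar>
     \<le> \<eta> / 5 * real (tot_len b y N) \<and> real (K_len b y (real (Suc N))) \<le> \<eta> / 5 * real N) sequentially"
    using A[of "\<eta> / 5"] \<eta> K by (intro eventually_conj) auto
  then obtain N0 where N0: "\<And>N. N \<ge> N0 \<Longrightarrow> \<bar>real (occ_count b f y a (tot_len b y N)) - real (tot_len b y N) * \<beta>\<bar>
     \<le> \<eta> / 5 * real (tot_len b y N) \<and> real (K_len b y (real (Suc N))) \<le> \<eta> / 5 * real N"
    by (auto simp: eventually_sequentially)
  show "\<exists>X0. \<forall>X\<ge>X0. norm (real (occ_count b f y a X) / real X - \<beta>) < \<eta>"
  proof (intro exI[of _ "max 1 (tot_len b y N0)"] allI impI)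
    fix X assume X: "X \<ge> max 1 (tot_len b y N0)"
    have ex: "X < tot_len b y (Suc X)" using tot_len_ge[OF b y, of "Suc X"] by simp
    \<comment> \<open>With M = N + 1, the first N blocks fit into the prefix of length
      \<open>X\<close> and the next block would overshoot it.\<close>
    define M where "M = (LEAST M. X < tot_len b y M)"
    have M: "X < tot_len b y M" unfolding M_def by (rule LeastI[of _ "Suc X"]) (rule ex)
    have "M \<noteq> 0"
    proof
      assume "M = 0" thus False using M by (simp add: tot_len_def)
    qed
    then obtain N where N: "M = Suc N" by (cases M) auto
    have le: "tot_len b y N \<le> X"
      using not_less_Least[of N "\<lambda>M. X < tot_len b y M"] N unfolding M_def by simp
    have NN: "N \<ge> N0"
    proof (rule ccontr)
      assume "\<not> N \<ge> N0"
      hence "tot_len b y M \<le> tot_len b y N0" unfolding N by (intro tot_len_mono) auto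
      thus False using M X by simp
    qed
    let ?T = "tot_len b y N" and ?C = "occ_count b f y a"
    have d: "X - ?T \<le> K_len b y (real (Suc N))" using M unfolding N tot_len_Suc by simp
    have NT: "N \<le> ?T" by (rule tot_len_ge[OF b y])
    have rd: "0 \<le> real X - real ?T" "real X - real ?T \<le> \<eta> / 5 * real X"
    proof -
      show "0 \<le> real X - real ?T" using le by simp
      have "real X - real ?T \<le> real (K_len b y (real (Suc N)))" using d le by linarith
      also have "\<dots> \<le> \<eta> / 5 * real N" using N0[OF NN] by blast
      also have "\<dots> \<le> \<eta> / 5 * real X" using NT le \<eta> by (intro mult_left_mono) auto
      finally show "real X - real ?T \<le> \<eta> / 5 * real X" .
    qed
    have cd: "\<bar>real (?C X) - real (?C ?T)\<bar> \<le> real X - real ?T"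
      using occ_count_mono[OF le, of b f y a] occ_count_diff[OF le, of b f y a] le by linarith
    have bd: "\<bar>real ?T * \<beta> - real X * \<beta>\<bar> \<le> real X - real ?T"
    proof -
      have "real ?T * \<beta> - real X * \<beta> = - ((real X - real ?T) * \<beta>)" by (simp add: left_diff_distrib)
      moreover have "0 \<le> (real X - real ?T) * \<beta>" using rd \<beta> by (intro mult_nonneg_nonneg) auto
      moreover have "(real X - real ?T) * \<beta> \<le> real X - real ?T"
        using mult_left_mono[OF \<beta>(2) rd(1)] by (simp only: mult_1_right)
      ultimately show ?thesis by (simp only: abs_minus_cancel abs_of_nonneg)
    qed
    have "\<eta> / 5 * real ?T \<le> \<eta> / 5 * real X" using le \<eta> by (intro mult_left_mono) auto
    hence "\<bar>real (?C X) - real X * \<beta>\<bar> \<le> 3 * (\<eta> / 5 * real X)"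
      using cd bd rd N0[OF NN] by linarith
    also have "\<dots> < \<eta> * real X" using X \<eta> by simp
    finally have "\<bar>real (?C X) - real X * \<beta>\<bar> / real X < \<eta>" using X by (simp add: divide_less_eq)
    moreover have "real (?C X) / real X - \<beta> = (real (?C X) - real X * \<beta>) / real X" using X by (simp add: field_simps)
    ultimately show "norm (real (?C X) / real X - \<beta>) < \<eta>" by simp
  qed
qed

section \<open>Digits of the concatenation and digits of the real number\<close>

lemma theta_digit_less:
  assumes "b \<ge> 2" "y > 0" "i \<ge> 1"
  shows "theta_digit b f y i < b"
proof -
  let ?c = "concat (map (trunc_string b f y) [1..<i + 1])"
  have "i - 1 < length ?c" using length_concat_trunc_string[OF assms(1,2), of i f] assms(3) by linarith
  hence "theta_digit b f y i \<in> set ?c" unfolding theta_digit_def by (rule nth_mem)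
  moreover have "\<forall>d\<in>set ?c. d < b" using assms(1) by (auto simp: trunc_string_def T_base_def)
  ultimately show ?thesis by blast
qed

lemma digit_theta:
  assumes b: "b \<ge> 2" "y > 0" and inf: "\<And>n. \<exists>i\<ge>n. theta_digit b f y (Suc i) \<noteq> b - 1" and i: "i \<ge> 1"
  shows "digit b (theta b f y) i = theta_digit b f y i"
proof -
  have "digit b (theta b f y) (Suc (i - 1)) = theta_digit b f y (Suc (i - 1))"
    unfolding theta_def
    by (rule digit_of_expansion[OF b(1), where d = "\<lambda>n. theta_digit b f y (Suc n)"])
       (use theta_digit_less[OF b] inf in auto)
  thus ?thesis using i by simp
qed

lemma count_set_eq_occ_count:
  assumes b: "b \<ge> 2" "y > 0" and inf: "\<And>n. \<exists>i\<ge>n. theta_digit b f y (Suc i) \<noteq> b - 1"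
    and x: "x \<ge> real (length a)"
  shows "card {n::nat. 1 \<le> n \<and> real n \<le> x - real (length a) \<and>
            (\<forall>i\<in>{1..length a}. digit b (theta b f y) (n - 1 + i) = a ! (i - 1))}
     = occ_count b f y a (nat \<lfloor>x\<rfloor> - length a)"
proof -
  have "real n \<le> x - real (length a) \<longleftrightarrow> n \<le> nat \<lfloor>x\<rfloor> - length a" if "n \<ge> 1" for n
  proof -
    have "real n \<le> x - real (length a) \<longleftrightarrow> real (n + length a) \<le> x" by auto
    also have "\<dots> \<longleftrightarrow> n + length a \<le> nat \<lfloor>x\<rfloor>"
    proof
      assume "real (n + length a) \<le> x" thus "n + length a \<le> nat \<lfloor>x\<rfloor>" by (rule le_nat_floor)
    next
      assume "n + length a \<le> nat \<lfloor>x\<rfloor>" thus "real (n + length a) \<le> x" using that by linarith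
    qed
    finally show ?thesis using that by auto
  qed
  moreover have "(\<forall>i\<in>{1..length a}. digit b (theta b f y) (n - 1 + i) = a ! (i - 1)) \<longleftrightarrow> occurs_at b f y a n" for n
    unfolding occurs_at_def by (intro ball_cong refl) (simp add: digit_theta[OF b inf])
  ultimately have "{n::nat. 1 \<le> n \<and> real n \<le> x - real (length a) \<and>
            (\<forall>i\<in>{1..length a}. digit b (theta b f y) (n - 1 + i) = a ! (i - 1))}
     = {n\<in>{1..nat \<lfloor>x\<rfloor> - length a}. occurs_at b f y a n}"
    by (intro Collect_cong) auto
  thus ?thesis by (simp only: occ_count_def)
qed

lemma occurs_at_0:
  assumes "occurs_at b f y [0] i" "i \<ge> 1"
  shows "theta_digit b f y i = 0"
  using assms by (simp add: occurs_at_def)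

text \<open>Since b \<ge> 2, a zero differs from b - 1, so unboundedly many zeros rule out the
  ambiguous tail. Both the normal and the non-normal case supply them.\<close>

lemma infinitely_many_zero_digits:
  assumes b: "b \<ge> 2" "y > 0" and unb: "\<And>B. \<exists>X. occ_count b f y [0] X > B"
  shows "\<exists>i\<ge>n. theta_digit b f y (Suc i) \<noteq> b - 1"
proof (rule ccontr)
  assume neg: "\<not> (\<exists>i\<ge>n. theta_digit b f y (Suc i) \<noteq> b - 1)"
  obtain X where X: "occ_count b f y [0] X > n" using unb by blast
  have "{i\<in>{1..X}. occurs_at b f y [0] i} \<subseteq> {1..n}"
  proof
    fix i assume i: "i \<in> {i\<in>{1..X}. occurs_at b f y [0] i}"
    hence z: "theta_digit b f y (Suc (i - 1)) = 0" using occurs_at_0[of b f y i] by auto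
    have "\<not> i - 1 \<ge> n"
    proof
      assume "i - 1 \<ge> n"
      hence "theta_digit b f y (Suc (i - 1)) = b - 1" using neg by blast
      thus False using z b by simp
    qed
    thus "i \<in> {1..n}" using i by auto
  qed
  hence "occ_count b f y [0] X \<le> card {1..n}" unfolding occ_count_def by (intro card_mono) auto
  thus False using X by simp
qed

lemma filterlim_floor_diff: "filterlim (\<lambda>x::real. nat \<lfloor>x\<rfloor> - k) sequentially at_top"
proof -
  have "filterlim (\<lambda>x::real. nat \<lfloor>x - real k\<rfloor>) sequentially at_top"
    by (rule filterlim_compose[OF filterlim_nat_sequentially]) (rule filterlim_compose[OF filterlim_floor_sequentially], real_asymp)
  moreover have "(\<lambda>x::real. nat \<lfloor>x - real k\<rfloor>) = (\<lambda>x. nat \<lfloor>x\<rfloor> - k)" 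
  proof
    fix x :: real show "nat \<lfloor>x - real k\<rfloor> = nat \<lfloor>x\<rfloor> - k" by linarith
  qed
  ultimately show ?thesis by simp
qed

lemma normal_if_occ_counts:
  assumes b: "b \<ge> 2" "y > 0"
    and lim: "\<And>a. set a \<subseteq> {..<b} \<Longrightarrow> a \<noteq> [] \<Longrightarrow>
      (\<lambda>X. real (occ_count b f y a X) / real X) \<longlonglongrightarrow> 1 / real (b ^ length a)"
  shows "normal_in_base b (theta b f y)"
proof -
  \<comment> \<open>A bounded number of zeros would give the string [0] the limiting frequency 0
    instead of 1/b.\<close>
  have unb: "\<exists>X. occ_count b f y [0] X > B" for B
  proof (rule ccontr)
    assume "\<not> (\<exists>X. occ_count b f y [0] X > B)"
    hence le: "occ_count b f y [0] X \<le> B" for X by (auto simp: not_less)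
    have "(\<lambda>X. real (occ_count b f y [0] X) / real X) \<longlonglongrightarrow> 0"
    proof (rule tendsto_sandwich[OF _ _ tendsto_const])
      show "(\<lambda>X. real B / real X) \<longlonglongrightarrow> 0" by real_asymp
    qed (auto intro!: always_eventually divide_right_mono le)
    moreover have "(\<lambda>X. real (occ_count b f y [0] X) / real X) \<longlonglongrightarrow> 1 / real b"
      using lim[of "[0]"] b by simp
    ultimately have "1 / real b = 0" using LIMSEQ_unique by blast
    thus False using b by simp
  qed
  have inf: "\<exists>i\<ge>n. theta_digit b f y (Suc i) \<noteq> b - 1" for n
    by (rule infinitely_many_zero_digits[OF b unb])
  show ?thesis
    unfolding normal_in_base_def
  proof (intro allI impI)
    fix k :: nat and a :: "nat list"
    assume k: "1 \<le> k" and a: "length a = k \<and> set a \<subseteq> {..<b}"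
    have ne: "a \<noteq> []" using k a by auto
    let ?C = "occ_count b f y a"
    have L: "((\<lambda>x::real. real (?C (nat \<lfloor>x\<rfloor> - k)) / real (nat \<lfloor>x\<rfloor> - k)) \<longlongrightarrow> 1 / real (b ^ length a)) at_top"
      by (rule filterlim_compose[OF lim filterlim_floor_diff]) (use a ne in auto)
    have Q: "((\<lambda>x::real. real (nat \<lfloor>x\<rfloor> - k) / x) \<longlongrightarrow> 1) at_top"
    proof (rule tendsto_sandwich)
      show "((\<lambda>x::real. (x - 1 - real k) / x) \<longlongrightarrow> 1) at_top" by real_asymp
      show "((\<lambda>x::real. 1) \<longlongrightarrow> (1::real)) at_top" by simp
      show "eventually (\<lambda>x::real. (x - 1 - real k) / x \<le> real (nat \<lfloor>x\<rfloor> - k) / x) at_top"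
        using eventually_gt_at_top[of "0::real"]
      proof eventually_elim
        case (elim x)
        have "x - 1 - real k \<le> real (nat \<lfloor>x\<rfloor> - k)" using elim by linarith
        thus ?case using elim by (intro divide_right_mono) auto
      qed
      show "eventually (\<lambda>x::real. real (nat \<lfloor>x\<rfloor> - k) / x \<le> 1) at_top"
        using eventually_gt_at_top[of "0::real"]
      proof eventually_elim
        case (elim x)
        have "real (nat \<lfloor>x\<rfloor> - k) \<le> x" using elim by linarith
        thus ?case using elim by simp
      qed
    qed
    have "((\<lambda>x::real. real (?C (nat \<lfloor>x\<rfloor> - k)) / real (nat \<lfloor>x\<rfloor> - k) * (real (nat \<lfloor>x\<rfloor> - k) / x)) \<longlongrightarrow> 1 / real (b ^ length a) * 1) at_top"
      by (rule tendsto_mult[OF L Q])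
    hence "((\<lambda>x::real. real (?C (nat \<lfloor>x\<rfloor> - k)) / real (nat \<lfloor>x\<rfloor> - k) * (real (nat \<lfloor>x\<rfloor> - k) / x)) \<longlongrightarrow> 1 / real b ^ k) at_top"
      using a by simp
    moreover have "eventually (\<lambda>x::real. real (?C (nat \<lfloor>x\<rfloor> - k)) / real (nat \<lfloor>x\<rfloor> - k) * (real (nat \<lfloor>x\<rfloor> - k) / x)
       = real (card {n::nat. 1 \<le> n \<and> real n \<le> x - real k \<and>
            (\<forall>i\<in>{1..k}. digit b (theta b f y) (n - 1 + i) = a ! (i - 1))}) / x) at_top"
      using eventually_ge_at_top[of "real k"] 
    proof eventually_elim
      case (elim x)
      \<comment> \<open>For an empty range the quotient is 0 / 0 = 0, and the identity still holds
        because the count itself is 0.\<close>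
      have C0: "?C 0 = 0" by (simp add: occ_count_def)
      have "card {n::nat. 1 \<le> n \<and> real n \<le> x - real k \<and>
            (\<forall>i\<in>{1..k}. digit b (theta b f y) (n - 1 + i) = a ! (i - 1))} = ?C (nat \<lfloor>x\<rfloor> - k)"
        using count_set_eq_occ_count[OF b inf, of a x] a elim by simp
      thus ?case using C0 by (cases "nat \<lfloor>x\<rfloor> - k = 0") simp_all
    qed
    ultimately show "((\<lambda>x::real. real (card {n::nat. 1 \<le> n \<and> real n \<le> x - real k \<and>
            (\<forall>i\<in>{1..k}. digit b (theta b f y) (n - 1 + i) = a ! (i - 1))}) / x)
        \<longlongrightarrow> 1 / real b ^ k) at_top"
      by (rule Lim_transform_eventually)
  qed
qed

lemma not_normal_if_many_zeros:
  assumes b: "b \<ge> 2" "y > 0" and \<kappa>: "\<kappa> > 0"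
    and many: "\<And>N0. \<exists>N\<ge>N0. real (occ_count b f y [0] (tot_len b y N)) \<ge> (1 / real b + \<kappa>) * real (tot_len b y N)"
  shows "\<not> normal_in_base b (theta b f y)"
proof
  assume normal: "normal_in_base b (theta b f y)"
  have unb: "\<exists>X. occ_count b f y [0] X > B" for B
  proof -
    obtain N0 :: nat where N0: "(real B + 1) / \<kappa> < real N0" using reals_Archimedean2 by blast
    obtain N where N: "N \<ge> N0" "real (occ_count b f y [0] (tot_len b y N)) \<ge> (1 / real b + \<kappa>) * real (tot_len b y N)"
      using many by blast
    have "real B < \<kappa> * real N0" using N0 \<kappa> by (simp add: field_simps)
    also have "\<dots> \<le> \<kappa> * real (tot_len b y N)"
      using N(1) tot_len_ge[OF b, of N] \<kappa> by (intro mult_left_mono) auto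
    also have "\<dots> \<le> (1 / real b + \<kappa>) * real (tot_len b y N)" by (intro mult_right_mono) auto
    also have "\<dots> \<le> real (occ_count b f y [0] (tot_len b y N))" by (rule N(2))
    finally show ?thesis by auto
  qed
  have inf: "\<exists>i\<ge>n. theta_digit b f y (Suc i) \<noteq> b - 1" for n
    by (rule infinitely_many_zero_digits[OF b unb])
  have "set [0] \<subseteq> {..<b}" "length [0::nat] = 1" using b by auto
  with normal have "((\<lambda>x::real. real (card {n::nat. 1 \<le> n \<and> real n \<le> x - real (1::nat) \<and>
            (\<forall>i\<in>{1..1}. digit b (theta b f y) (n - 1 + i) = [0] ! (i - 1))}) / x)
        \<longlongrightarrow> 1 / real b ^ 1) at_top"
    unfolding normal_in_base_def by blast
  hence "eventually (\<lambda>x::real. real (card {n::nat. 1 \<le> n \<and> real n \<le> x - real (1::nat) \<and>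
            (\<forall>i\<in>{1..1}. digit b (theta b f y) (n - 1 + i) = [0] ! (i - 1))}) / x < 1 / real b ^ 1 + \<kappa> / 2) at_top"
    by (rule order_tendstoD(2)) (use \<kappa> in simp)
  then obtain x0 where x0: "\<And>x::real. x \<ge> x0 \<Longrightarrow> real (card {n::nat. 1 \<le> n \<and> real n \<le> x - real (1::nat) \<and>
            (\<forall>i\<in>{1..1}. digit b (theta b f y) (n - 1 + i) = [0] ! (i - 1))}) / x < 1 / real b ^ 1 + \<kappa> / 2"
    by (auto simp: eventually_at_top_linorder)
  \<comment> \<open>The term 4 / \<kappa> makes the surplus (\<kappa>/2) T exceed 1/b + \<kappa>/2,
    the cost of passing from T to T + 1.\<close>
  obtain N0 :: nat where N0: "max x0 (4 / \<kappa> + 1) < real N0" using reals_Archimedean2 by blast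
  obtain N where N: "N \<ge> N0" "real (occ_count b f y [0] (tot_len b y N)) \<ge> (1 / real b + \<kappa>) * real (tot_len b y N)"
    using many by blast
  define T where "T = real (tot_len b y N)"
  \<comment> \<open>Normality counts n \<le> x - 1 for a string of length 1, so this
    \<open>x\<close> selects exactly the first \<open>tot_len b y N\<close> positions.\<close>
  define x where "x = T + 1"
  have T: "T \<ge> real N0" unfolding T_def using N(1) tot_len_ge[OF b, of N] by simp
  have fx: "nat \<lfloor>x\<rfloor> - 1 = tot_len b y N"
  proof -
    have "x = of_int (int (tot_len b y N + 1))" by (simp add: x_def T_def)
    hence "\<lfloor>x\<rfloor> = int (tot_len b y N + 1)" by (simp only: floor_of_int)
    thus ?thesis by simp
  qed
  have "x \<ge> x0" using T N0 by (simp add: x_def)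
  from x0[OF this] have "real (occ_count b f y [0] (tot_len b y N)) / x < 1 / real b + \<kappa> / 2"
    using count_set_eq_occ_count[OF b inf, of "[0]" x] fx T N0 by (simp add: x_def)
  moreover have xp: "x > 0" using T by (simp add: x_def)
  ultimately have "real (occ_count b f y [0] (tot_len b y N)) < (1 / real b + \<kappa> / 2) * x"
    by (simp add: divide_less_eq)
  hence "(1 / real b + \<kappa>) * T < (1 / real b + \<kappa> / 2) * (T + 1)"
    using N(2) unfolding T_def[symmetric] x_def by linarith
  hence "\<kappa> / 2 * T < 1 / real b + \<kappa> / 2"
    by (simp only: ring_distribs mult_1_right)
  moreover have "1 / real b \<le> 1" using b by simp
  moreover have "\<kappa> / 2 * T \<ge> \<kappa> / 2 * (4 / \<kappa> + 1)" using T N0 \<kappa> by (intro mult_left_mono) auto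
  moreover have "\<kappa> / 2 * (4 / \<kappa> + 1) = 2 + \<kappa> / 2" using \<kappa> by (simp add: field_simps)
  ultimately show False by linarith
qed

section \<open>Concentration\<close>

text \<open>Expanding the square needs only upper bounds for the counts of multiples of p q, so
  pairs with p q > N require no separate treatment. The lower bound for the first moment loses 1 per
  prime, at most N in all; together with the diagonal this gives N L + 2 N L.\<close>

lemma turan:
  assumes "N \<ge> 1"
  shows "(\<Sum>n=1..N. (real (card (prime_factors n)) - prime_recip_sum N) ^ 2) \<le> 3 * real N * prime_recip_sum N"
proof -
  define P where "P = {p. prime p \<and> p \<le> N}"
  define L where "L = prime_recip_sum N"
  define i where "i = (\<lambda>(p::nat) (n::nat). if p dvd n then 1 else 0 :: real)"
  have fin: "finite P" by (simp add: P_def)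
  have L: "L = (\<Sum>p\<in>P. 1 / real p)" by (simp add: L_def P_def prime_recip_sum_def)
  have L0: "L \<ge> 0" unfolding L by (intro sum_nonneg) auto
  have pos: "p > 0" if "p \<in> P" for p using that by (simp add: P_def prime_gt_0_nat)
  have om: "real (card (prime_factors n)) = (\<Sum>p\<in>P. i p n)" if n: "n \<in> {1..N}" for n
  proof -
    have "p \<le> N" if "p dvd n" for p using dvd_imp_le[OF that] n by auto
    hence "prime_factors n = {p\<in>P. p dvd n}" using n by (auto simp: P_def in_prime_factors_iff)
    hence "real (card (prime_factors n)) = (\<Sum>p\<in>{p\<in>P. p dvd n}. 1)" by simp
    also have "\<dots> = (\<Sum>p\<in>P. i p n)" unfolding i_def by (rule sum.inter_filter[OF fin])
    finally show ?thesis .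
  qed
  have count: "(\<Sum>n=1..N. i d n) = real (card {n\<in>{1..N}. d dvd n})" for d
  proof -
    have "(\<Sum>n=1..N. i d n) = (\<Sum>n\<in>{n\<in>{1..N}. d dvd n}. 1)"
      unfolding i_def by (rule sum.inter_filter[symmetric]) simp
    thus ?thesis by simp
  qed
  have S1: "(\<Sum>n=1..N. \<Sum>p\<in>P. i p n) \<ge> real N * L - real N"
  proof -
    have "real N * L - real (card P) = (\<Sum>p\<in>P. real N / real p - 1)"
      unfolding L by (simp add: sum_subtractf sum_distrib_left)
    also have "\<dots> \<le> (\<Sum>p\<in>P. real (card {n\<in>{1..N}. p dvd n}))"
      by (intro sum_mono card_multiples_ge pos)
    also have "\<dots> = (\<Sum>p\<in>P. \<Sum>n=1..N. i p n)" by (simp only: count)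
    also have "\<dots> = (\<Sum>n=1..N. \<Sum>p\<in>P. i p n)" by (rule sum.swap)
    finally have 1: "real N * L - real (card P) \<le> (\<Sum>n=1..N. \<Sum>p\<in>P. i p n)" .
    have "P \<subseteq> {1..N}" using pos by (auto simp: P_def Suc_le_eq)
    hence "card P \<le> N" using card_mono[of "{1..N}" P] by simp
    thus ?thesis using 1 by linarith
  qed
  have S2: "(\<Sum>n=1..N. (\<Sum>p\<in>P. i p n) ^ 2) \<le> real N * L ^ 2 + real N * L"
  proof -
    have pq: "(\<Sum>n=1..N. i p n * i q n) \<le> real N * (1 / real p * (1 / real q)) + (if p = q then real N * (1 / real p) else 0)"
      if "p \<in> P" "q \<in> P" for p q
    proof (cases "p = q")
      case True
      have "(\<Sum>n=1..N. i p n * i q n) = (\<Sum>n=1..N. i p n)" using True by (intro sum.cong) (auto simp: i_def)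
      also have "\<dots> \<le> real N / real p" unfolding count by (rule card_multiples_le[OF pos[OF that(1)]])
      also have "\<dots> \<le> real N * (1 / real p * (1 / real q)) + real N / real p" by simp
      finally show ?thesis using True by simp
    next
      case False
      have "coprime p q" using that False by (intro primes_coprime) (auto simp: P_def)
      hence "(\<Sum>n=1..N. i p n * i q n) = (\<Sum>n=1..N. i (p * q) n)"
        by (intro sum.cong refl) (auto simp: i_def intro: divides_mult dvd_mult_left dvd_mult_right)
      also have "\<dots> \<le> real N / real (p * q)" unfolding count
        by (rule card_multiples_le) (use pos[OF that(1)] pos[OF that(2)] in simp)
      finally show ?thesis using False by simp
    qed
    have "(\<Sum>n=1..N. (\<Sum>p\<in>P. i p n) ^ 2) = (\<Sum>n=1..N. \<Sum>p\<in>P. \<Sum>q\<in>P. i p n * i q n)"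
      by (simp only: power2_eq_square sum_product)
    also have "\<dots> = (\<Sum>p\<in>P. \<Sum>n=1..N. \<Sum>q\<in>P. i p n * i q n)" by (rule sum.swap)
    also have "\<dots> = (\<Sum>p\<in>P. \<Sum>q\<in>P. \<Sum>n=1..N. i p n * i q n)" by (intro sum.cong refl sum.swap)
    also have "\<dots> \<le> (\<Sum>p\<in>P. \<Sum>q\<in>P. real N * (1 / real p * (1 / real q)) + (if p = q then real N * (1 / real p) else 0))"
      by (intro sum_mono pq)
    also have "\<dots> = (\<Sum>p\<in>P. \<Sum>q\<in>P. real N * (1 / real p * (1 / real q))) + (\<Sum>p\<in>P. \<Sum>q\<in>P. if p = q then real N * (1 / real p) else 0)"
      by (simp only: sum.distrib)
    also have "(\<Sum>p\<in>P. \<Sum>q\<in>P. real N * (1 / real p * (1 / real q))) = real N * L ^ 2"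
      unfolding L power2_eq_square sum_product by (simp only: sum_distrib_left)
    also have "(\<Sum>p\<in>P. \<Sum>q\<in>P. if p = q then real N * (1 / real p) else 0) = (\<Sum>p\<in>P. real N * (1 / real p))"
      using fin by (intro sum.cong refl) simp
    also have "\<dots> = real N * L" unfolding L by (simp only: sum_distrib_left)
    finally show ?thesis .
  qed
  have "(\<Sum>n=1..N. (real (card (prime_factors n)) - L) ^ 2) = (\<Sum>n=1..N. (\<Sum>p\<in>P. i p n) ^ 2 - 2 * L * (\<Sum>p\<in>P. i p n) + L ^ 2)"
    by (intro sum.cong refl) (simp add: om power2_diff)
  also have "\<dots> = (\<Sum>n=1..N. (\<Sum>p\<in>P. i p n) ^ 2) - 2 * L * (\<Sum>n=1..N. \<Sum>p\<in>P. i p n) + real N * L ^ 2"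
    by (simp add: sum.distrib sum_subtractf sum_distrib_left)
  also have "\<dots> \<le> (real N * L ^ 2 + real N * L) - 2 * L * (real N * L - real N) + real N * L ^ 2"
    using S2 mult_left_mono[OF S1, of "2 * L"] L0 by simp
  also have "\<dots> = 3 * real N * L" by (simp add: power2_eq_square algebra_simps)
  finally show ?thesis by (simp only: L_def)
qed

section \<open>Arguments whose centre lies just above a power of the base\<close>

lemma prime_recip_sum_mono: "M \<le> N \<Longrightarrow> prime_recip_sum M \<le> prime_recip_sum N"
  unfolding prime_recip_sum_def by (rule sum_mono2) auto

lemma prime_recip_sum_Suc: "prime_recip_sum (Suc N) \<le> prime_recip_sum N + 1"
proof -
  have "{p. prime p \<and> p \<le> Suc N} \<subseteq> insert (Suc N) {p. prime p \<and> p \<le> N}" by (auto simp: le_Suc_eq)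
  hence "prime_recip_sum (Suc N) \<le> (\<Sum>p\<in>insert (Suc N) {p. prime p \<and> p \<le> N}. 1 / real p)"
    unfolding prime_recip_sum_def by (intro sum_mono2) auto
  also have "\<dots> = 1 / real (Suc N) + prime_recip_sum N"
    unfolding prime_recip_sum_def by (subst sum.insert) auto
  also have "1 / real (Suc N) \<le> 1" by simp
  finally show ?thesis by simp
qed

text \<open>
  At suitable arguments the centre \<open>c * prime_recip_sum N\<close> lies just above a power of \<open>b\<close>, so that the
  upper half of the digits of most values \<open>f n\<close> consists of a single one followed by zeros.
\<close>

lemma additive_concentrated:
  fixes f :: "nat \<Rightarrow> real"
  assumes f: "additive_fun f" and c: "c > 0"
    and sm: "summable (\<lambda>p. if prime p then min 1 \<bar>f p - c\<bar> / real p else 0)"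
    and b: "b \<ge> 2" and eps: "\<epsilon> > 0"
  shows "\<exists>C. \<forall>N0. \<exists>N\<ge>N0. \<exists>m J. J \<le> m \<and> real J \<le> ln (ll N) / ln (real b) / 2 + C \<and>
     real (card {n\<in>{1..N}. \<not> (b ^ m \<le> int_part f n \<and> int_part f n < b ^ m + b ^ J)}) \<le> \<epsilon> * real N"
proof -
  define g where "g = (\<lambda>n. f n - c * real (card (prime_factors n)))"
  obtain C0 where C0: "\<And>N. real (card {n\<in>{1..N}. \<bar>g n\<bar> > C0}) \<le> \<epsilon> / 2 * real N"
    using additive_near_prime_count[OF f sm, of "\<epsilon> / 2"] eps unfolding g_def by auto
  \<comment> \<open>Deviations beyond A sqrt L have density at most 3 / A^2 = \<epsilon>/2 by
    Turan's inequality.\<close>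
  define A where "A = sqrt (6 / \<epsilon>)"
  have A: "A > 0" "A ^ 2 = 6 / \<epsilon>" using eps by (auto simp: A_def)
  \<comment> \<open>All deviations measured in units of sqrt (b^m); the factor sqrt (2/c) comes from
    L \<le> (2/c) b^m.\<close>
  define D where "D = \<bar>C0\<bar> + c + 1 + c * A * sqrt (2 / c)"
  have D: "D > 0" using c A by (simp add: D_def add_nonneg_pos add_pos_nonneg)
  have b1: "real b > 1" using b by simp
  have lb: "ln (real b) > 0" using b by simp
  \<comment> \<open>This makes b^J at least 2 D sqrt (b^m) for J = m div 2 + J1; the factor sqrt b
    covers odd m.\<close>
  obtain J1 where J1: "2 * D * sqrt (real b) < real b ^ J1" using real_arch_pow[OF b1] by blast
  define C where "C = ln (9 * c) / ln (real b) / 2 + real J1"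
  obtain N1 where N1: "\<And>N. N \<ge> N1 \<Longrightarrow> ll N \<ge> 1" 
    using eventually_ll_ge[of 1] by (auto simp: eventually_sequentially)
  show ?thesis
  proof (intro exI[of _ C] allI)
    fix N0 :: nat
    define N0' where "N0' = max N0 (max N1 2)"
    obtain m0 where m0: "max (c * prime_recip_sum N0') (2 * c) < real b ^ m0" using real_arch_pow[OF b1] by blast
    \<comment> \<open>The bound by 2 * J1 gives J \<le> m, and \<open>m0\<close> pushes b^m above
      all centres up to N0', which forces the chosen N to be large.\<close>
    define m where "m = max m0 (2 * J1)"
    define J where "J = m div 2 + J1"
    have Jm: "J \<le> m" unfolding J_def m_def by linarith
    have bm: "c * prime_recip_sum N0' < real b ^ m" "2 * c < real b ^ m"
    proof -
      have "real b ^ m0 \<le> real b ^ m" using b1 by (intro power_increasing) (auto simp: m_def)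
      thus "c * prime_recip_sum N0' < real b ^ m" "2 * c < real b ^ m" using m0 by linarith+
    qed
    have bm1: "real b ^ m \<ge> 1" using b1 by (intro one_le_power) auto
    have bJm: "real b ^ J \<le> real b ^ m" using b1 Jm by (intro power_increasing) auto
    have DJ: "D * sqrt (real b ^ m) \<le> real b ^ J / 2"
    proof -
      have "real b ^ m \<le> real b ^ (1 + 2 * (m div 2))" using b1 by (intro power_increasing) auto
      also have "\<dots> = (sqrt (real b) * real b ^ (m div 2)) ^ 2"
        using b1 by (simp add: power_mult_distrib power_mult [symmetric] power_add mult.commute)
      finally have "sqrt (real b ^ m) \<le> sqrt (real b) * real b ^ (m div 2)"
        using b1 by (intro real_le_lsqrt) auto
      hence "2 * D * sqrt (real b ^ m) \<le> 2 * D * (sqrt (real b) * real b ^ (m div 2))"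
        using D by (intro mult_left_mono) auto
      also have "\<dots> = (2 * D * sqrt (real b)) * real b ^ (m div 2)" by simp
      also have "\<dots> \<le> real b ^ J1 * real b ^ (m div 2)" using J1 b1 by (intro mult_right_mono) auto
      also have "\<dots> = real b ^ J" by (simp add: J_def power_add)
      finally show ?thesis by simp
    qed
    \<comment> \<open>The midpoint of the target interval. The centre moves by at most c from one N
      to the next, so at the first N that reaches \<open>T\<close> it lies in [T, T + c), and
      deviations of almost b^J / 2 are allowed on both sides.\<close>
    define T where "T = real b ^ m + real b ^ J / 2"
    have ex: "\<exists>N. c * prime_recip_sum N \<ge> T"
    proof -
      have "eventually (\<lambda>N. ll N \<ge> T / c + 1 \<and> N \<ge> 2) sequentially"
        by (intro eventually_conj eventually_ll_ge eventually_ge_at_top)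
      then obtain N where N: "ll N \<ge> T / c + 1" "N \<ge> 2" by (auto simp: eventually_sequentially)
      have "prime_recip_sum N \<ge> T / c" using prime_recip_sum_ge[OF N(2)] N(1) by linarith
      hence "c * prime_recip_sum N \<ge> T" using c by (simp add: field_simps)
      thus ?thesis by blast
    qed
    define N where "N = (LEAST N. c * prime_recip_sum N \<ge> T)"
    define L where "L = prime_recip_sum N"
    have NT: "c * L \<ge> T" unfolding L_def N_def by (rule LeastI_ex[OF ex])
    have bJ0: "real b ^ J > 0" using b1 by simp
    have Nbig: "N > N0'"
    proof (rule ccontr)
      assume "\<not> N > N0'"
      hence "L \<le> prime_recip_sum N0'" unfolding L_def by (intro prime_recip_sum_mono) auto
      hence "c * L \<le> c * prime_recip_sum N0'" using c by (intro mult_left_mono) auto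
      thus False using NT bm(1) bJ0 unfolding T_def by linarith
    qed
    have NT2: "c * L < T + c"
    proof -
      obtain N' where N': "N = Suc N'" using Nbig by (cases N) auto
      have "\<not> c * prime_recip_sum N' \<ge> T"
        using not_less_Least[of N' "\<lambda>N. c * prime_recip_sum N \<ge> T"] N' unfolding N_def by simp
      moreover have "c * L \<le> c * (prime_recip_sum N' + 1)"
        unfolding L_def N' using c prime_recip_sum_Suc[of N'] by (intro mult_left_mono) auto
      ultimately show ?thesis by (simp add: ring_distribs)
    qed
    have N2: "N \<ge> 2" and llN: "ll N \<ge> 1" using Nbig N1[of N] by (auto simp: N0'_def)
    have L0: "L > 0"
    proof -
      have "0 < T" unfolding T_def using bm1 bJ0 by linarith
      hence "0 < c * L" using NT by linarith
      thus ?thesis using c by (simp add: zero_less_mult_iff)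
    qed
    have Lup: "L \<le> 2 / c * real b ^ m"
    proof -
      have "c * L \<le> 2 * real b ^ m" using NT2 bJm bm(2) unfolding T_def by linarith
      thus ?thesis using c by (simp add: field_simps)
    qed
    define s where "s = A * sqrt L"
    have s: "s > 0" using A L0 by (simp add: s_def)
    have dev: "\<bar>C0\<bar> + c * s + c + 1 \<le> real b ^ J / 2"
    proof -
      have "sqrt L \<le> sqrt (2 / c) * sqrt (real b ^ m)"
        using Lup by (simp add: real_sqrt_mult [symmetric])
      hence "c * s \<le> c * A * sqrt (2 / c) * sqrt (real b ^ m)"
        unfolding s_def using c A by (simp add: mult.assoc)
      moreover have "(\<bar>C0\<bar> + c + 1) * 1 \<le> (\<bar>C0\<bar> + c + 1) * sqrt (real b ^ m)"
        using c bm1 by (intro mult_left_mono) auto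
      ultimately have "\<bar>C0\<bar> + c * s + c + 1 \<le> D * sqrt (real b ^ m)"
        unfolding D_def by (simp add: ring_distribs)
      thus ?thesis using DJ by linarith
    qed
    let ?om = "\<lambda>n. real (card (prime_factors n))"
    let ?B1 = "{n\<in>{1..N}. \<bar>g n\<bar> > C0}" and ?B2 = "{n\<in>{1..N}. (?om n - L) ^ 2 \<ge> s ^ 2}"
    have sub: "{n\<in>{1..N}. \<not> (b ^ m \<le> int_part f n \<and> int_part f n < b ^ m + b ^ J)} \<subseteq> ?B1 \<union> ?B2"
    proof (rule subsetI, rule ccontr)
      fix n assume n: "n \<in> {n\<in>{1..N}. \<not> (b ^ m \<le> int_part f n \<and> int_part f n < b ^ m + b ^ J)}"
        and nb: "n \<notin> ?B1 \<union> ?B2"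
      have 1: "\<bar>g n\<bar> \<le> C0" and 2: "(?om n - L) ^ 2 < s ^ 2" using n nb by auto
      have "\<bar>?om n - L\<bar> ^ 2 < s ^ 2" using 2 by (simp only: power2_abs)
      hence "\<bar>?om n - L\<bar> < s" by (rule power2_less_imp_less) (use s in simp)
      hence "c * \<bar>?om n - L\<bar> \<le> c * s" using c by (intro mult_left_mono) auto
      hence 3: "\<bar>c * (?om n - L)\<bar> \<le> c * s" using c by (simp add: abs_mult)
      have "f n = c * L + g n + c * (?om n - L)" by (simp add: g_def algebra_simps)
      hence lo: "f n \<ge> real b ^ m" and up: "f n < real b ^ m + real b ^ J"
        using 1 3 dev NT NT2 unfolding T_def by linarith+
      have "real (b ^ m) \<le> f n" "f n < real (b ^ m + b ^ J)" using lo up by simp_all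
      hence "b ^ m \<le> int_part f n" "int_part f n < b ^ m + b ^ J" unfolding int_part_def by linarith+
      thus False using n by simp
    qed
    have B2: "real (card ?B2) \<le> \<epsilon> / 2 * real N"
    proof -
      have "real (card ?B2) \<le> 3 * real N * L / s ^ 2"
        by (rule markov_card) (use turan[of N] N2 s in \<open>auto simp: L_def\<close>)
      also have "\<dots> = 3 * real N / A ^ 2" using L0 A(1) by (simp add: s_def power_mult_distrib)
      also have "\<dots> = \<epsilon> / 2 * real N" using eps by (simp add: A(2))
      finally show ?thesis .
    qed
    have "card {n\<in>{1..N}. \<not> (b ^ m \<le> int_part f n \<and> int_part f n < b ^ m + b ^ J)} \<le> card (?B1 \<union> ?B2)"
      by (rule card_mono[OF _ sub]) auto
    also have "\<dots> \<le> card ?B1 + card ?B2" by (rule card_Un_le)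
    finally have card: "real (card {n\<in>{1..N}. \<not> (b ^ m \<le> int_part f n \<and> int_part f n < b ^ m + b ^ J)}) \<le> \<epsilon> * real N"
      using B2 C0[of N] by linarith
    have "real J \<le> ln (ll N) / ln (real b) / 2 + C"
    proof -
      have "real b ^ m \<le> c * L" using NT bJ0 unfolding T_def by linarith
      also have "\<dots> \<le> c * (9 * ll N)"
        unfolding L_def using c prime_recip_sum_le[OF N2] llN by (intro mult_left_mono) auto
      finally have "ln (real b ^ m) \<le> ln (9 * c * ll N)" using b1 by (intro ln_mono) (auto simp: mult_ac)
      hence "real m * ln (real b) \<le> ln (9 * c) + ln (ll N)"
        using b1 c llN by (simp add: ln_realpow ln_mult)
      hence "real m \<le> (ln (9 * c) + ln (ll N)) / ln (real b)" using lb by (simp add: pos_le_divide_eq)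
      hence m: "real m \<le> ln (9 * c) / ln (real b) + ln (ll N) / ln (real b)" by (simp only: add_divide_distrib)
      have "real J \<le> v / 2 + (u / 2 + real J1)" if "real m \<le> u + v" for u v
        using that unfolding J_def by linarith
      from this[OF m] show ?thesis by (simp only: C_def)
    qed
    with Jm card Nbig show "\<exists>N\<ge>N0. \<exists>m J. J \<le> m \<and> real J \<le> ln (ll N) / ln (real b) / 2 + C \<and>
       real (card {n\<in>{1..N}. \<not> (b ^ m \<le> int_part f n \<and> int_part f n < b ^ m + b ^ J)}) \<le> \<epsilon> * real N"
      by (intro exI[of _ N] conjI exI[of _ m] exI[of _ J]) (auto simp: N0'_def)
  qed
qed

text \<open>The value is b^m plus a remainder below b^J, so besides the digit 1 at position m only
  digits below position J can be nonzero.\<close>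

lemma hit_zero_of_interval:
  assumes b: "b \<ge> 2" and F: "b ^ m \<le> int_part f n" "int_part f n < b ^ m + b ^ J" and J: "J \<le> m" and j: "J \<le> j" "j \<noteq> m"
  shows "hit b f [0] n j"
proof -
  define e where "e = int_part f n - b ^ m"
  have e: "int_part f n = b ^ m + e" "e < b ^ J" using F by (auto simp: e_def)
  have eJ: "e < b ^ j"
  proof -
    have "b ^ J \<le> b ^ j" using j b by (intro power_increasing) auto
    thus ?thesis using e by linarith
  qed
  have "int_part f n div b ^ j mod b = 0"
  proof (cases "j < m")
    case True
    have "b ^ m = b ^ (m - j) * b ^ j" using True by (simp add: power_add[symmetric])
    hence "int_part f n div b ^ j = b ^ (m - j)" using e eJ b by simp
    moreover have "b dvd b ^ (m - j)" using True by (intro dvd_power) auto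
    ultimately show ?thesis by simp
  next
    case False
    hence "m < j" using j by simp
    have "b ^ m + e < 2 * b ^ m"
    proof -
      have "b ^ J \<le> b ^ m" using J b by (intro power_increasing) auto
      thus ?thesis using e by linarith
    qed
    also have "\<dots> \<le> b ^ Suc m" using b by simp
    also have "\<dots> \<le> b ^ j" using \<open>m < j\<close> b by (intro power_increasing) auto
    finally show ?thesis unfolding e by simp
  qed
  thus ?thesis by (simp add: hit_def string_value_def)
qed

text \<open>With l = log_b (ll N), the lower l/2 positions contain zeros with frequency about 1/b
  and the upper (y - 1/2) l positions almost only zeros. The surplus over y l / b is (y - 1/2) (1 -
  1/b) l per value of n, which is \<Delta> l in the proof; \<kappa> is an eighth of it relative to y
  l.\<close>

lemma many_zeros:
  fixes f :: "nat \<Rightarrow> real"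
  assumes f: "nonneg_fun f" "additive_fun f" and c: "c > 0"
    and sm: "summable (\<lambda>p. if prime p then min 1 \<bar>f p - c\<bar> / real p else 0)"
    and b: "b \<ge> 2" and y: "y > 1/2"
  defines "\<kappa> \<equiv> (y - 1/2) * (1 - 1 / real b) / (8 * y)"
  shows "\<exists>N\<ge>N0. real (occ_count b f y [0] (tot_len b y N)) \<ge> (1 / real b + \<kappa>) * real (tot_len b y N)"
proof -
  define \<Delta> where "\<Delta> = (y - 1/2) * (1 - 1 / real b)"
  have b1: "1 / real b < 1" "1 / real b > 0" using b by auto
  have \<Delta>: "\<Delta> > 0" unfolding \<Delta>_def using y b1 by (intro mult_pos_pos) auto
  have \<kappa>: "\<kappa> > 0" "\<kappa> * (8 * y) = \<Delta>" using \<Delta> y by (auto simp: \<kappa>_def \<Delta>_def)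
  have y0: "y > 0" using y by simp
  have lb: "ln (real b) > 0" using b by simp
  \<comment> \<open>The bound 1/8 gives \<epsilon> < 1/2, the bound 1/b keeps the density 1/b -
    \<epsilon> non-negative, and the last bound limits all losses proportional to \<epsilon> l to a
    quarter of the surplus.\<close>
  define \<epsilon> where "\<epsilon> = min (1/8) (min (1 / real b) (\<Delta> / (4 * (y + 3))))"
  have eps: "\<epsilon> > 0" "\<epsilon> < 1/2" "\<epsilon> \<le> 1 / real b" "\<epsilon> * (y + 3) \<le> \<Delta> / 4"
  proof -
    show "\<epsilon> > 0" using \<Delta> y b1 by (simp add: \<epsilon>_def)
    have "\<epsilon> * (y + 3) \<le> \<Delta> / (4 * (y + 3)) * (y + 3)" using y by (intro mult_right_mono) (auto simp: \<epsilon>_def)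
    also have "\<dots> = \<Delta> / 4" using y by (simp add: field_simps)
    finally show "\<epsilon> * (y + 3) \<le> \<Delta> / 4" .
  qed (auto simp: \<epsilon>_def)
  have a: "set [0] \<subseteq> {..<b}" "[0::nat] \<noteq> []" using b by auto
  obtain C where C: "\<And>N0. \<exists>N\<ge>N0. \<exists>m J. J \<le> m \<and> real J \<le> ln (ll N) / ln (real b) / 2 + C \<and>
     real (card {n\<in>{1..N}. \<not> (b ^ m \<le> int_part f n \<and> int_part f n < b ^ m + b ^ J)}) \<le> \<epsilon> * real N"
    using additive_concentrated[OF f(2) c sm b eps(1)] by blast
  have 1: "eventually (\<lambda>N. \<forall>j. ll N powr \<epsilon> \<le> real b ^ (j + length [0::nat]) \<and> real b ^ (j + length [0::nat]) \<le> ll N powr (1/2 - \<epsilon>) \<longrightarrow>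
     \<bar>real (card {n\<in>{1..N}. hit b f [0] n j}) - real N / real (b ^ length [0::nat])\<bar> \<le> \<epsilon> * real N) sequentially"
    by (rule hit_equidistributed[OF f c sm eps(1,1) b a(1)])
  have 2: "eventually (\<lambda>N. \<bar>C\<bar> + 20 \<le> \<Delta> / 4 * (ln (ll N) / ln (real b))) sequentially"
    by (rule eventually_ll_compose) (use \<Delta> lb in real_asymp)
  have 3: "eventually (\<lambda>N. 1 \<le> y * (ln (ll N) / ln (real b))) sequentially"
    by (rule eventually_ll_compose) (use y0 lb in real_asymp)
  have 4: "eventually (\<lambda>N. 1 \<le> \<kappa> / 2 * (y * (ln (ll N) / ln (real b)))) sequentially"
    by (rule eventually_ll_compose) (use y0 lb \<kappa>(1) in real_asymp)
  have 5: "eventually (\<lambda>N. real N * real (K_len b y (real N)) - real (tot_len b y N) \<le>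
     \<kappa> / 2 * (real N * real (K_len b y (real N)))) sequentially"
    by (rule tot_len_asymp[OF b y0]) (use \<kappa> in simp)
  \<comment> \<open>Quantified over all m and J, because suitable pairs exist only for infinitely
    many N and are inserted at the end.\<close>
  have "eventually (\<lambda>N. \<forall>m J. J \<le> m \<and> real J \<le> ln (ll N) / ln (real b) / 2 + C \<and>
     real (card {n\<in>{1..N}. \<not> (b ^ m \<le> int_part f n \<and> int_part f n < b ^ m + b ^ J)}) \<le> \<epsilon> * real N \<longrightarrow>
     real (occ_count b f y [0] (tot_len b y N)) \<ge> (1 / real b + \<kappa>) * real (tot_len b y N)) sequentially"
    using 1 2 3 4 5 K_len_bounds[OF b y0] eventually_ll_ge[of 1]
  proof eventually_elim
    case (elim N)
    define K where "K = K_len b y (real N)"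
    define l where "l = ln (ll N) / ln (real b)"
    have l: "l \<ge> 0" "y * l \<le> real K" "real K \<le> y * l + 1" using elim(6) by (auto simp: l_def K_def)
    show ?case
    proof (intro allI impI)
      fix m J
      assume mJ: "J \<le> m \<and> real J \<le> ln (ll N) / ln (real b) / 2 + C \<and>
         real (card {n\<in>{1..N}. \<not> (b ^ m \<le> int_part f n \<and> int_part f n < b ^ m + b ^ J)}) \<le> \<epsilon> * real N"
      let ?c = "\<lambda>j. card {n\<in>{1..N}. hit b f [0] n j}"
      define K' where "K' = nat \<lfloor>l / 2\<rfloor>"
      have K': "real K' \<le> l / 2" "l / 2 < real K' + 1" unfolding K'_def using l by linarith+
      have yl: "1/2 * l \<le> y * l" using y l by (intro mult_right_mono) auto
      have K'K: "K' \<le> K" using K' l yl by linarith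
      \<comment> \<open>\<open>G\<close> holds the equidistributed positions in the lower half,
        \<open>Z\<close> the upper ones without the leading digit at m. The maximum with K' in
        \<open>Z\<close> keeps the two disjoint.\<close>
      define G where "G = {j\<in>{..<K'}. ll N powr \<epsilon> \<le> real b ^ (j + 1) \<and> real b ^ (j + 1) \<le> ll N powr (1/2 - \<epsilon>)}"
      define Z where "Z = {max J K'..<K} - {m}"
      have cardG: "real (card G) \<ge> l / 2 - 2 * \<epsilon> * l - 6"
      proof -
        define B where "B = {j\<in>{..<K'}. \<not> (ll N powr \<epsilon> \<le> real b ^ (j + 1) \<and> real b ^ (j + 1) \<le> ll N powr (1/2 - \<epsilon>))}"
        have "real (card B) \<le> 2 * \<epsilon> * l + real (1::nat) + 4"
          unfolding l_def B_def by (rule card_bad_exponents[OF b elim(7) eps(1,2)]) (use K' in \<open>simp add: l_def\<close>)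
        moreover have "card {..<K'} \<le> card G + card B"
        proof -
          have "{..<K'} = G \<union> B" by (auto simp: G_def B_def)
          thus ?thesis using card_Un_le[of G B] by simp
        qed
        ultimately show ?thesis using K' by simp
      qed
      have cardZ: "real (card Z) \<ge> real K - l / 2 - \<bar>C\<bar> - 1"
      proof -
        have "card {max J K'..<K} \<le> card Z + 1" unfolding Z_def
          by (cases "m \<in> {max J K'..<K}") (auto simp: card_Diff_singleton)
        hence "real K - real (max J K') \<le> real (card Z) + 1" by simp
        moreover have "real (max J K') \<le> l / 2 + \<bar>C\<bar>" using mJ K' by (auto simp: l_def max_def)
        ultimately show ?thesis by linarith
      qed
      have hG: "real (?c j) \<ge> (1 / real b - \<epsilon>) * real N" if "j \<in> G" for j
      proof -
        have "\<bar>real (?c j) - real N / real (b ^ length [0::nat])\<bar> \<le> \<epsilon> * real N"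
          using elim(1) that unfolding G_def by simp
        thus ?thesis by (simp add: left_diff_distrib abs_le_iff)
      qed
      have hZ: "real (?c j) \<ge> (1 - \<epsilon>) * real N" if "j \<in> Z" for j
      proof -
        let ?X = "{n\<in>{1..N}. \<not> (b ^ m \<le> int_part f n \<and> int_part f n < b ^ m + b ^ J)}"
        have "{1..N} \<subseteq> {n\<in>{1..N}. hit b f [0] n j} \<union> ?X"
          using hit_zero_of_interval[OF b, of m f _ J j] mJ that by (auto simp: Z_def)
        hence "card {1..N} \<le> card ({n\<in>{1..N}. hit b f [0] n j} \<union> ?X)" by (intro card_mono) auto
        also have "\<dots> \<le> ?c j + card ?X" by (rule card_Un_le)
        finally have "real N \<le> real (?c j) + real (card ?X)" by simp
        moreover have "real (card ?X) \<le> \<epsilon> * real N" using mJ by blast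
        ultimately show ?thesis by (simp add: left_diff_distrib)
      qed
      have GZ: "G \<inter> Z = {}" "G \<union> Z \<subseteq> {..<K}" "finite G" "finite Z"
        using K'K by (auto simp: G_def Z_def)
      define V where "V = real (hit_count b f y [0] N)"
      have V: "V \<ge> real N * ((1 / real b - \<epsilon>) * (l / 2 - 2 * \<epsilon> * l - 6) + (1 - \<epsilon>) * (real K - l / 2 - \<bar>C\<bar> - 1))"
      proof -
        have g1: "(1 / real b - \<epsilon>) * (l / 2 - 2 * \<epsilon> * l - 6) \<le> (1 / real b - \<epsilon>) * real (card G)"
          using cardG eps by (intro mult_left_mono) auto
        have g2: "(1 - \<epsilon>) * (real K - l / 2 - \<bar>C\<bar> - 1) \<le> (1 - \<epsilon>) * real (card Z)"
          using cardZ eps by (intro mult_left_mono) auto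
        have "real N * ((1 / real b - \<epsilon>) * (l / 2 - 2 * \<epsilon> * l - 6) + (1 - \<epsilon>) * (real K - l / 2 - \<bar>C\<bar> - 1))
          \<le> real N * ((1 / real b - \<epsilon>) * real (card G) + (1 - \<epsilon>) * real (card Z))"
          by (rule mult_left_mono[OF add_mono[OF g1 g2]]) simp
        also have "\<dots> = (\<Sum>j\<in>G. (1 / real b - \<epsilon>) * real N) + (\<Sum>j\<in>Z. (1 - \<epsilon>) * real N)"
          by (simp add: algebra_simps)
        also have "\<dots> \<le> (\<Sum>j\<in>G. real (?c j)) + (\<Sum>j\<in>Z. real (?c j))"
          by (intro add_mono sum_mono hG hZ)
        also have "\<dots> = (\<Sum>j\<in>G \<union> Z. real (?c j))" using GZ by (simp add: sum.union_disjoint)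
        also have "\<dots> \<le> (\<Sum>j<K. real (?c j))" using GZ by (intro sum_mono2) auto
        also have "\<dots> = V" by (simp add: V_def hit_count_def K_def)
        finally show ?thesis .
      qed
      \<comment> \<open>The surplus \<Delta> l is spent as a quarter on the \<epsilon> terms, a
        quarter on constants, and half on 2 \<kappa> K. Of the 2 \<kappa>, one \<kappa> pays below
        for the unequal block lengths and the block ends.\<close>
      have num: "(1 / real b - \<epsilon>) * (l / 2 - 2 * \<epsilon> * l - 6) + (1 - \<epsilon>) * (real K - l / 2 - \<bar>C\<bar> - 1) \<ge> (1 / real b + 2 * \<kappa>) * real K"
      proof -
        define \<beta> where "\<beta> = 1 / real b"
        have \<beta>: "0 < \<beta>" "\<beta> < 1" using b1 by (auto simp: \<beta>_def)
        define h where "h = l / 2"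
        have el: "\<epsilon> * l \<ge> 0" using eps l by simp
        have eh: "\<epsilon> * h = (\<epsilon> * l) / 2" by (simp add: h_def)
        have e1: "(\<beta> - \<epsilon>) * (h - 2 * \<epsilon> * l - 6) = \<beta> * h - \<epsilon> * h - 2 * ((\<beta> - \<epsilon>) * (\<epsilon> * l)) - 6 * \<beta> + 6 * \<epsilon>"
          by (simp add: algebra_simps)
        have e2: "(\<beta> - \<epsilon>) * (\<epsilon> * l) \<le> 1 * (\<epsilon> * l)" using \<beta> eps el by (intro mult_right_mono) auto
        have p1: "(\<beta> - \<epsilon>) * (h - 2 * \<epsilon> * l - 6) \<ge> \<beta> * h - 5 / 2 * (\<epsilon> * l) - 6"
          using e1 e2 eh \<beta> eps(1) by linarith
        have e3: "(1 - \<epsilon>) * (real K - h - \<bar>C\<bar> - 1) = real K - h - \<bar>C\<bar> - 1 - \<epsilon> * real K + \<epsilon> * h + \<epsilon> * (\<bar>C\<bar> + 1)"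
          by (simp add: algebra_simps)
        have e4: "\<epsilon> * (\<bar>C\<bar> + 1) \<ge> 0" using eps by simp
        have "\<epsilon> * real K \<le> \<epsilon> * (y * l + 1)" using l eps by (intro mult_left_mono) auto
        also have "\<dots> = y * (\<epsilon> * l) + \<epsilon>" by (simp add: algebra_simps)
        finally have p2: "(1 - \<epsilon>) * (real K - h - \<bar>C\<bar> - 1) \<ge> real K - h - \<bar>C\<bar> - 2 - y * (\<epsilon> * l)"
          using e3 e4 eh el eps(2) by linarith
        have p3: "(1 - \<beta>) * real K \<ge> (1 - \<beta>) * (y * l)" using l \<beta> by (intro mult_left_mono) auto
        have p4: "(1 - \<beta>) * (y * l) - (1 - \<beta>) * h = \<Delta> * l"
        proof -
          have "(1 - \<beta>) * (y * l) - (1 - \<beta>) * h = (1 - \<beta>) * (y * l - h)" by (simp only: right_diff_distrib)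
          also have "y * l - h = (y - 1/2) * l" by (simp add: h_def left_diff_distrib)
          finally show ?thesis by (simp add: \<Delta>_def \<beta>_def)
        qed
        have "\<epsilon> * (y + 3) * l \<le> \<Delta> / 4 * l" by (rule mult_right_mono[OF eps(4) l(1)])
        hence p5: "y * (\<epsilon> * l) + 3 * (\<epsilon> * l) \<le> (\<Delta> * l) / 4" by (simp add: algebra_simps)
        have p6: "\<bar>C\<bar> + 20 \<le> (\<Delta> * l) / 4" using elim(2) by (simp add: l_def)
        have p7: "2 * \<kappa> * real K \<le> (\<Delta> * l) / 2"
        proof -
          have "1 \<le> y * l" using elim(3) by (simp add: l_def)
          hence "real K \<le> 2 * (y * l)" using l by linarith
          hence "2 * \<kappa> * real K \<le> 2 * \<kappa> * (2 * (y * l))" using \<kappa> by (intro mult_left_mono) auto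
          also have "\<dots> = \<kappa> * (8 * y) / 2 * l" by simp
          also have "\<dots> = \<Delta> / 2 * l" by (simp only: \<kappa>(2))
          finally show ?thesis by simp
        qed
        have "(\<beta> + 2 * \<kappa>) * real K = real K - (1 - \<beta>) * real K + 2 * \<kappa> * real K" by (simp add: algebra_simps)
        also have "\<dots> \<le> (\<beta> - \<epsilon>) * (h - 2 * \<epsilon> * l - 6) + (1 - \<epsilon>) * (real K - h - \<bar>C\<bar> - 1)"
        proof -
          have "(1 - \<beta>) * h = h - \<beta> * h" by (simp add: left_diff_distrib)
          thus ?thesis using p1 p2 p3 p4 p5 p6 p7 el by linarith
        qed
        finally show ?thesis by (simp only: \<beta>_def h_def)
      qed
      define NK where "NK = real N * real K"
      define T where "T = real (tot_len b y N)"
      define Q where "Q = real (occ_count b f y [0] (tot_len b y N))"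
      have "real N * ((1 / real b + 2 * \<kappa>) * real K) \<le> V"
        using mult_left_mono[OF num, of "real N"] V by linarith
      hence v1: "(1 / real b + 2 * \<kappa>) * NK \<le> V" by (simp add: NK_def mult_ac)
      have v2: "\<bar>Q - V\<bar> \<le> (NK - T) + real N"
        using occ_count_hit_count[OF b y0 a, of f N] by (simp add: Q_def V_def NK_def T_def K_def)
      have v3: "NK - T \<le> \<kappa> / 2 * NK" using elim(5) by (simp add: NK_def T_def K_def)
      have v4: "real N \<le> \<kappa> / 2 * NK"
      proof -
        have "\<kappa> / 2 * (y * l) \<le> \<kappa> / 2 * real K" using l \<kappa> by (intro mult_left_mono) auto
        moreover have "1 \<le> \<kappa> / 2 * (y * l)" using elim(4) by (simp only: l_def)
        ultimately have "1 \<le> \<kappa> / 2 * real K" by linarith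
        hence "1 * real N \<le> \<kappa> / 2 * real K * real N" by (intro mult_right_mono) auto
        thus ?thesis by (simp add: NK_def mult_ac)
      qed
      have v5: "T \<le> NK" unfolding T_def NK_def K_def by (rule tot_len_le[OF b y0])
      have "(1 / real b + \<kappa>) * T \<le> (1 / real b + \<kappa>) * NK" using v5 \<kappa> b1 by (intro mult_left_mono) auto
      also have "\<dots> = (1 / real b + 2 * \<kappa>) * NK - \<kappa> * NK" by (simp add: algebra_simps)
      also have "\<dots> \<le> Q" using v1 v2 v3 v4 by linarith
      finally show "real (occ_count b f y [0] (tot_len b y N)) \<ge> (1 / real b + \<kappa>) * real (tot_len b y N)"
        by (simp add: Q_def T_def)
    qed
  qed
  then obtain N1 where N1: "\<And>N m J. N \<ge> N1 \<Longrightarrow> J \<le> m \<and> real J \<le> ln (ll N) / ln (real b) / 2 + C \<and>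
     real (card {n\<in>{1..N}. \<not> (b ^ m \<le> int_part f n \<and> int_part f n < b ^ m + b ^ J)}) \<le> \<epsilon> * real N \<Longrightarrow>
     real (occ_count b f y [0] (tot_len b y N)) \<ge> (1 / real b + \<kappa>) * real (tot_len b y N)"
    unfolding eventually_sequentially by blast
  obtain N m J where N: "N \<ge> max N0 N1" "J \<le> m \<and> real J \<le> ln (ll N) / ln (real b) / 2 + C \<and>
     real (card {n\<in>{1..N}. \<not> (b ^ m \<le> int_part f n \<and> int_part f n < b ^ m + b ^ J)}) \<le> \<epsilon> * real N"
    using C[of "max N0 N1"] by blast
  have "N \<ge> N1" "N \<ge> N0" using N(1) by auto
  with N1[OF _ N(2)] show ?thesis by blast
qed

theorem theorem1p2:
  fixes b :: nat and f :: "nat \<Rightarrow> real" and y :: real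
  assumes "b \<ge> 2"
    and "nonneg_fun f" and "additive_fun f"
    and "almost_constant_on_primes f"
  shows "(0 < y \<and> y \<le> 1/2 \<longrightarrow> normal_in_base b (theta b f y)) \<and>
         (y > 1/2 \<and> weakly_additive f \<longrightarrow> \<not> normal_in_base b (theta b f y))"
proof -
  obtain c where c: "c > 0" "summable (\<lambda>p. if prime p then min 1 \<bar>f p - c\<bar> / real p else 0)"
    using almost_constant_summable[OF assms(4)] by blast
  show ?thesis
  proof (intro conjI impI)
    assume y: "0 < y \<and> y \<le> 1/2"
    show "normal_in_base b (theta b f y)"
    proof (rule normal_if_occ_counts[OF assms(1)])
      fix a :: "nat list" assume a: "set a \<subseteq> {..<b}" "a \<noteq> []"
      have \<beta>: "0 \<le> 1 / real (b ^ length a)" "1 / real (b ^ length a) \<le> 1" using assms(1) by auto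
      show "(\<lambda>X. real (occ_count b f y a X) / real X) \<longlonglongrightarrow> 1 / real (b ^ length a)"
      proof (rule occ_count_limit[OF assms(1) _ \<beta>])
        fix \<eta> :: real assume \<eta>: "\<eta> > 0"
        have "eventually (\<lambda>N. \<bar>real (occ_count b f y a (tot_len b y N)) - real (tot_len b y N) / real (b ^ length a)\<bar>
           \<le> \<eta> * real (tot_len b y N)) sequentially"
          by (rule occ_count_asymp[OF assms(1) _ a hit_count_asymp[OF assms(2,3) c assms(1) _ _ a(1)] \<eta>]) (use y in auto)
        thus "eventually (\<lambda>N. \<bar>real (occ_count b f y a (tot_len b y N)) - real (tot_len b y N) * (1 / real (b ^ length a))\<bar>
           \<le> \<eta> * real (tot_len b y N)) sequentially" by simp
      qed (use y in simp)
    qed (use y in simp)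
  next
    assume y: "y > 1/2 \<and> weakly_additive f"
    define \<kappa> where "\<kappa> = (y - 1/2) * (1 - 1 / real b) / (8 * y)"
    have "\<kappa> > 0"
      unfolding \<kappa>_def using y assms(1) by (intro divide_pos_pos mult_pos_pos) auto
    moreover have "\<exists>N\<ge>N0. real (occ_count b f y [0] (tot_len b y N)) \<ge> (1 / real b + \<kappa>) * real (tot_len b y N)" for N0
      unfolding \<kappa>_def by (rule many_zeros[OF assms(2,3) c assms(1)]) (use y in simp)
    ultimately show "\<not> normal_in_base b (theta b f y)"
      using y by (intro not_normal_if_many_zeros[OF assms(1)]) auto
  qed
qed

end
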